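(* Let $n\geqslant 3$, $0<\alpha\leqslant 2$, let $A$ be an arbitrary proper subset of $\mathbb R^n$ with $c_\alpha(A)>0$, and let $\mu\in\mathcal E^+$. Then there is a unique $\mu^A\in\mathcal E^+$ such that $$\mu^K\to\mu^A\quad\text{strongly and vaguely in }\mathcal E^+$$ as $K$ increases along the upper directed family $\mathfrak C_A$ of all compact subsets of $A$, where $\mu^K$ is the orthogonal projection of $\mu$ in $\mathcal E$ onto $\mathcal E^+_K$. This $\mu^A$ can alternatively be defined as the orthogonal projection of $\mu$ onto $\mathcal E_A'$, that is, $\mu^A\in\mathcal E'_A$ and $$\|\mu-\mu^A\|=\min_{\nu\in\mathcal E_A'}\|\mu-\nu\|.$$
   Context: $\mathfrak M$ is the space of real (signed) Radon measures on $\mathbb R^n$ with the vague topology, i.e. the topology of pointwise convergence on the continuous compactly supported functions. The mutual energy is $E(\nu,\nu_1)=\int|x-y|^{\alpha-n}\,d(\nu\otimes\nu_1)(x,y)$ and the energy is $E(\nu)=E(\nu,\nu)$. The measures $\nu\in\mathfrak M$ with finite energy form a pre-Hilbert space $\mathcal E$ with inner product $(\nu,\nu_1)=E(\nu,\nu_1)$ and norm $\|\nu\|=\sqrt{E(\nu)}$; the corresponding topology is called strong. $\mathcal E^+$ is the cone of positive measures in $\mathcal E$. For $Q\subset\mathbb R^n$, $\mathcal E^+_Q$ is the cone of all $\nu\in\mathcal E^+$ carried by $Q$, i.e. such that $Q$ is $\nu$-measurable and $Q^c=\mathbb R^n\setminus Q$ is $\nu$-negligible. The inner capacity is $c_\alpha(Q)=1/\inf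 E(\nu)$, where $\nu$ ranges over all $\nu\in\mathcal E^+_Q$ with $\nu(\mathbb R^n)=1$ (the infimum over the empty set is $+\infty$, $1/(+\infty)=0$, $1/0=+\infty$). $\mathcal E_A'$ is the closure of $\mathcal E^+_A$ in the strong topology (a strongly closed convex cone in $\mathcal E^+$). The orthogonal projection of $\mu\in\mathcal E^+$ onto a strongly closed convex cone $\mathcal M\subset\mathcal E^+$ containing $0$ is the unique element of $\mathcal M$ minimizing $\|\mu-\nu\|$ over $\nu\in\mathcal M$. (For $K$ compact, $\mathcal E^+_K$ is such a cone.) The limit along $\mathfrak C_A$ is the limit of a net, $\mathfrak C_A$ being directed by inclusion; only those $K$ with $c_\alpha(K)>0$ need be considered. *)

theory Defs
  imports "HOL-Analysis.Analysis"
begin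

section \<open>Radon measures\<close>

text \<open>On a Euclidean space the positive Radon measures are exactly the Borel measures that are
  finite on compact sets; regularity is then automatic.\<close>

definition radon_measure :: "'a::euclidean_space measure \<Rightarrow> bool" where
  "radon_measure P \<longleftrightarrow> sets P = sets borel \<and> (\<forall>K. compact K \<longrightarrow> emeasure P K < \<infinity>)"

text \<open>A signed Radon measure is a difference \<open>P - N\<close> of two positive Radon measures. As both may have
  infinite total mass, it is encoded by its values on the \<^emph>\<open>bounded\<close> Borel sets, with value
  \<open>0\<close> on all other sets, so that equality and subtraction of signed measures are equality
  and subtraction of functions. In particular \<open>\<nu> UNIV = 0\<close> by convention: the total mass of a positive
  \<open>\<nu>\<close> is \<open>emeasure (pos_part \<nu>) UNIV\<close>.\<close>

definition measure_diff :: "'a::euclidean_space measure \<Rightarrow> 'a measure \<Rightarrow> 'a set \<Rightarrow> real" where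
  "measure_diff P N B = (if B \<in> sets borel \<and> bounded B then measure P B - measure N B else 0)"

definition signed_radon :: "('a::euclidean_space set \<Rightarrow> real) set" where
  "signed_radon = {measure_diff P N | P N. radon_measure P \<and> radon_measure N}"

definition is_jordan_decomp ::
  "('a::euclidean_space set \<Rightarrow> real) \<Rightarrow> 'a measure \<Rightarrow> 'a measure \<Rightarrow> bool" where
  "is_jordan_decomp \<nu> P N \<longleftrightarrow>
     radon_measure P \<and> radon_measure N \<and> \<nu> = measure_diff P N \<and>
     (\<exists>S\<in>sets borel. emeasure P (- S) = 0 \<and> emeasure N S = 0)"

definition pos_part :: "('a::euclidean_space set \<Rightarrow> real) \<Rightarrow> 'a measure" where
  "pos_part \<nu> = fst (THE J. is_jordan_decomp \<nu> (fst J) (snd J))"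

definition neg_part :: "('a::euclidean_space set \<Rightarrow> real) \<Rightarrow> 'a measure" where
  "neg_part \<nu> = snd (THE J. is_jordan_decomp \<nu> (fst J) (snd J))"


section \<open>The vague topology\<close>

definition Cc :: "('a::euclidean_space \<Rightarrow> real) set" where
  "Cc = {\<phi>. continuous_on UNIV \<phi> \<and> compact (closure {x. \<phi> x \<noteq> 0})}"

definition signed_integral :: "('a::euclidean_space set \<Rightarrow> real) \<Rightarrow> ('a \<Rightarrow> real) \<Rightarrow> real" where
  "signed_integral \<nu> \<phi> = (\<integral>x. \<phi> x \<partial>pos_part \<nu>) - (\<integral>x. \<phi> x \<partial>neg_part \<nu>)"

definition vague_topology :: "('a::euclidean_space set \<Rightarrow> real) topology" where
  "vague_topology =
     pullback_topology signed_radon (\<lambda>\<nu>. \<lambda>\<phi>\<in>Cc. signed_integral \<nu> \<phi>)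
       (product_topology (\<lambda>_. euclideanreal) Cc)"


section \<open>Riesz energy and the strong topology\<close>

text \<open>The diagonal is treated separately because \<open>0 powr a = 0\<close>.\<close>

definition riesz_kernel :: "real \<Rightarrow> 'a::euclidean_space \<Rightarrow> 'a \<Rightarrow> ennreal" where
  "riesz_kernel \<alpha> x y =
     (if x = y then \<infinity> else ennreal (norm (x - y) powr (\<alpha> - real DIM('a))))"

definition pos_energy :: "real \<Rightarrow> 'a::euclidean_space measure \<Rightarrow> 'a measure \<Rightarrow> ennreal" where
  "pos_energy \<alpha> P Q = (\<integral>\<^sup>+(x, y). riesz_kernel \<alpha> x y \<partial>(P \<Otimes>\<^sub>M Q))"

text \<open>Integrability of the kernel with respect to the signed product measure, i.e. with respect to
  all four products of the positive and negative parts.\<close>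

definition finite_energy ::
  "real \<Rightarrow> ('a::euclidean_space set \<Rightarrow> real) \<Rightarrow> ('a set \<Rightarrow> real) \<Rightarrow> bool" where
  "finite_energy \<alpha> \<nu> \<nu>1 \<longleftrightarrow>
     (\<forall>P\<in>{pos_part \<nu>, neg_part \<nu>}. \<forall>Q\<in>{pos_part \<nu>1, neg_part \<nu>1}. pos_energy \<alpha> P Q < \<infinity>)"

text \<open>Only meaningful when \<open>finite_energy\<close> holds.\<close>

definition mutual_energy ::
  "real \<Rightarrow> ('a::euclidean_space set \<Rightarrow> real) \<Rightarrow> ('a set \<Rightarrow> real) \<Rightarrow> real" where
  "mutual_energy \<alpha> \<nu> \<nu>1 =
     enn2real (pos_energy \<alpha> (pos_part \<nu>) (pos_part \<nu>1))
   + enn2real (pos_energy \<alpha> (neg_part \<nu>) (neg_part \<nu>1))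
   - enn2real (pos_energy \<alpha> (pos_part \<nu>) (neg_part \<nu>1))
   - enn2real (pos_energy \<alpha> (neg_part \<nu>) (pos_part \<nu>1))"

abbreviation energy :: "real \<Rightarrow> ('a::euclidean_space set \<Rightarrow> real) \<Rightarrow> real" where
  "energy \<alpha> \<nu> \<equiv> mutual_energy \<alpha> \<nu> \<nu>"

definition energy_norm :: "real \<Rightarrow> ('a::euclidean_space set \<Rightarrow> real) \<Rightarrow> real" where
  "energy_norm \<alpha> \<nu> = sqrt (energy \<alpha> \<nu>)"

definition energy_space :: "real \<Rightarrow> ('a::euclidean_space set \<Rightarrow> real) set" where
  "energy_space \<alpha> = {\<nu> \<in> signed_radon. finite_energy \<alpha> \<nu> \<nu>}"

definition energy_cone :: "real \<Rightarrow> ('a::euclidean_space set \<Rightarrow> real) set" where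
  "energy_cone \<alpha> = {\<nu> \<in> energy_space \<alpha>. \<forall>B. 0 \<le> \<nu> B}"

definition strong_topology :: "real \<Rightarrow> ('a::euclidean_space set \<Rightarrow> real) topology" where
  "strong_topology \<alpha> = topology (\<lambda>U. U \<subseteq> energy_space \<alpha> \<and>
     (\<forall>\<nu>\<in>U. \<exists>\<epsilon>>0. \<forall>\<xi>\<in>energy_space \<alpha>. energy_norm \<alpha> (\<xi> - \<nu>) < \<epsilon> \<longrightarrow> \<xi> \<in> U))"

lemma openin_strong_topology:
  "openin (strong_topology \<alpha>) U \<longleftrightarrow> U \<subseteq> energy_space \<alpha> \<and>
     (\<forall>\<nu>\<in>U. \<exists>\<epsilon>>0. \<forall>\<xi>\<in>energy_space \<alpha>. energy_norm \<alpha> (\<xi> - \<nu>) < \<epsilon> \<longrightarrow> \<xi> \<in> U)"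
proof -
  define E :: "('a set \<Rightarrow> real) set" where "E = energy_space \<alpha>"
  define P where "P = (\<lambda>U. U \<subseteq> E \<and>
     (\<forall>\<nu>\<in>U. \<exists>\<epsilon>>0. \<forall>\<xi>\<in>E. energy_norm \<alpha> (\<xi> - \<nu>) < \<epsilon> \<longrightarrow> \<xi> \<in> U))"
  have "P (S \<inter> T)" if S: "P S" and T: "P T" for S T
    unfolding P_def
  proof (intro conjI ballI)
    show "S \<inter> T \<subseteq> E" using S by (auto simp: P_def)
    fix \<nu> assume "\<nu> \<in> S \<inter> T"
    then obtain a b where "a > 0" "\<forall>\<xi>\<in>E. energy_norm \<alpha> (\<xi> - \<nu>) < a \<longrightarrow> \<xi> \<in> S"
      and "b > 0" "\<forall>\<xi>\<in>E. energy_norm \<alpha> (\<xi> - \<nu>) < b \<longrightarrow> \<xi> \<in> T"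
      using S T unfolding P_def by blast
    then show "\<exists>\<epsilon>>0. \<forall>\<xi>\<in>E. energy_norm \<alpha> (\<xi> - \<nu>) < \<epsilon> \<longrightarrow> \<xi> \<in> S \<inter> T"
      by (intro exI[of _ "min a b"]) auto
  qed
  moreover have "P (\<Union>\<K>)" if "\<forall>K\<in>\<K>. P K" for \<K>
    unfolding P_def
  proof (intro conjI ballI)
    show "\<Union>\<K> \<subseteq> E" using that by (auto simp: P_def)
    fix \<nu> assume "\<nu> \<in> \<Union>\<K>"
    then obtain K where "K \<in> \<K>" "\<nu> \<in> K" by blast
    with that obtain a where "a > 0" "\<forall>\<xi>\<in>E. energy_norm \<alpha> (\<xi> - \<nu>) < a \<longrightarrow> \<xi> \<in> K"
      unfolding P_def by blast
    with \<open>K \<in> \<K>\<close> show "\<exists>\<epsilon>>0. \<forall>\<xi>\<in>E. energy_norm \<alpha> (\<xi> - \<nu>) < \<epsilon> \<longrightarrow> \<xi> \<in> \<Union>\<K>"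
      by blast
  qed
  ultimately have "istopology P" by (simp add: istopology_def)
  then show ?thesis
    by (simp add: strong_topology_def topology_inverse' P_def E_def)
qed


section \<open>Measures carried by a set, inner capacity, projections\<close>

text \<open>For Radon measures on a Euclidean space, the \<open>\<nu>\<close>-measurable and \<open>\<nu>\<close>-negligible sets
  are the measurable and the null sets of the completion of \<open>\<nu>\<close>.\<close>

definition carried_by :: "'a::euclidean_space measure \<Rightarrow> 'a set \<Rightarrow> bool" where
  "carried_by P Q \<longleftrightarrow> Q \<in> sets (completion P) \<and> - Q \<in> null_sets (completion P)"

definition energy_cone_on ::
  "real \<Rightarrow> 'a::euclidean_space set \<Rightarrow> ('a set \<Rightarrow> real) set" where
  "energy_cone_on \<alpha> Q = {\<nu> \<in> energy_cone \<alpha>. carried_by (pos_part \<nu>) Q}"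

definition inner_capacity :: "real \<Rightarrow> 'a::euclidean_space set \<Rightarrow> ennreal" where
  "inner_capacity \<alpha> Q =
     1 / (INF \<nu>\<in>{\<nu> \<in> energy_cone_on \<alpha> Q. emeasure (pos_part \<nu>) UNIV = 1}. ennreal (energy \<alpha> \<nu>))"

definition energy_cone_closure ::
  "real \<Rightarrow> 'a::euclidean_space set \<Rightarrow> ('a set \<Rightarrow> real) set" where
  "energy_cone_closure \<alpha> A = strong_topology \<alpha> closure_of energy_cone_on \<alpha> A"

definition is_orth_proj ::
  "real \<Rightarrow> ('a::euclidean_space set \<Rightarrow> real) set \<Rightarrow> ('a set \<Rightarrow> real) \<Rightarrow> ('a set \<Rightarrow> real) \<Rightarrow> bool" where
  "is_orth_proj \<alpha> M \<mu> p \<longleftrightarrow>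
     p \<in> M \<and> (\<forall>\<nu>\<in>M. energy_norm \<alpha> (\<mu> - p) \<le> energy_norm \<alpha> (\<mu> - \<nu>))"

definition orth_proj ::
  "real \<Rightarrow> ('a::euclidean_space set \<Rightarrow> real) set \<Rightarrow> ('a set \<Rightarrow> real) \<Rightarrow> ('a set \<Rightarrow> real)" where
  "orth_proj \<alpha> M \<mu> = (THE p. is_orth_proj \<alpha> M \<mu> p)"

text \<open>The filter of tails of the family of compact subsets of \<open>A\<close> directed by inclusion.\<close>

definition compact_subsets_at_top :: "'a::euclidean_space set \<Rightarrow> 'a set filter" where
  "compact_subsets_at_top A =
     (INF K\<in>{K. compact K \<and> K \<subseteq> A}. principal {K'. compact K' \<and> K' \<subseteq> A \<and> K \<subseteq> K'})"

lemma eventually_compact_subsets_at_top: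
  "eventually P (compact_subsets_at_top A) \<longleftrightarrow>
     (\<exists>K. compact K \<and> K \<subseteq> A \<and> (\<forall>K'. compact K' \<and> K' \<subseteq> A \<and> K \<subseteq> K' \<longrightarrow> P K'))"
  unfolding compact_subsets_at_top_def
proof (subst eventually_INF_base)
  show "{K. compact K \<and> K \<subseteq> A} \<noteq> {}" by (auto intro: exI[of _ "{}"])
  fix K L assume "K \<in> {K. compact K \<and> K \<subseteq> A}" "L \<in> {K. compact K \<and> K \<subseteq> A}"
  then show "\<exists>M\<in>{K. compact K \<and> K \<subseteq> A}. principal {K'. compact K' \<and> K' \<subseteq> A \<and> M \<subseteq> K'}
      \<le> inf (principal {K'. compact K' \<and> K' \<subseteq> A \<and> K \<subseteq> K'})
            (principal {K'. compact K' \<and> K' \<subseteq> A \<and> L \<subseteq> K'})"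
    by (intro bexI[of _ "K \<union> L"]) auto
qed (auto simp: eventually_principal)

definition sweeps_to ::
  "real \<Rightarrow> 'a::euclidean_space set \<Rightarrow> ('a set \<Rightarrow> real) \<Rightarrow> ('a set \<Rightarrow> real) \<Rightarrow> bool" where
  "sweeps_to \<alpha> A \<mu> \<mu>A \<longleftrightarrow>
     limitin (subtopology (strong_topology \<alpha>) (energy_cone \<alpha>))
       (\<lambda>K. orth_proj \<alpha> (energy_cone_on \<alpha> K) \<mu>) \<mu>A (compact_subsets_at_top A) \<and>
     limitin (subtopology vague_topology (energy_cone \<alpha>))
       (\<lambda>K. orth_proj \<alpha> (energy_cone_on \<alpha> K) \<mu>) \<mu>A (compact_subsets_at_top A)"

end

theory Submission
  imports Defs
begin

text \<open>The Riesz kernel is a superposition of indicators of balls: with a suitable constant \<open>c\<close> it is the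
  integral of \<open>1\<^bsub>B(z, r)\<^esub>(x) 1\<^bsub>B(z, r)\<^esub>(y)\<close> with respect to \<open>c r\<^bsup>\<alpha> - 2 n - 1\<^esup> dz dr\<close>.
  Hence \<open>E(\<nu>)\<close> is the squared \<open>L\<^sup>2\<close> norm of the function \<open>(z, r) \<mapsto> \<nu>(B(z, r))\<close>, which depends linearly on
  \<open>\<nu>\<close> and determines \<open>\<nu>\<close>, so that the energy norm is a pre-Hilbert norm. As a continuous function is
  nearly equal to its means over small balls, strong convergence of positive measures implies vague
  convergence. A strong Cauchy sequence of positive measures therefore converges, on the continuous
  compactly supported functions, to a positive functional, which the Riesz--Markov theorem represents
  by a measure; by Fatou's lemma that measure is the strong limit. Thus the cone of positive measures is
  complete, and projections exist by the parallelogram law. By inner regularity the cones of the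
  compact subsets of \<open>A\<close> are strongly dense in the cone of \<open>A\<close>, and the convergence of the projections
  follows, again from the parallelogram law.\<close>

section \<open>Continuous functions with compact support\<close>

text \<open>Signed measures of finite energy need not form a complete space (already in the
  Newtonian case \<alpha> = 2), so the Hilbert space projection theorem cannot simply be quoted;
  limits have to be produced as measures. Positivity makes this possible: the energy of a positive
  measure bounds its mass on every compact set, because all sufficiently large balls with centre
  near the origin contain that set. The exponent \<open>\<alpha> - 2 * n - 1\<close> is forced by
  homogeneity: it is the only one for which the integral over balls scales like the Riesz kernel.
  Vague convergence controls the mass of a ball only if the limit does not charge the boundary
  sphere. This fails for a null set of balls at most, which is harmless for Fatou's lemma. The
  passage from strong to vague convergence is an estimate uniform in the measures, so it serves
  Cauchy sequences and the net of compact sets alike. Along that net the distance from \<mu> to the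
  cone of K approaches the distance to the closure, and every near minimizer is close to the
  projection.\<close>

lemma Cc_iff: "f \<in> Cc \<longleftrightarrow> continuous_on UNIV f \<and> (\<exists>R. \<forall>x. R < norm x \<longrightarrow> f x = 0)"
  for f :: "'a::euclidean_space \<Rightarrow> real"
proof
  assume f: "f \<in> Cc"
  then have "bounded (closure {x. f x \<noteq> 0})" by (auto simp: Cc_def compact_eq_bounded_closed)
  then obtain R where "\<forall>x\<in>closure {x. f x \<noteq> 0}. norm x \<le> R" by (auto simp: bounded_iff)
  then have "\<forall>x. R < norm x \<longrightarrow> f x = 0" using closure_subset[of "{x. f x \<noteq> 0}"] by force
  with f show "continuous_on UNIV f \<and> (\<exists>R. \<forall>x. R < norm x \<longrightarrow> f x = 0)" by (auto simp: Cc_def)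
next
  assume f: "continuous_on UNIV f \<and> (\<exists>R. \<forall>x. R < norm x \<longrightarrow> f x = 0)"
  then obtain R where "\<forall>x. R < norm x \<longrightarrow> f x = 0" by auto
  then have "{x. f x \<noteq> 0} \<subseteq> cball 0 R" by (force simp: not_less[symmetric])
  then have "bounded {x. f x \<noteq> 0}" using bounded_cball bounded_subset by blast
  then show "f \<in> Cc" using f by (auto simp: Cc_def compact_closure)
qed

lemma CcI: "continuous_on UNIV f \<Longrightarrow> (\<And>x. R < norm x \<Longrightarrow> f x = 0) \<Longrightarrow> f \<in> Cc"
  by (auto simp: Cc_iff)

lemma Cc_continuous: "f \<in> Cc \<Longrightarrow> continuous_on UNIV f"
  by (simp add: Cc_iff)

lemma Cc_measurable: "f \<in> Cc \<Longrightarrow> f \<in> borel_measurable borel"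
  by (simp add: Cc_iff borel_measurable_continuous_onI)

lemma Cc_add: "f \<in> Cc \<Longrightarrow> g \<in> Cc \<Longrightarrow> (\<lambda>x. f x + g x) \<in> Cc"
proof -
  assume "f \<in> Cc" "g \<in> Cc"
  then obtain R S where "\<forall>x. R < norm x \<longrightarrow> f x = 0" "\<forall>x. S < norm x \<longrightarrow> g x = 0"
      "continuous_on UNIV f" "continuous_on UNIV g"
    by (auto simp: Cc_iff)
  then show ?thesis by (intro CcI[where R="max R S"] continuous_intros) auto
qed

lemma Cc_comp: "f \<in> Cc \<Longrightarrow> continuous_on UNIV h \<Longrightarrow> h 0 = 0 \<Longrightarrow> (\<lambda>x. h (f x)) \<in> Cc"
proof -
  assume f: "f \<in> Cc" and h: "continuous_on UNIV h" "h 0 = 0"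
  obtain R where "\<And>x. R < norm x \<Longrightarrow> f x = 0" using f by (auto simp: Cc_iff)
  then show ?thesis
    using h continuous_on_compose2[OF h(1) Cc_continuous[OF f]] by (intro CcI[where R=R]) auto
qed

lemma Cc_mult: "f \<in> Cc \<Longrightarrow> continuous_on UNIV g \<Longrightarrow> (\<lambda>x. f x * g x) \<in> Cc"
  by (auto simp: Cc_iff intro!: continuous_intros)

lemma Cc_scale: "f \<in> Cc \<Longrightarrow> (\<lambda>x. c * f x) \<in> Cc"
  by (auto simp: Cc_iff intro!: continuous_intros)

lemma Cc_diff: "f \<in> Cc \<Longrightarrow> g \<in> Cc \<Longrightarrow> (\<lambda>x. f x - g x) \<in> Cc"
  using Cc_add[of f "\<lambda>x. (-1) * g x"] Cc_scale[of g "-1"] by simp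

lemma Cc_max: "f \<in> Cc \<Longrightarrow> g \<in> Cc \<Longrightarrow> (\<lambda>x. max (f x) (g x)) \<in> Cc"
proof -
  assume "f \<in> Cc" "g \<in> Cc"
  then obtain R S where "\<forall>x. R < norm x \<longrightarrow> f x = 0" "\<forall>x. S < norm x \<longrightarrow> g x = 0"
      "continuous_on UNIV f" "continuous_on UNIV g"
    by (auto simp: Cc_iff)
  then show ?thesis by (intro CcI[where R="max R S"] continuous_intros) auto
qed

lemma Cc_sum: "finite I \<Longrightarrow> (\<And>i. i \<in> I \<Longrightarrow> f i \<in> Cc) \<Longrightarrow> (\<lambda>x. \<Sum>i\<in>I. f i x) \<in> Cc"
  by (induction I rule: finite_induct) (auto intro!: Cc_add simp: Cc_iff[of "\<lambda>x. 0"])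

lemma Cc_bounded: assumes "f \<in> Cc" obtains B where "B > 0" "\<And>x. \<bar>f x\<bar> \<le> B"
proof -
  obtain R where R: "\<forall>x. R < norm x \<longrightarrow> f x = 0" "continuous_on UNIV f"
    using assms by (auto simp: Cc_iff)
  then have "compact (f ` cball 0 R)"
    by (intro compact_continuous_image) (auto intro: continuous_on_subset)
  then obtain B where "\<forall>y\<in>f ` cball 0 R. norm y \<le> B" using compact_imp_bounded bounded_iff by metis
  then have "\<bar>f x\<bar> \<le> max B 1" for x
  proof (cases "norm x \<le> R")
    case True
    then have "f x \<in> f ` cball 0 R" by (intro imageI) simp
    then show ?thesis using \<open>\<forall>y\<in>f ` cball 0 R. norm y \<le> B\<close> by force
  qed (use R(1) in auto)
  then show ?thesis by (intro that[of "max B 1"]) auto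
qed

text \<open>A cutoff that majorizes every function with values in [0, 1] vanishing outside the ball
  of radius R; it bounds a positive functional locally.\<close>

definition plateau :: "real \<Rightarrow> 'a::euclidean_space \<Rightarrow> real" where
  "plateau R x = max 0 (min 1 (R + 1 - norm x))"

lemma plateau: "plateau R \<in> Cc" "0 \<le> plateau R x" "plateau R x \<le> 1" "norm x \<le> R \<Longrightarrow> plateau R x = 1"
  unfolding plateau_def by (auto intro!: CcI[where R="R+1"] continuous_intros)

lemma compact_superlevel: "f \<in> Cc \<Longrightarrow> e > 0 \<Longrightarrow> compact {x. e \<le> f x}"
  unfolding compact_eq_bounded_closed
proof
  assume f: "f \<in> Cc" "e > 0"
  then obtain R where "\<forall>x. R < norm x \<longrightarrow> f x = 0" by (auto simp: Cc_iff)
  with f have "{x. e \<le> f x} \<subseteq> cball 0 R" by (force simp: not_less[symmetric])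
  then show "bounded {x. e \<le> f x}" using bounded_cball bounded_subset by blast
  show "closed {x. e \<le> f x}" using f by (intro closed_Collect_le continuous_intros Cc_continuous)
qed

lemma open_positive_function:
  fixes U :: "'a::euclidean_space set"
  assumes "open U" obtains d :: "'a \<Rightarrow> real" where "continuous_on UNIV d" "\<And>x. 0 \<le> d x" "\<And>x. 0 < d x \<longleftrightarrow> x \<in> U"
\<comment> \<open>\<open>infdist\<close> to the empty set is 0 by convention, so the whole space
  needs its own function.\<close>
proof (cases "U = UNIV")
  case True then show ?thesis by (intro that[of "\<lambda>_. 1"]) auto
next
  case False
  then have "infdist x (-U) = 0 \<longleftrightarrow> x \<in> -U" for x
    using in_closed_iff_infdist_zero[of "-U"] assms by auto
  then have "0 < infdist x (-U) \<longleftrightarrow> x \<in> U" for x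
    using infdist_nonneg[of x "-U"] by (metis ComplD ComplI less_eq_real_def order_less_irrefl)
  then show ?thesis by (intro that[of "\<lambda>x. infdist x (-U)"]) (auto intro!: continuous_intros infdist_nonneg)
qed

text \<open>Approximating a from below avoids subtraction on \<open>ennreal\<close>. For a = 0 there
  is no smaller s, and the second premise takes over.\<close>

lemma ennreal_add_le_of_less:
  fixes a b c :: ennreal
  assumes "\<And>s. s < a \<Longrightarrow> s + b \<le> c" "b \<le> c" shows "a + b \<le> c"
proof (cases "a = 0")
  case False
  then have "0 \<in> {..<a}" by (simp add: zero_less_iff_neq_zero)
  then have ne: "{..<a} \<noteq> {}" by auto
  have "a = (SUP s\<in>{..<a}. s)" using Sup_lessThan[of a] by simp
  then have "a + b = (SUP s\<in>{..<a}. s + b)" using ennreal_SUP_add_left[OF ne, of "\<lambda>s. s" b] by simp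
  also have "\<dots> \<le> c" using assms by (intro SUP_least) auto
  finally show ?thesis .
qed (use assms in auto)

lemma radon_integrable_Cc:
  assumes "radon_measure M" "f \<in> Cc" shows "integrable M f"
proof -
  obtain R where R: "\<And>x. R < norm x \<Longrightarrow> f x = 0" using assms by (auto simp: Cc_iff)
  obtain B where B: "\<And>x. \<bar>f x\<bar> \<le> B" using Cc_bounded[OF assms(2)] by metis
  have s: "sets M = sets borel" using assms by (simp add: radon_measure_def)
  have "integrable M (\<lambda>x. B * indicator (cball 0 R) x :: real)"
    using assms by (intro integrable_mult_right integrable_real_indicator) (auto simp: radon_measure_def s)
  then show ?thesis
  proof (rule Bochner_Integration.integrable_bound)
    show "f \<in> borel_measurable M" using Cc_measurable[OF assms(2)] measurable_cong_sets[OF s refl] by blast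
    have "\<bar>f x\<bar> \<le> \<bar>B * indicator (cball 0 R) x\<bar>" for x
      using B[of x] R[of x] by (cases "norm x \<le> R") (auto simp: indicator_def)
    then show "AE x in M. norm (f x) \<le> norm (B * indicator (cball 0 R) x :: real)" by simp
  qed
qed

section \<open>The Riesz--Markov theorem\<close>

locale positive_functional =
  fixes L :: "('a::euclidean_space \<Rightarrow> real) \<Rightarrow> real"
  assumes add: "f \<in> Cc \<Longrightarrow> g \<in> Cc \<Longrightarrow> L (\<lambda>x. f x + g x) = L f + L g"
    and scale: "f \<in> Cc \<Longrightarrow> L (\<lambda>x. c * f x) = c * L f"
    and nonneg: "f \<in> Cc \<Longrightarrow> (\<And>x. 0 \<le> f x) \<Longrightarrow> 0 \<le> L f"
begin

lemma diff: "f \<in> Cc \<Longrightarrow> g \<in> Cc \<Longrightarrow> L (\<lambda>x. f x - g x) = L f - L g"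
  using add[of f "\<lambda>x. (-1) * g x"] scale[of g "-1"] Cc_scale[of g "-1"] by simp

lemma mono: "f \<in> Cc \<Longrightarrow> g \<in> Cc \<Longrightarrow> (\<And>x. f x \<le> g x) \<Longrightarrow> L f \<le> L g"
  using nonneg[OF Cc_diff[of g f]] diff[of g f] by simp

lemma sum: "finite I \<Longrightarrow> (\<And>i. i \<in> I \<Longrightarrow> f i \<in> Cc) \<Longrightarrow> L (\<lambda>x. \<Sum>i\<in>I. f i x) = (\<Sum>i\<in>I. L (f i))"
proof (induction I rule: finite_induct)
  case empty
  show ?case using scale[of "\<lambda>_. 0" 0] by (simp add: Cc_iff)
next
  case (insert i F)
  then show ?case using add[of "f i" "\<lambda>x. \<Sum>i\<in>F. f i x"] Cc_sum[of F f] by simp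
qed

section \<open>The outer measure induced by a positive functional\<close>

text \<open>Only vanishing outside U is asked, not a compact support inside U. Such functions are
  easier to build, and truncation supplies a compact set when one is needed.\<close>

definition below :: "'a set \<Rightarrow> ('a \<Rightarrow> real) set" where
  "below U = {f \<in> Cc. \<forall>x. 0 \<le> f x \<and> f x \<le> 1 \<and> (x \<notin> U \<longrightarrow> f x = 0)}"

definition open_mass :: "'a set \<Rightarrow> ennreal" where
  "open_mass U = (SUP f\<in>below U. ennreal (L f))"

definition outer_mass :: "'a set \<Rightarrow> ennreal" where
  "outer_mass E = (INF U\<in>{U. open U \<and> E \<subseteq> U}. open_mass U)"

lemma zero_below: "(\<lambda>_. 0) \<in> below U"
  by (simp add: below_def Cc_iff)

lemma open_mass_mono: "U \<subseteq> V \<Longrightarrow> open_mass U \<le> open_mass V"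
  unfolding open_mass_def by (rule SUP_subset_mono) (auto simp: below_def)

lemma open_mass_empty: "open_mass {} = 0"
proof -
  have "below {} = {\<lambda>_. 0}" using zero_below by (auto simp: below_def)
  then show ?thesis using scale[of "\<lambda>_. 0" 0] by (simp add: open_mass_def Cc_iff)
qed

lemma below_mass: "f \<in> below U \<Longrightarrow> ennreal (L f) \<le> open_mass U"
  unfolding open_mass_def by (rule SUP_upper)

lemma outer_mass_open: "open U \<Longrightarrow> outer_mass U = open_mass U"
  unfolding outer_mass_def by (rule antisym) (auto intro: INF_lower2 INF_greatest open_mass_mono)

lemma outer_mass_mono: "E \<subseteq> F \<Longrightarrow> outer_mass E \<le> outer_mass F"
  unfolding outer_mass_def by (rule INF_superset_mono) auto

text \<open>Truncation: \<open>max 0 (f x - e)\<close> vanishes outside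
  \<open>{x. e \<le> f x}\<close>, a compact subset of U. As f is at most this truncation plus e
  times a cutoff, the functional loses at most \<open>e * L (plateau R)\<close>.\<close>

lemma open_mass_approx:
  assumes "s < open_mass U"
  obtains f K where "f \<in> below U" "compact K" "K \<subseteq> U" "\<And>x. x \<notin> K \<Longrightarrow> f x = 0" "s < ennreal (L f)"
proof -
  obtain f where f: "f \<in> below U" "s < ennreal (L f)"
    using assms by (auto simp: open_mass_def less_SUP_iff)
  then have fC: "f \<in> Cc" and f01: "\<And>x. 0 \<le> f x" "\<And>x. f x \<le> 1" "\<And>x. x \<notin> U \<Longrightarrow> f x = 0"
    by (auto simp: below_def)
  obtain R where R: "\<And>x. R < norm x \<Longrightarrow> f x = 0" using fC by (auto simp: Cc_iff)
  obtain t where t: "s = ennreal t" "0 \<le> t" "t < L f"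
    using f(2) by (cases s) (auto simp: ennreal_less_iff)
  \<comment> \<open>Small enough that \<open>e * L (plateau R)\<close> stays below the margin
    \<open>L f - t\<close>; the summand 1 guards against division by zero.\<close>
  define e where "e = (L f - t) / (L (plateau R) + 1) / 2"
  have P0: "0 \<le> L (plateau R)" using plateau by (intro nonneg) auto
  have e: "e > 0" using t P0 by (auto simp: e_def)
  have eL: "e * L (plateau R) < L f - t"
  proof -
    have "e * L (plateau R) < e * ((L (plateau R) + 1) * 2)" using e P0 by (intro mult_strict_left_mono) auto
    also have "\<dots> = L f - t" using P0 by (simp add: e_def field_simps)
    finally show ?thesis .
  qed
  define g where "g = (\<lambda>x. max 0 (f x - e))"
  have gC: "g \<in> Cc" unfolding g_def using e
    by (intro Cc_comp[OF fC, of "\<lambda>y. max 0 (y - e)"]) (auto intro!: continuous_intros)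
  have "L f \<le> L (\<lambda>x. g x + e * plateau R x)"
    using fC gC plateau(1) f01(1) e
  proof (intro mono Cc_add Cc_scale)
    fix x show "f x \<le> g x + e * plateau R x"
      using R[of x] f01(1)[of x] e plateau(2)[of R x] plateau(4)[of x R] by (cases "norm x \<le> R") (auto simp: g_def max_def)
  qed auto
  also have "\<dots> = L g + e * L (plateau R)" using add[OF gC Cc_scale[OF plateau(1), of e R]] scale[OF plateau(1), of e R] by simp
  finally have "t < L g" using eL by simp
  show ?thesis
  proof (rule that[of g "{x. e \<le> f x}"])
    show "g \<in> below U" unfolding below_def mem_Collect_eq
    proof (intro conjI gC allI impI)
      fix x show "0 \<le> g x" by (simp add: g_def)
      show "g x \<le> 1" using f01(2)[of x] e by (simp add: g_def)
      show "x \<notin> U \<Longrightarrow> g x = 0" using f01(3)[of x] e by (simp add: g_def)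
    qed
    show "compact {x. e \<le> f x}" by (rule compact_superlevel[OF fC e])
    show "{x. e \<le> f x} \<subseteq> U" using f01 e by force
    show "\<And>x. x \<notin> {x. e \<le> f x} \<Longrightarrow> g x = 0" by (auto simp: g_def)
    show "s < ennreal (L g)" using t \<open>t < L g\<close> by (simp add: ennreal_less_iff)
  qed
qed

text \<open>A partition of unity on the compact set K outside which f vanishes splits f into
  finitely many functions, each below a single \<open>U i\<close>.\<close>

lemma open_mass_subadditive:
  fixes U :: "nat \<Rightarrow> 'a set"
  assumes U: "\<And>i. open (U i)"
  shows "open_mass (\<Union>i. U i) \<le> (\<Sum>i. open_mass (U i))"
proof (rule dense_le)
  fix s assume "s < open_mass (\<Union>i. U i)"
  then obtain f K where f: "f \<in> below (\<Union>i. U i)" "compact K" "K \<subseteq> (\<Union>i. U i)"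
    "\<And>x. x \<notin> K \<Longrightarrow> f x = 0" "s < ennreal (L f)" using open_mass_approx by metis
  have fC: "f \<in> Cc" and f01: "\<And>x. 0 \<le> f x" "\<And>x. f x \<le> 1" using f by (auto simp: below_def)
  obtain J where J: "finite J" "K \<subseteq> (\<Union>i\<in>J. U i)"
    using compactE_image[OF f(2), of UNIV U] U f(3) by auto
  have "\<exists>d. continuous_on UNIV d \<and> (\<forall>x. 0 \<le> d x) \<and> (\<forall>x. (0::real) < d x \<longleftrightarrow> x \<in> U i)" for i
    using open_positive_function[OF U[of i]] by metis
  then obtain d where d: "\<And>i. continuous_on UNIV (d i)" "\<And>i x. 0 \<le> d i x"
    "\<And>i x. (0::real) < d i x \<longleftrightarrow> x \<in> U i" by metis
  define D where "D x = (\<Sum>i\<in>J. d i x)" for x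
  have Dc: "continuous_on UNIV D" unfolding D_def using d(1) by (intro continuous_intros)
  have Dpos: "0 < D x" if x: "x \<in> K" for x
  proof -
    obtain i where "i \<in> J" "x \<in> U i" using J x by auto
    then have "0 < d i x" "d i x \<le> D x" unfolding D_def using d J(1) by (auto intro: member_le_sum)
    then show ?thesis by simp
  qed
  obtain \<delta> where \<delta>: "0 < \<delta>" "\<And>x. x \<in> K \<Longrightarrow> \<delta> \<le> D x"
  proof (cases "K = {}")
    case True then show ?thesis by (intro that[of 1]) auto
  next
    case False
    obtain x where "x \<in> K" "\<forall>y\<in>K. D x \<le> D y"
      using continuous_attains_inf[OF f(2) False, of D] Dc continuous_on_subset by blast
    then show ?thesis using Dpos by (intro that[of "D x"]) auto
  qed
  \<comment> \<open>Dividing by the maximum rather than by D keeps the quotient continuous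
    everywhere. On K the maximum is D, and off K the factor f vanishes, so the pieces still sum to
    f.\<close>
  define h where "h i x = f x * (d i x / max \<delta> (D x))" for i x
  have D0: "0 \<le> D x" for x unfolding D_def using d(2) by (intro sum_nonneg) auto
  have hC: "h i \<in> Cc" for i unfolding h_def using \<delta>(1)
    by (intro Cc_mult[OF fC] continuous_intros d Dc) (auto simp: max_def)
  have h: "h i \<in> below (U i)" if i: "i \<in> J" for i
  proof -
    have "d i x \<le> max \<delta> (D x)" for x
    proof -
      have "d i x \<le> D x" unfolding D_def using d(2) i J(1) by (intro member_le_sum) auto
      then show ?thesis by simp
    qed
    then have le1: "d i x / max \<delta> (D x) \<le> 1" and ge0: "0 \<le> d i x / max \<delta> (D x)" for x
      using d(2)[of i x] D0[of x] \<delta>(1) by (auto simp: divide_le_eq_1)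
    then have "0 \<le> h i x \<and> h i x \<le> 1" for x using f01[of x] le1[of x] ge0[of x]
      unfolding h_def by (metis mult_nonneg_nonneg mult_le_one)
    moreover have "h i x = 0" if "x \<notin> U i" for x
      using d(2)[of i x] d(3)[of i x] that by (simp add: h_def)
    ultimately show ?thesis using hC by (auto simp: below_def)
  qed
  have "f x = (\<Sum>i\<in>J. h i x)" for x
  proof (cases "x \<in> K")
    case True
    then have "(\<Sum>i\<in>J. h i x) = f x * (D x / D x)"
      using \<delta>(2)[OF True] unfolding h_def sum_distrib_left[symmetric] sum_divide_distrib[symmetric]
      by (simp add: D_def max_def)
    then show ?thesis using Dpos[OF True] by simp
  qed (simp add: h_def f(4))
  then have "L f = L (\<lambda>x. \<Sum>i\<in>J. h i x)" by presburger
  also have "\<dots> = (\<Sum>i\<in>J. L (h i))" using J(1) hC by (rule sum)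
  finally have "ennreal (L f) = (\<Sum>i\<in>J. ennreal (L (h i)))"
    using h nonneg by (simp add: below_def)
  also have "\<dots> \<le> (\<Sum>i\<in>J. open_mass (U i))" using h by (intro sum_mono below_mass) auto
  also have "\<dots> \<le> (\<Sum>i. open_mass (U i))" using J(1) by (intro sum_le_suminf) auto
  finally show "s \<le> (\<Sum>i. open_mass (U i))" using f(5) by simp
qed

lemma outer_mass_space: "outer_measure_space (Pow UNIV) outer_mass"
  unfolding outer_measure_space_def
proof (intro conjI)
  show "positive (Pow UNIV) outer_mass"
    using outer_mass_open[of "{}"] open_mass_empty by (simp add: positive_def)
  show "increasing (Pow UNIV) outer_mass"
    using outer_mass_mono by (simp add: increasing_def)
  show "countably_subadditive (Pow UNIV) outer_mass"
    unfolding countably_subadditive_def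
  proof (intro allI impI)
    fix A :: "nat \<Rightarrow> 'a set"
    show "outer_mass (\<Union>i. A i) \<le> (\<Sum>i. outer_mass (A i))"
    proof (rule ennreal_le_epsilon)
      fix e :: real assume e: "0 < e"
      \<comment> \<open>The i-th set is granted the error e / 2^(i+1), and these errors sum to e; a
        set of infinite mass is covered by the whole space.\<close>
      have "\<exists>U. open U \<and> A i \<subseteq> U \<and> open_mass U \<le> outer_mass (A i) + ennreal (e * (1/2)^Suc i)" for i
      proof (cases "outer_mass (A i) = \<infinity>")
        case True then show ?thesis by (intro exI[of _ UNIV]) auto
      next
        case False
        have "0 < ennreal (e * (1/2)^Suc i)" unfolding ennreal_less_zero_iff using e by (intro mult_pos_pos zero_less_power) auto
        then have "outer_mass (A i) + 0 < outer_mass (A i) + ennreal (e * (1/2)^Suc i)"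
          unfolding ennreal_add_left_cancel_less using False by auto
        then have "outer_mass (A i) < outer_mass (A i) + ennreal (e * (1/2)^Suc i)"
          unfolding add_0_right .
        then obtain U where "open U" "A i \<subseteq> U" "open_mass U < outer_mass (A i) + ennreal (e * (1/2)^Suc i)"
          unfolding outer_mass_def[of "A i"] INF_less_iff by auto
        then show ?thesis by (auto intro: less_imp_le)
      qed
      then obtain U where U: "\<And>i. open (U i)" "\<And>i. A i \<subseteq> U i"
        "\<And>i. open_mass (U i) \<le> outer_mass (A i) + ennreal (e * (1/2)^Suc i)" by metis
      have "outer_mass (\<Union>i. A i) \<le> open_mass (\<Union>i. U i)"
        unfolding outer_mass_def using U by (intro INF_lower) auto
      also have "\<dots> \<le> (\<Sum>i. open_mass (U i))" using U(1) by (rule open_mass_subadditive)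
      also have "\<dots> \<le> (\<Sum>i. outer_mass (A i) + ennreal (e * (1/2)^Suc i))"
        using U(3) by (intro suminf_le) auto
      also have "\<dots> = (\<Sum>i. outer_mass (A i)) + (\<Sum>i. ennreal (e * (1/2)^Suc i))"
        by (intro suminf_add[symmetric]) auto
      also have "(\<Sum>i. ennreal (e * (1/2)^Suc i)) = ennreal e"
        using sums_mult[OF power_half_series, of e] e by (intro suminf_ennreal_eq) auto
      finally show "outer_mass (\<Union>i. A i) \<le> (\<Sum>i. outer_mass (A i)) + ennreal e" .
    qed
  qed
qed

text \<open>Caratheodory's condition is tested on open V containing E. A function f nearly
  exhausting V \<inter> U vanishes off a compact K, and E - U lies in the open set V - K. Functions
  below V - K vanish wherever f does not, so adding f keeps them below V.\<close>

lemma open_in_lambda_system: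
  assumes U: "open U" shows "U \<in> lambda_system UNIV (Pow UNIV) outer_mass"
proof -
  have le: "outer_mass (U \<inter> E) + outer_mass ((UNIV - U) \<inter> E) \<le> outer_mass E" for E
    unfolding outer_mass_def[of E]
  proof (rule INF_greatest, clarify)
    fix V assume V: "open V" "E \<subseteq> V"
    have "open_mass (V \<inter> U) + outer_mass (E - U) \<le> open_mass V"
    proof (rule ennreal_add_le_of_less)
      have "outer_mass (E - U) \<le> outer_mass V" using V by (intro outer_mass_mono) auto
      then show "outer_mass (E - U) \<le> open_mass V" using V by (simp add: outer_mass_open)
      fix s assume "s < open_mass (V \<inter> U)"
      then obtain f K where f: "f \<in> below (V \<inter> U)" "compact K" "K \<subseteq> V \<inter> U"
        "\<And>x. x \<notin> K \<Longrightarrow> f x = 0" "s < ennreal (L f)" using open_mass_approx by metis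
      have op: "open (V - K)" using V f by (intro open_Diff compact_imp_closed) auto
      have "outer_mass (E - U) \<le> open_mass (V - K)"
        unfolding outer_mass_open[OF op, symmetric] using V f by (intro outer_mass_mono) auto
      then have "s + outer_mass (E - U) \<le> open_mass (V - K) + ennreal (L f)"
        using f(5) by (metis add.commute add_mono less_imp_le)
      also have "\<dots> \<le> open_mass V"
        unfolding open_mass_def[of "V - K"]
      proof (subst ennreal_SUP_add_left[symmetric])
        show "(SUP g\<in>below (V - K). ennreal (L g) + ennreal (L f)) \<le> open_mass V"
        proof (rule SUP_least)
          fix g assume g: "g \<in> below (V - K)"
          have *: "f x = 0 \<or> g x = 0" for x using f(4)[of x] g by (auto simp: below_def)
          have gC: "g \<in> Cc" "f \<in> Cc" using f g by (auto simp: below_def)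
          have "0 \<le> g x + f x \<and> g x + f x \<le> 1 \<and> (x \<notin> V \<longrightarrow> g x + f x = 0)" for x
            using *[of x] f(1) g by (auto simp: below_def)
          with gC have "(\<lambda>x. g x + f x) \<in> below V" unfolding below_def by (auto intro: Cc_add)
          then have "ennreal (L g + L f) \<le> open_mass V" using below_mass[of "\<lambda>x. g x + f x" V] add[OF gC] by simp
          moreover have "0 \<le> L f" "0 \<le> L g" using f g nonneg by (auto simp: below_def)
          ultimately show "ennreal (L g) + ennreal (L f) \<le> open_mass V" by simp
        qed
      qed (use zero_below in auto)
      finally show "s + outer_mass (E - U) \<le> open_mass V" .
    qed
    moreover have eq: "(UNIV - U) \<inter> E = E - U" by auto
    moreover have "outer_mass (U \<inter> E) \<le> open_mass (V \<inter> U)"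
    proof -
      have "open (V \<inter> U)" "U \<inter> E \<subseteq> V \<inter> U" using U V by auto
      then show ?thesis using outer_mass_mono[of "U \<inter> E" "V \<inter> U"] outer_mass_open[of "V \<inter> U"] by simp
    qed
    ultimately show "outer_mass (U \<inter> E) + outer_mass ((UNIV - U) \<inter> E) \<le> open_mass V"
      unfolding eq by (meson add_right_mono order_trans)
  qed
  have ge: "outer_mass E \<le> outer_mass (U \<inter> E) + outer_mass ((UNIV - U) \<inter> E)" for E
  proof -
    \<comment> \<open>Countable subadditivity speaks of sequences, so the two pieces are padded with
      empty sets.\<close>
    define B where "B = (\<lambda>i::nat. if i = 0 then U \<inter> E else if i = 1 then (UNIV - U) \<inter> E else {})"
    have "E = (\<Union>i. B i)"
    proof
      show "E \<subseteq> (\<Union>i. B i)"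
      proof
        fix x assume "x \<in> E"
        then show "x \<in> (\<Union>i. B i)"
          by (cases "x \<in> U") (auto simp: B_def intro: exI[of _ 0] exI[of _ 1])
      qed
    qed (auto simp: B_def split: if_splits)
    moreover have "disjoint_family B" by (auto simp: disjoint_family_on_def B_def)
    ultimately have "outer_mass E \<le> (\<Sum>i. outer_mass (B i))"
      using outer_mass_space by (auto simp: outer_measure_space_def countably_subadditive_def)
    also have "\<dots> = (\<Sum>i<2. outer_mass (B i))"
      using outer_mass_open[of "{}"] open_mass_empty by (intro suminf_finite) (auto simp: B_def)
    also have "\<dots> = outer_mass (U \<inter> E) + outer_mass ((UNIV - U) \<inter> E)"
      by (simp add: B_def numeral_2_eq_2)
    finally show ?thesis .
  qed
  show ?thesis unfolding lambda_system_def using le ge by (auto intro: antisym)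
qed

definition riesz_measure :: "'a measure" where
  "riesz_measure = measure_of UNIV (sets borel) outer_mass"

lemma sets_riesz_measure: "sets riesz_measure = sets borel"
  unfolding riesz_measure_def using sets.sigma_sets_eq[of borel] by (simp add: sets_measure_of_conv)

text \<open>The sets satisfying Caratheodory's condition form a sigma algebra on which the outer
  measure is a measure; containing the open sets, it contains all Borel sets.\<close>

lemma emeasure_riesz_measure: assumes "B \<in> sets borel" shows "emeasure riesz_measure B = outer_mass B"
proof -
  interpret P: sigma_algebra UNIV "Pow UNIV :: 'a set set" by (rule sigma_algebra_Pow)
  have ms: "measure_space UNIV (lambda_system UNIV (Pow UNIV) outer_mass) outer_mass"
    using P.caratheodory_lemma[OF outer_mass_space] by simp
  then have sa: "sigma_algebra UNIV (lambda_system UNIV (Pow UNIV) outer_mass)"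
    by (simp add: measure_space_def)
  have "sets (borel :: 'a measure) \<subseteq> lambda_system UNIV (Pow UNIV) outer_mass"
    unfolding borel_def using open_in_lambda_system
    using sigma_algebra.sigma_sets_subset[OF sa, of "{S. open S}"] by (auto simp: sets_measure_of_conv)
  moreover have "sigma_algebra UNIV (sets (borel :: 'a measure))"
    using sets.sigma_algebra_axioms[of "borel :: 'a measure"] by simp
  ultimately have "measure_space UNIV (sets (borel :: 'a measure)) outer_mass"
    using measure_down[OF ms] by blast
  then show ?thesis
    unfolding riesz_measure_def using assms
    by (intro emeasure_measure_of_sigma) (auto simp: measure_space_def)
qed

lemma emeasure_riesz_open: "open U \<Longrightarrow> emeasure riesz_measure U = open_mass U"
  by (simp add: emeasure_riesz_measure outer_mass_open)

lemma radon_riesz_measure: "radon_measure riesz_measure"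
  unfolding radon_measure_def
proof (intro conjI allI impI sets_riesz_measure)
  fix K :: "'a set" assume "compact K"
  then obtain R where R: "K \<subseteq> ball 0 R" using compact_imp_bounded bounded_subset_ballD by metis
  have "emeasure riesz_measure K \<le> emeasure riesz_measure (ball 0 R)"
    using R by (intro emeasure_mono) (auto simp: sets_riesz_measure)
  also have "\<dots> = open_mass (ball 0 R)" by (simp add: emeasure_riesz_open)
  also have "\<dots> \<le> ennreal (L (plateau R))"
    unfolding open_mass_def
  proof (intro SUP_least ennreal_leI)
    fix f :: "'a \<Rightarrow> real" assume f: "f \<in> below (ball 0 R)"
    show "L f \<le> L (plateau R)"
    proof (rule mono)
      fix x show "f x \<le> plateau R x"
        using f plateau(2)[of R x] plateau(4)[of x R] by (cases "norm x < R") (auto simp: below_def)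
    qed (use f plateau in \<open>auto simp: below_def\<close>)
  qed
  finally show "emeasure riesz_measure K < \<infinity>" using ennreal_less_top by (metis infinity_ennreal_def le_less_trans)
qed

section \<open>The functional as integration against the constructed measure\<close>

text \<open>f is cut into N horizontal layers \<open>g j\<close> of height 1 / N. N times a layer is
  below the open set \<open>S (j / N)\<close>, while the layer equals 1 / N on
  \<open>S (Suc j / N)\<close>. The upper bound for L and the lower bound for the integral differ by
  one index, so the sums telescope to an excess of at most \<open>m 0 / N\<close>.\<close>

lemma L_le_integral_unit:
  assumes fC: "f \<in> Cc" and f0: "\<And>x. 0 \<le> f x" and f1: "\<And>x. f x \<le> 1"
  shows "L f \<le> (\<integral>x. f x \<partial>riesz_measure)"
proof (rule ccontr)
  assume neg: "\<not> ?thesis"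
  define S where "S t = {x. t < f x}" for t
  define m where "m t = measure riesz_measure (S t)" for t
  have openS: "open (S t)" for t unfolding S_def
    by (intro open_Collect_less continuous_intros Cc_continuous fC)
  have fin: "emeasure riesz_measure (S t) < \<infinity>" if "0 \<le> t" for t
  proof -
    obtain R where R: "\<And>x. R < norm x \<Longrightarrow> f x = 0" using fC by (auto simp: Cc_iff)
    then have "S t \<subseteq> cball 0 R" using that by (force simp: S_def not_less[symmetric])
    then have "emeasure riesz_measure (S t) \<le> emeasure riesz_measure (cball 0 R)"
      by (intro emeasure_mono) (auto simp: sets_riesz_measure)
    then show ?thesis using radon_riesz_measure unfolding radon_measure_def
      by (meson compact_cball le_less_trans)
  qed
  \<comment> \<open>N is so large that an excess of \<open>m 0 / N\<close> is smaller than the gap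
    assumed in \<open>neg\<close>.\<close>
  obtain N :: nat where N: "m 0 / (L f - (\<integral>x. f x \<partial>riesz_measure)) < real N" "N > 0"
    using reals_Archimedean2[of "max 0 (m 0 / (L f - (\<integral>x. f x \<partial>riesz_measure)))"] by auto
  define c where "c j x = min (f x) (real j / real N)" for j x
  define g where "g j x = c (Suc j) x - c j x" for j x
  have cC: "c j \<in> Cc" for j unfolding c_def
    by (intro Cc_comp[OF fC, of "\<lambda>y. min y (real j / real N)"] continuous_intros) auto
  then have gC: "g j \<in> Cc" for j unfolding g_def by (intro Cc_diff)
  have "f = (\<lambda>x. \<Sum>j<N. g j x)"
  proof
    fix x have "(\<Sum>j<N. g j x) = c N x - c 0 x"
      unfolding g_def by (rule sum_lessThan_telescope)
    then show "f x = (\<Sum>j<N. g j x)" using N f0[of x] f1[of x] by (simp add: c_def)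
  qed
  then have Lf: "L f = (\<Sum>j<N. L (g j))" and If: "(\<integral>x. f x \<partial>riesz_measure) = (\<Sum>j<N. \<integral>x. g j x \<partial>riesz_measure)"
    using sum[of "{..<N}" g] gC radon_integrable_Cc[OF radon_riesz_measure]
    by (auto simp del: Bochner_Integration.integral_sum intro!: Bochner_Integration.integral_sum)
  have jN: "real j / real N \<le> real (Suc j) / real N" "real (Suc j) / real N - real j / real N = 1 / real N" for j
    using N by (auto simp: field_simps)
  have g_bd: "0 \<le> g j x" "g j x \<le> 1 / real N" "x \<notin> S (real j / real N) \<Longrightarrow> g j x = 0"
    "x \<in> S (real (Suc j) / real N) \<Longrightarrow> g j x = 1 / real N" for j x
    using jN[of j] by (auto simp: g_def c_def S_def min_def)
  have up: "L (g j) \<le> m (real j / real N) / real N" for j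
  proof -
    have "(\<lambda>x. real N * g j x) \<in> below (S (real j / real N))"
      using g_bd[where j=j] gC N by (auto simp: below_def Cc_scale field_simps)
    then have "ennreal (L (\<lambda>x. real N * g j x)) \<le> emeasure riesz_measure (S (real j / real N))"
      using below_mass emeasure_riesz_open openS by metis
    also have "\<dots> = ennreal (m (real j / real N))"
      unfolding m_def using fin[of "real j / real N"] by (intro emeasure_eq_ennreal_measure) auto
    finally have "L (\<lambda>x. real N * g j x) \<le> m (real j / real N)" by (simp add: m_def)
    then show ?thesis using N by (simp add: scale[OF gC] field_simps)
  qed
  have low: "m (real (Suc j) / real N) / real N \<le> (\<integral>x. g j x \<partial>riesz_measure)" for j
  proof -
    have Sm: "S t \<in> sets riesz_measure" for t using openS by (simp add: sets_riesz_measure)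
    have ii: "integrable riesz_measure (\<lambda>x. indicator (S (real (Suc j) / real N)) x :: real)"
      using Sm fin by (intro integrable_real_indicator) (auto simp del: of_nat_Suc)
    have "(\<integral>x. indicator (S (real (Suc j) / real N)) x / real N \<partial>riesz_measure) \<le> (\<integral>x. g j x \<partial>riesz_measure)"
    proof (rule integral_mono)
      show "integrable riesz_measure (g j)" by (rule radon_integrable_Cc[OF radon_riesz_measure gC])
      fix x show "indicator (S (real (Suc j) / real N)) x / real N \<le> g j x"
        using g_bd(1)[of j x] g_bd(4)[of x j] by (cases "x \<in> S (real (Suc j) / real N)") auto
    qed (use ii in auto)
    moreover have "(\<integral>x. indicator (S (real (Suc j) / real N)) x / real N \<partial>riesz_measure)
        = m (real (Suc j) / real N) / real N"
      using sets_eq_imp_space_eq[OF sets_riesz_measure] by (simp add: m_def)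
    ultimately show ?thesis by metis
  qed
  have "L f - (\<integral>x. f x \<partial>riesz_measure) \<le> (\<Sum>j<N. m (real j / real N) / real N) - (\<Sum>j<N. m (real (Suc j) / real N) / real N)"
    unfolding Lf If using up low by (intro diff_mono sum_mono) auto
  also have "\<dots> = - (\<Sum>j<N. m (real (Suc j) / real N) / real N - m (real j / real N) / real N)"
    by (simp add: sum_subtractf)
  also have "\<dots> = m 0 / real N - m (real N / real N) / real N"
    by (subst sum_lessThan_telescope[of "\<lambda>j. m (real j / real N) / real N"]) simp
  also have "\<dots> \<le> m 0 / real N" by (simp add: m_def)
  finally have "L f - (\<integral>x. f x \<partial>riesz_measure) \<le> m 0 / real N" .
  with N neg show False by (simp add: field_simps)
qed

lemma L_le_integral:
  assumes fC: "f \<in> Cc" and f0: "\<And>x. 0 \<le> f x"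
  shows "L f \<le> (\<integral>x. f x \<partial>riesz_measure)"
proof -
  obtain B where B: "B > 0" "\<And>x. \<bar>f x\<bar> \<le> B" using Cc_bounded[OF fC] by metis
  have "L (\<lambda>x. (1/B) * f x) \<le> (\<integral>x. (1/B) * f x \<partial>riesz_measure)"
    using B f0 by (intro L_le_integral_unit Cc_scale fC) (auto simp: field_simps abs_le_iff)
  then show ?thesis using B(1) unfolding scale[OF fC] by (simp add: field_simps)
qed

text \<open>The reverse inequality comes from the known one applied to h - f, where h dominates f,
  stays below the indicator of a ball U and has \<open>L h\<close> within e of the mass of U. The
  integral of h is then at most \<open>L h + e\<close>.\<close>

lemma L_eq_integral_nonneg:
  assumes fC: "f \<in> Cc" and f0: "\<And>x. 0 \<le> f x"
  shows "L f = (\<integral>x. f x \<partial>riesz_measure)"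
proof (rule antisym[OF L_le_integral[OF assms]])
  have *: "(\<integral>x. f x \<partial>riesz_measure) \<le> L f" if fC: "f \<in> Cc" and f0: "\<And>x. 0 \<le> f x" and f1: "\<And>x. f x \<le> 1" for f
  proof (rule field_le_epsilon)
    fix e :: real assume e: "0 < e"
    obtain R where R: "\<And>x. R < norm x \<Longrightarrow> f x = 0" using fC by (auto simp: Cc_iff)
    define U :: "'a set" where "U = ball 0 (R + 1)"
    have fU: "x \<notin> U \<Longrightarrow> f x = 0" for x using R[of x] by (auto simp: U_def)
    have finU: "emeasure riesz_measure U < \<infinity>"
      using radon_riesz_measure emeasure_mono[of U "cball 0 (R+1)" riesz_measure] unfolding radon_measure_def U_def
      by (metis ball_subset_cball compact_cball le_less_trans borel_closed closed_cball)
    have U: "emeasure riesz_measure U = open_mass U" by (simp add: U_def emeasure_riesz_open)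
    have "\<exists>g\<in>below U. open_mass U \<le> ennreal (L g) + ennreal e"
    proof (cases "open_mass U = 0")
      case True then show ?thesis using zero_below by auto
    next
      case False
      then have "open_mass U - ennreal e < open_mass U"
        using finU e U by (intro ennreal_between) (auto simp: zero_less_iff_neq_zero)
      then obtain g where "g \<in> below U" "open_mass U - ennreal e < ennreal (L g)"
        unfolding open_mass_def[of U] less_SUP_iff by auto
      then show ?thesis by (metis add.commute ennreal_minus_le_iff less_imp_le)
    qed
    then obtain g where g: "g \<in> below U" "open_mass U \<le> ennreal (L g) + ennreal e" by auto
    have gC: "g \<in> Cc" using g by (auto simp: below_def)
    \<comment> \<open>The maximum makes h - f nonnegative, stays below the indicator of U, and can
      only increase the functional.\<close>
    define h where "h = (\<lambda>x. max (g x) (f x))"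
    have hC: "h \<in> Cc" unfolding h_def by (rule Cc_max[OF gC \<open>f \<in> Cc\<close>])
    have Lg: "0 \<le> L g" "L g \<le> L h" using g gC hC by (auto intro!: nonneg mono simp: below_def h_def)
    have mU: "emeasure riesz_measure U = ennreal (measure riesz_measure U)"
      using finU by (intro emeasure_eq_ennreal_measure) auto
    have Um: "U \<in> sets riesz_measure" by (simp add: U_def sets_riesz_measure)
    have "(\<integral>x. h x \<partial>riesz_measure) \<le> (\<integral>x. indicator U x \<partial>riesz_measure)"
    proof (intro integral_mono radon_integrable_Cc[OF radon_riesz_measure hC])
      show "integrable riesz_measure (indicator U :: 'a \<Rightarrow> real)" using finU Um by (intro integrable_real_indicator) auto
      fix x show "h x \<le> indicator U x" using g f1[of x] fU[of x] by (auto simp: h_def below_def indicator_def)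
    qed
    also have "\<dots> = measure riesz_measure U" using Um by (simp add: sets_eq_imp_space_eq[OF sets_riesz_measure])
    also have "\<dots> \<le> L g + e"
      using g(2) Lg e unfolding U[symmetric] mU by (simp flip: ennreal_plus)
    also have "\<dots> \<le> L h + e" using Lg by simp
    finally have 1: "(\<integral>x. h x \<partial>riesz_measure) \<le> L h + e" .
    have "L (\<lambda>x. h x - f x) \<le> (\<integral>x. h x - f x \<partial>riesz_measure)"
      by (rule L_le_integral[OF Cc_diff[OF hC fC]]) (simp add: h_def)
    also have "\<dots> = (\<integral>x. h x \<partial>riesz_measure) - (\<integral>x. f x \<partial>riesz_measure)"
      by (intro Bochner_Integration.integral_diff radon_integrable_Cc[OF radon_riesz_measure] hC fC)
    finally show "(\<integral>x. f x \<partial>riesz_measure) \<le> L f + e"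
      using 1 diff[OF hC fC] by simp
  qed
  obtain B where B: "B > 0" "\<And>x. \<bar>f x\<bar> \<le> B" using Cc_bounded[OF fC] by metis
  have "(\<integral>x. (1/B) * f x \<partial>riesz_measure) \<le> L (\<lambda>x. (1/B) * f x)"
    using B f0 by (intro * Cc_scale fC) (auto simp: field_simps abs_le_iff)
  then show "(\<integral>x. f x \<partial>riesz_measure) \<le> L f" using B(1) unfolding scale[OF fC] by (simp add: field_simps)
qed

theorem riesz_markov:
  assumes fC: "f \<in> Cc" shows "L f = (\<integral>x. f x \<partial>riesz_measure)"
proof -
  define p n where "p = (\<lambda>x. max 0 (f x))" and "n = (\<lambda>x. max 0 (- f x))"
  have pC: "p \<in> Cc" "n \<in> Cc" unfolding p_def n_def
    by (auto intro!: Cc_comp[OF fC, of "\<lambda>y. max 0 y"] Cc_comp[OF fC, of "\<lambda>y. max 0 (-y)"] continuous_intros)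
  have f: "f = (\<lambda>x. p x - n x)" by (auto simp: p_def n_def)
  have "L p = (\<integral>x. p x \<partial>riesz_measure)" "L n = (\<integral>x. n x \<partial>riesz_measure)"
    using pC by (auto intro!: L_eq_integral_nonneg simp: p_def n_def)
  then show ?thesis using diff[OF pC] pC radon_integrable_Cc[OF radon_riesz_measure]
    by (subst (1 2) f) simp
qed

end

section \<open>Jordan decomposition of signed Radon measures\<close>

lemma radon_sets: "radon_measure P \<Longrightarrow> sets P = sets borel"
  by (simp add: radon_measure_def)

lemma radon_space: "radon_measure P \<Longrightarrow> space P = UNIV"
  using sets_eq_imp_space_eq[OF radon_sets] by auto

lemma radon_finite_bounded:
  assumes "radon_measure P" "bounded B" shows "emeasure P B < \<infinity>"
proof -
  obtain R where "B \<subseteq> cball 0 R"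
    using bounded_subset_ballD[OF assms(2), of 0] ball_subset_cball by blast
  then have "emeasure P B \<le> emeasure P (cball 0 R)"
    using assms by (intro emeasure_mono) (auto simp: radon_sets)
  also have "\<dots> < \<infinity>" using assms by (auto simp: radon_measure_def)
  finally show ?thesis .
qed

lemma radon_emeasure_eq:
  assumes "radon_measure P" "bounded B" shows "emeasure P B = ennreal (measure P B)"
  using radon_finite_bounded[OF assms] by (intro emeasure_eq_ennreal_measure) auto

lemma radon_sigma_finite: assumes "radon_measure P" shows "sigma_finite_measure P"
proof
  show "\<exists>A. countable A \<and> A \<subseteq> sets P \<and> \<Union> A = space P \<and> (\<forall>a\<in>A. emeasure P a \<noteq> \<infinity>)"
  proof (intro exI conjI ballI)
    show "countable (range (\<lambda>n::nat. cball 0 (real n) :: 'a set))" by simp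
    show "range (\<lambda>n::nat. cball 0 (real n)) \<subseteq> sets P" using assms by (auto simp: radon_sets)
    show "\<Union> (range (\<lambda>n::nat. cball 0 (real n))) = space P"
      using real_arch_simple by (auto simp: radon_space[OF assms])
    fix a assume "a \<in> range (\<lambda>n::nat. cball (0::'a) (real n))"
    then show "emeasure P a \<noteq> \<infinity>" using radon_finite_bounded[OF assms, of a] by auto
  qed
qed

lemma radon_eqI:
  assumes P: "radon_measure P" and Q: "radon_measure Q"
    and eq: "\<And>B. B \<in> sets borel \<Longrightarrow> bounded B \<Longrightarrow> measure P B = measure Q B"
  shows "P = Q"
proof (rule measure_eqI)
  show "sets P = sets Q" using P Q by (simp add: radon_sets)
  fix A assume "A \<in> sets P"
  then have A: "A \<in> sets borel" using P by (simp add: radon_sets)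
  have SUP: "emeasure M A = (SUP n::nat. emeasure M (A \<inter> cball 0 (real n)))" if M: "radon_measure M" for M
  proof -
    have "(SUP n::nat. emeasure M (A \<inter> cball 0 (real n))) = emeasure M (\<Union>n::nat. A \<inter> cball 0 (real n))"
      using A by (intro SUP_emeasure_incseq) (auto simp: radon_sets[OF M] incseq_def)
    also have "(\<Union>n::nat. A \<inter> cball 0 (real n)) = A" using real_arch_simple by auto
    finally show ?thesis by simp
  qed
  show "emeasure P A = emeasure Q A"
    unfolding SUP[OF P] SUP[OF Q] using A
    by (intro SUP_cong refl) (simp add: radon_emeasure_eq P Q eq bounded_Int)
qed

definition add_measure :: "'a::topological_space measure \<Rightarrow> 'a measure \<Rightarrow> 'a measure" where
  "add_measure P N = measure_of UNIV (sets borel) (\<lambda>A. emeasure P A + emeasure N A)"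

lemma sets_add_measure: "sets (add_measure P N) = sets borel"
  unfolding add_measure_def using sets.sigma_sets_eq[of borel] by (simp add: sets_measure_of_conv)

lemma emeasure_add_measure:
  assumes "sets P = sets borel" "sets N = sets borel" "A \<in> sets borel"
  shows "emeasure (add_measure P N) A = emeasure P A + emeasure N A"
  unfolding add_measure_def
proof (rule emeasure_measure_of_sigma)
  show "sigma_algebra UNIV (sets (borel :: 'a measure))"
    using sets.sigma_algebra_axioms[of "borel :: 'a measure"] by simp
  show "positive (sets borel) (\<lambda>A. emeasure P A + emeasure N A)" by (simp add: positive_def)
  show "countably_additive (sets borel) (\<lambda>A. emeasure P A + emeasure N A)"
  proof (rule countably_additiveI)
    fix A :: "nat \<Rightarrow> 'a set" assume A: "range A \<subseteq> sets borel" "disjoint_family A"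
    then have "(\<Sum>i. emeasure P (A i)) = emeasure P (\<Union>i. A i)" "(\<Sum>i. emeasure N (A i)) = emeasure N (\<Union>i. A i)"
      using assms by (auto intro!: suminf_emeasure)
    then show "(\<Sum>i. emeasure P (A i) + emeasure N (A i)) = emeasure P (\<Union>i. A i) + emeasure N (\<Union>i. A i)"
      by (subst suminf_add[symmetric]) auto
  qed
qed fact

lemma radon_add: "radon_measure P \<Longrightarrow> radon_measure N \<Longrightarrow> radon_measure (add_measure P N)"
  unfolding radon_measure_def
  by (auto simp: sets_add_measure emeasure_add_measure borel_compact)

lemma measure_add_measure:
  assumes "radon_measure P" "radon_measure N" "B \<in> sets borel" "bounded B"
  shows "measure (add_measure P N) B = measure P B + measure N B"
proof -
  have "ennreal (measure (add_measure P N) B) = ennreal (measure P B + measure N B)"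
    using assms emeasure_add_measure[of P N B] radon_emeasure_eq[of P B] radon_emeasure_eq[of N B]
      radon_emeasure_eq[OF radon_add, of P N B] by (simp add: radon_sets)
  then show ?thesis by (subst (asm) ennreal_inj) auto
qed

text \<open>Cut a bounded Borel set along the set S that separates P from N. On S the measure N
  vanishes, so P = P' - N' \<le> P' there; off S likewise N \<le> N'. Each decomposition is
  therefore below the other.\<close>

lemma jordan_decomp_unique:
  assumes 1: "is_jordan_decomp \<nu> P N" and 2: "is_jordan_decomp \<nu> P' N'"
  shows "P = P'" "N = N'"
proof -
  have le: "measure P B \<le> measure P' B \<and> measure N B \<le> measure N' B"
    if 1: "is_jordan_decomp \<nu> P N" and 2: "is_jordan_decomp \<nu> P' N'" and B: "B \<in> sets borel" "bounded B"
    for B P N P' N'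
  proof -
    have r: "radon_measure P" "radon_measure N" "radon_measure P'" "radon_measure N'"
      using 1 2 by (auto simp: is_jordan_decomp_def)
    obtain S where S: "S \<in> sets borel" "emeasure P (- S) = 0" "emeasure N S = 0"
      using 1 by (auto simp: is_jordan_decomp_def)
    have eq: "measure_diff P N C = measure_diff P' N' C" for C
      using 1 2 by (metis is_jordan_decomp_def)
    have bd: "bounded (B \<inter> S)" "bounded (B - S)" "B \<inter> S \<in> sets borel" "B - S \<in> sets borel"
      using B S by (auto simp: bounded_diff bounded_Int)
    have null: "measure P (B - S) = 0" "measure N (B \<inter> S) = 0"
      using emeasure_mono[of "B - S" "- S" P, OF Diff_subset_conv[THEN iffD2]] emeasure_mono[of "B \<inter> S" S N] S r
      by (auto simp: radon_sets measure_def)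
    have split: "measure M B = measure M (B \<inter> S) + measure M (B - S)" if "radon_measure M" for M
    proof -
      have "measure M ((B \<inter> S) \<union> (B - S)) = measure M (B \<inter> S) + measure M (B - S)"
        using bd radon_finite_bounded[OF that] by (intro measure_Union) (auto simp: radon_sets[OF that] less_top)
      then show ?thesis by (simp add: Int_Diff_Un)
    qed
    have "measure P (B \<inter> S) = measure P' (B \<inter> S) - measure N' (B \<inter> S)"
      "- measure N (B - S) = measure P' (B - S) - measure N' (B - S)"
      using eq[of "B \<inter> S"] eq[of "B - S"] bd null by (auto simp: measure_diff_def)
    then show ?thesis
      using split[OF r(1)] split[OF r(2)] split[OF r(3)] split[OF r(4)] null
        measure_nonneg[of N' "B \<inter> S"] measure_nonneg[of P' "B - S"]
        measure_nonneg[of P' "B \<inter> S"] measure_nonneg[of N' "B - S"]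
      by (intro conjI; linarith)
  qed
  have r: "radon_measure P" "radon_measure N" "radon_measure P'" "radon_measure N'"
    using 1 2 by (auto simp: is_jordan_decomp_def)
  show "P = P'" "N = N'"
    by (intro radon_eqI r order_antisym; use le[OF 1 2] le[OF 2 1] in blast)+
qed

lemma jordan_parts:
  assumes "is_jordan_decomp \<nu> P N" shows "pos_part \<nu> = P" "neg_part \<nu> = N"
proof -
  have "(THE J. is_jordan_decomp \<nu> (fst J) (snd J)) = (P, N)"
  proof (rule the_equality)
    show "J = (P, N)" if "is_jordan_decomp \<nu> (fst J) (snd J)" for J
      using jordan_decomp_unique[OF assms that] by (cases J) simp
  qed (simp add: assms)
  then show "pos_part \<nu> = P" "neg_part \<nu> = N" by (auto simp: pos_part_def neg_part_def)
qed

definition pdiff :: "ennreal \<Rightarrow> ennreal \<Rightarrow> ennreal" where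
  "pdiff f g = (if g < f then f - g else 0)"

lemma pdiff_add: "pdiff f g + g = max f g"
  by (auto simp: pdiff_def max_def diff_add_cancel_ennreal not_less)

lemma pdiff_le: "pdiff f g \<le> f"
  by (simp add: pdiff_def diff_le_self_ennreal)

lemma pdiff_measurable[measurable]:
  assumes [measurable]: "f \<in> borel_measurable M" "g \<in> borel_measurable M"
  shows "(\<lambda>x. pdiff (f x) (g x)) \<in> borel_measurable M"
  unfolding pdiff_def by measurable

text \<open>With \<open>f\<close> and \<open>g\<close> the densities of \<open>P\<close> and \<open>N\<close> with respect to \<open>P + N\<close>, the two parts
  have the densities \<open>(f - g)\<^sup>+\<close> and \<open>(g - f)\<^sup>+\<close>. (On \<open>ennreal\<close>, \<open>\<infinity> - \<infinity> = \<infinity>\<close>, hence \<open>pdiff\<close>.)\<close>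

lemma jordan_decomp_exists:
  assumes P: "radon_measure P" and N: "radon_measure N"
  obtains P' N' where "is_jordan_decomp (measure_diff P N) P' N'"
    "\<And>A. A \<in> sets borel \<Longrightarrow> emeasure P' A \<le> emeasure P A" "\<And>A. A \<in> sets borel \<Longrightarrow> emeasure N' A \<le> emeasure N A"
proof -
  define S where "S = add_measure P N"
  have sS: "sets S = sets borel" by (simp add: S_def sets_add_measure)
  interpret S: sigma_finite_measure S unfolding S_def by (intro radon_sigma_finite radon_add P N)
  have "absolutely_continuous S P" "absolutely_continuous S N"
    unfolding absolutely_continuous_def null_sets_def
    using P N by (auto simp: S_def sets_add_measure emeasure_add_measure radon_sets)
  moreover have "sets P = sets S" "sets N = sets S" using P N sS by (simp_all add: radon_sets)
  moreover define f g where "f = RN_deriv S P" and "g = RN_deriv S N"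
  ultimately have d: "density S f = P" "density S g = N"
    unfolding f_def g_def by (blast intro: S.density_RN_deriv)+
  have m[measurable]: "f \<in> borel_measurable S" "g \<in> borel_measurable S" by (auto simp: f_def g_def)
  define P' N' where "P' = density S (\<lambda>x. pdiff (f x) (g x))" and "N' = density S (\<lambda>x. pdiff (g x) (f x))"
  have e: "emeasure P' A = (\<integral>\<^sup>+x. pdiff (f x) (g x) * indicator A x \<partial>S)"
    "emeasure N' A = (\<integral>\<^sup>+x. pdiff (g x) (f x) * indicator A x \<partial>S)"
    "emeasure P A = (\<integral>\<^sup>+x. f x * indicator A x \<partial>S)"
    "emeasure N A = (\<integral>\<^sup>+x. g x * indicator A x \<partial>S)" if "A \<in> sets borel" for A
  proof -
    have A: "A \<in> sets S" using that sS by simp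
    show "emeasure P A = (\<integral>\<^sup>+x. f x * indicator A x \<partial>S)" "emeasure N A = (\<integral>\<^sup>+x. g x * indicator A x \<partial>S)"
      using emeasure_density[OF m(1) A] emeasure_density[OF m(2) A] by (simp_all only: d)
    show "emeasure P' A = (\<integral>\<^sup>+x. pdiff (f x) (g x) * indicator A x \<partial>S)"
      "emeasure N' A = (\<integral>\<^sup>+x. pdiff (g x) (f x) * indicator A x \<partial>S)"
      unfolding P'_def N'_def using A by (subst emeasure_density; simp)+
  qed
  have le: "emeasure P' A \<le> emeasure P A" "emeasure N' A \<le> emeasure N A" if "A \<in> sets borel" for A
    unfolding e[OF that] by (intro nn_integral_mono mult_right_mono pdiff_le; simp)+
  have s': "sets P' = sets borel" "sets N' = sets borel" by (auto simp: P'_def N'_def sS)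
  have rP': "radon_measure P'" "radon_measure N'"
    unfolding radon_measure_def using s' le P N
    by (simp_all add: radon_measure_def) (meson borel_compact le_less_trans)+
  \<comment> \<open>Stated with sums, since differences are meaningless where both masses are
    infinite.\<close>
  have sum: "emeasure P' A + emeasure N A = emeasure P A + emeasure N' A" if A: "A \<in> sets borel" for A
  proof -
    have mA: "A \<in> sets S" using A sS by simp
    have "emeasure P' A + emeasure N A = (\<integral>\<^sup>+x. pdiff (f x) (g x) * indicator A x + g x * indicator A x \<partial>S)"
      unfolding e[OF A] using mA by (intro nn_integral_add[symmetric]) auto
    also have "\<dots> = (\<integral>\<^sup>+x. f x * indicator A x + pdiff (g x) (f x) * indicator A x \<partial>S)"
    proof (intro nn_integral_cong)
      fix x
      have "pdiff (f x) (g x) + g x = f x + pdiff (g x) (f x)"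
        using pdiff_add[of "f x" "g x"] pdiff_add[of "g x" "f x"] by (metis add.commute max.commute)
      then show "pdiff (f x) (g x) * indicator A x + g x * indicator A x
          = f x * indicator A x + pdiff (g x) (f x) * indicator A x"
        by (metis distrib_right)
    qed
    also have "\<dots> = emeasure P A + emeasure N' A"
      unfolding e[OF A] using mA by (intro nn_integral_add) auto
    finally show ?thesis .
  qed
  define D where "D = {x \<in> space S. g x < f x}"
  have D: "D \<in> sets borel" unfolding D_def sS[symmetric] by measurable
  have "emeasure P' (- D) = 0" "emeasure N' D = 0"
  proof -
    have z: "pdiff (f x) (g x) * indicator (- D) x = 0" "pdiff (g x) (f x) * indicator D x = 0" for x
      using sets_eq_imp_space_eq[OF sS] by (auto simp: D_def indicator_def pdiff_def)
    show "emeasure P' (- D) = 0" "emeasure N' D = 0"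
      using D by (simp_all only: e borel_comp z nn_integral_const mult_zero_left)
  qed
  moreover have "measure_diff P N = measure_diff P' N'"
  proof
    fix B show "measure_diff P N B = measure_diff P' N' B"
    proof (cases "B \<in> sets borel \<and> bounded B")
      case True
      have "ennreal (measure P' B + measure N B) = ennreal (measure P B + measure N' B)"
        using True sum[of B] rP' P N by (simp add: radon_emeasure_eq)
      then have "measure P' B + measure N B = measure P B + measure N' B"
        by (subst (asm) ennreal_inj) auto
      then show ?thesis using True by (simp add: measure_diff_def)
    qed (auto simp: measure_diff_def)
  qed
  ultimately have "is_jordan_decomp (measure_diff P N) P' N'"
    unfolding is_jordan_decomp_def using rP' D by blast
  then show ?thesis using that le by blast
qed

section \<open>Positive measures among the signed ones\<close>

definition signed_of :: "'a::euclidean_space measure \<Rightarrow> 'a set \<Rightarrow> real" where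
  "signed_of P = measure_diff P (null_measure borel)"

lemma radon_null: "radon_measure (null_measure borel)"
  by (simp add: radon_measure_def)

lemma signed_of_apply: "B \<in> sets borel \<Longrightarrow> bounded B \<Longrightarrow> signed_of P B = measure P B"
  by (simp add: signed_of_def measure_diff_def)

lemma jordan_signed_of: "radon_measure P \<Longrightarrow> is_jordan_decomp (signed_of P) P (null_measure borel)"
  unfolding is_jordan_decomp_def signed_of_def
  by (auto intro!: radon_null bexI[of _ UNIV])

lemma parts_signed_of:
  "radon_measure P \<Longrightarrow> pos_part (signed_of P) = P"
  "radon_measure P \<Longrightarrow> neg_part (signed_of P) = null_measure borel"
  using jordan_parts[OF jordan_signed_of] by auto

lemma signed_of_inj: "radon_measure P \<Longrightarrow> radon_measure Q \<Longrightarrow> signed_of P = signed_of Q \<longleftrightarrow> P = Q"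
  by (metis parts_signed_of(1))

lemma nonneg_signed_radon:
  assumes "\<nu> \<in> signed_radon" "\<And>B. 0 \<le> \<nu> B"
  obtains P where "radon_measure P" "\<nu> = signed_of P"
proof -
  obtain P0 N0 where "radon_measure P0" "radon_measure N0" "\<nu> = measure_diff P0 N0"
    using assms by (auto simp: signed_radon_def)
  then obtain P N where J: "is_jordan_decomp \<nu> P N" using jordan_decomp_exists[of P0 N0] by metis
  then obtain S where S: "radon_measure P" "radon_measure N" "\<nu> = measure_diff P N"
    "S \<in> sets borel" "emeasure P (- S) = 0" "emeasure N S = 0" by (auto simp: is_jordan_decomp_def)
  have "N = null_measure borel"
  proof (rule radon_eqI[OF S(2) radon_null])
    fix B :: "'a set" assume B: "B \<in> sets borel" "bounded B"
    have bd: "bounded (B - S)" "B - S \<in> sets borel" "B \<inter> S \<in> sets borel" "bounded (B \<inter> S)"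
      using B S by (auto simp: bounded_diff bounded_Int)
    have n: "measure P (B - S) = 0" "measure N (B \<inter> S) = 0"
      using emeasure_mono[of "B - S" "- S" P, OF Diff_subset_conv[THEN iffD2]] emeasure_mono[of "B \<inter> S" S N] S
      by (auto simp: radon_sets measure_def)
    \<comment> \<open>P has no mass off S, so nonnegativity of \<nu> leaves no room for N
      there.\<close>
    have "measure N (B - S) \<le> 0" using assms(2)[of "B - S"] bd n by (simp add: S(3) measure_diff_def)
    moreover have "measure N ((B \<inter> S) \<union> (B - S)) = measure N (B \<inter> S) + measure N (B - S)"
      using bd radon_finite_bounded[OF S(2)] by (intro measure_Union) (auto simp: radon_sets[OF S(2)] less_top)
    ultimately show "measure N B = measure (null_measure borel) B"
      using n measure_nonneg[of N B] by (simp add: Int_Diff_Un antisym)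
  qed
  then show ?thesis using that S by (simp add: signed_of_def)
qed

section \<open>Averages over balls\<close>

text \<open>Truncated multiples of d increase to the indicator of U. The function d is a parameter
  so that one sequence of test functions can serve several measures.\<close>

lemma bounded_open_Cc_limit:
  fixes M :: "'a::euclidean_space measure"
  assumes U: "open U" "bounded U" and M: "radon_measure M"
    and d: "continuous_on UNIV d" "\<And>x. 0 \<le> d x" "\<And>x. 0 < d x \<longleftrightarrow> x \<in> U"
  shows "(\<lambda>k. \<integral>x. min 1 (real k * d x) \<partial>M) \<longlonglongrightarrow> measure M U"
    "(\<lambda>x. min 1 (real k * d x)) \<in> Cc"
proof -
  obtain R where R: "U \<subseteq> cball 0 R"
    using bounded_subset_ballD[OF U(2), of 0] ball_subset_cball by blast
  have C: "(\<lambda>x. min 1 (real k * d x)) \<in> Cc" for k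
  proof (rule CcI)
    fix x :: 'a assume "R < norm x"
    then have "x \<notin> U" using R by auto
    then show "min 1 (real k * d x) = 0" using d(2)[of x] d(3)[of x] by simp
  qed (intro continuous_intros d)
  show "(\<lambda>x. min 1 (real k * d x)) \<in> Cc" for k by (rule C)
  have "(\<lambda>k. \<integral>x. min 1 (real k * d x) \<partial>M) \<longlonglongrightarrow> (\<integral>x. indicator U x \<partial>M)"
  proof (rule integral_dominated_convergence[where w="indicator U"])
    show "(\<lambda>x. min 1 (real k * d x)) \<in> borel_measurable M" for k
      by (rule borel_measurable_integrable[OF radon_integrable_Cc[OF M C]])
    show "integrable M (indicator U :: 'a \<Rightarrow> real)"
      using U radon_finite_bounded[OF M U(2)] by (intro integrable_real_indicator) (auto simp: radon_sets[OF M])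
    then show "(indicator U :: 'a \<Rightarrow> real) \<in> borel_measurable M" by
     (rule borel_measurable_integrable)
    show "AE x in M. (\<lambda>k. min 1 (real k * d x)) \<longlonglongrightarrow> indicator U x"
    proof (intro AE_I2)
      fix x show "(\<lambda>k. min 1 (real k * d x)) \<longlonglongrightarrow> indicator U x"
      proof (cases "x \<in> U")
        case True
        then have "0 < d x" using d by auto
        then obtain n where n: "1 / d x < real n" using reals_Archimedean2 by blast
        have "eventually (\<lambda>k. min 1 (real k * d x) = 1) sequentially"
        proof (rule eventually_sequentiallyI[of n])
          fix k assume "n \<le> k"
          then have "1 / d x < real k" using n by (meson less_le_trans of_nat_mono)
          then show "min 1 (real k * d x) = 1" using \<open>0 < d x\<close> by (simp add: field_simps min_def)
        qed
        then show ?thesis using True by (auto intro: tendsto_eventually)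
      next
        case False
        then have "d x = 0" using d(2)[of x] d(3)[of x] by auto
        then show ?thesis using False by simp
      qed
    qed
    show "AE x in M. norm (min 1 (real k * d x)) \<le> indicator U x" for k
    proof (intro AE_I2)
      fix x show "norm (min 1 (real k * d x)) \<le> indicator U x"
        using d(2)[of x] d(3)[of x] by (cases "x \<in> U") auto
    qed
  qed
  also have "(\<integral>x. indicator U x \<partial>M) = measure M U"
    using U by (simp add: radon_space[OF M])
  finally show "(\<lambda>k. \<integral>x. min 1 (real k * d x) \<partial>M) \<longlonglongrightarrow> measure M U" .
qed

text \<open>Test functions determine the mass of bounded open sets, and these generate the Borel
  sets, are stable under intersection and exhaust the space.\<close>

lemma radon_eqI_Cc:
  fixes P Q :: "'a::euclidean_space measure"
  assumes P: "radon_measure P" and Q: "radon_measure Q"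
    and eq: "\<And>f. f \<in> Cc \<Longrightarrow> (\<integral>x. f x \<partial>P) = (\<integral>x. f x \<partial>Q)"
  shows "P = Q"
proof -
  have open_eq: "emeasure P U = emeasure Q U" if U: "open U" "bounded U" for U
  proof -
    obtain d :: "'a \<Rightarrow> real" where d: "continuous_on UNIV d" "\<And>x. 0 \<le> d x" "\<And>x. 0 < d x \<longleftrightarrow> x \<in> U"
      using open_positive_function[OF U(1)] by metis
    have "measure P U = measure Q U"
      using bounded_open_Cc_limit(1)[OF U P d] bounded_open_Cc_limit(1)[OF U Q d] unfolding eq[OF bounded_open_Cc_limit(2)[OF U P d]] by (rule LIMSEQ_unique)
    then show ?thesis using U P Q by (simp add: radon_emeasure_eq)
  qed
  let ?E = "{U :: 'a set. open U \<and> bounded U}"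
  have gen: "sigma_sets UNIV ?E = sets borel"
  proof
    have "?E \<subseteq> sets borel" by auto
    from sets.sigma_sets_subset[OF this] show "sigma_sets UNIV ?E \<subseteq> sets borel" by simp
    have "U \<in> sigma_sets UNIV ?E" if "open U" for U
    proof -
      have "U = (\<Union>n::nat. U \<inter> ball 0 (real n))" using reals_Archimedean2 by auto
      moreover have "(\<Union>n::nat. U \<inter> ball 0 (real n)) \<in> sigma_sets UNIV ?E"
        using that by (intro sigma_sets.Union sigma_sets.Basic) (auto simp: bounded_Int)
      ultimately show ?thesis by simp
    qed
    then have "sigma_sets UNIV {U. open U} \<subseteq> sigma_sets UNIV ?E"
      by (intro sigma_sets_mono) auto
    then show "sets borel \<subseteq> sigma_sets UNIV ?E" by (simp add: borel_def sets_measure_of_conv)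
  qed
  show ?thesis
  proof (rule measure_eqI_generator_eq[where E="?E" and \<Omega>=UNIV and A="\<lambda>n::nat. ball 0 (real n)"])
    show "Int_stable ?E" by (auto simp: Int_stable_def bounded_Int)
    show "(\<Union>n::nat. ball (0::'a) (real n)) = UNIV" using reals_Archimedean2 by auto
    show "emeasure P (ball 0 (real n)) \<noteq> \<infinity>" for n
      using radon_finite_bounded[OF P, of "ball 0 (real n)"] by auto
  qed (use open_eq gen P Q in \<open>auto simp: radon_sets\<close>)
qed

lemma Cc_uniformly_continuous:
  assumes "f \<in> Cc" "e > 0"
  obtains d where "d > 0" "\<And>x y. dist x y < d \<Longrightarrow> \<bar>f x - f y\<bar> < e"
proof -
  obtain R where R: "\<And>x. R < norm x \<Longrightarrow> f x = 0" using assms by (auto simp: Cc_iff)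
  have "uniformly_continuous_on (cball 0 (R+1)) f"
    using Cc_continuous[OF assms(1)] by (intro compact_uniformly_continuous) (auto intro: continuous_on_subset)
  then obtain d where d: "d > 0" "\<And>x y. x \<in> cball 0 (R+1) \<Longrightarrow> y \<in> cball 0 (R+1) \<Longrightarrow> dist y x < d \<Longrightarrow> dist (f y) (f x) < e"
    using assms(2) unfolding uniformly_continuous_on_def by metis
  \<comment> \<open>A step below 1 cannot lead from outside the ball of radius R + 1 into the ball
    of radius R, so at far points both values are 0.\<close>
  have "\<bar>f x - f y\<bar> < e" if xy: "dist x y < min d 1" for x y
  proof (cases "norm x \<le> R + 1 \<and> norm y \<le> R + 1")
    case True
    then show ?thesis using d(2)[of y x] xy by (auto simp: dist_real_def)
  next
    case False
    have "norm x \<le> norm y + dist x y" "norm y \<le> norm x + dist x y"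
      using norm_triangle_ineq2[of x y] norm_triangle_ineq2[of y x] by (auto simp: dist_norm norm_minus_commute)
    then have "R < norm x" "R < norm y" using False xy by auto
    then show ?thesis using R assms(2) by simp
  qed
  then show ?thesis using d(1) by (intro that[of "min d 1"]) auto
qed

section \<open>The measure on the space of balls\<close>

text \<open>Pairs \<open>p = (z, r)\<close> stand for the balls \<open>ball z r\<close>.\<close>

definition ball_measure :: "real \<Rightarrow> real \<Rightarrow> ('a::euclidean_space \<times> real) measure" where
  "ball_measure c \<beta> = density lborel (\<lambda>p. ennreal (c * snd p powr \<beta>) * indicator {0<..} (snd p))"

abbreviation pball :: "'a::euclidean_space \<times> real \<Rightarrow> 'a set" where
  "pball p \<equiv> ball (fst p) (snd p)"

lemma sets_ball_measure[simp, measurable_cong]: "sets (ball_measure c \<beta>) = sets borel"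
  by (simp add: ball_measure_def)

lemma space_ball_measure[simp]: "space (ball_measure c \<beta>) = UNIV"
  by (simp add: ball_measure_def)

lemma fst_snd_measurable[measurable]:
  "fst \<in> borel_measurable (borel :: ('a::euclidean_space \<times> real) measure)"
  "snd \<in> borel_measurable (borel :: ('a::euclidean_space \<times> real) measure)"
  by (auto intro!: borel_measurable_continuous_onI continuous_intros)

lemma ball_weight_measurable[measurable]:
  "(\<lambda>p. ennreal (c * snd p powr \<beta>) * indicator {0<..} (snd p)) \<in> borel_measurable (borel :: ('a::euclidean_space \<times> real) measure)"
  by measurable

lemma sigma_finite_ball_measure: "sigma_finite_measure (ball_measure c \<beta>)"
  unfolding ball_measure_def
  by (subst sigma_finite_measure.sigma_finite_iff_density_finite[OF lborel.sigma_finite_measure_axioms]) (auto simp: ennreal_mult_eq_top_iff indicator_def)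

lemma nn_integral_ball_measure:
  fixes f :: "'a::euclidean_space \<times> real \<Rightarrow> ennreal"
  assumes [measurable]: "f \<in> borel_measurable borel"
  shows "(\<integral>\<^sup>+p. f p \<partial>ball_measure c \<beta>) =
    (\<integral>\<^sup>+r. ennreal (c * r powr \<beta>) * indicator {0<..} r * (\<integral>\<^sup>+z. f (z, r) \<partial>lborel) \<partial>lborel)"
proof -
  have [measurable]: "f \<in> borel_measurable (borel \<Otimes>\<^sub>M borel)" using assms by (simp add: borel_prod)
  have "(\<integral>\<^sup>+p. f p \<partial>ball_measure c \<beta>) =
    (\<integral>\<^sup>+p. ennreal (c * snd p powr \<beta>) * indicator {0<..} (snd p) * f p \<partial>lborel)"
    unfolding ball_measure_def by (subst nn_integral_density) auto
  also have "\<dots> = (\<integral>\<^sup>+p. ennreal (c * snd p powr \<beta>) * indicator {0<..} (snd p) * f p \<partial>(lborel \<Otimes>\<^sub>M lborel))"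
    by (simp add: lborel_prod)
  also have "\<dots> = (\<integral>\<^sup>+r. (\<integral>\<^sup>+z. ennreal (c * r powr \<beta>) * indicator {0<..} r * f (z, r) \<partial>lborel) \<partial>lborel)"
    by (subst lborel_pair.nn_integral_snd[symmetric]) auto
  also have "\<dots> = (\<integral>\<^sup>+r. ennreal (c * r powr \<beta>) * indicator {0<..} r * (\<integral>\<^sup>+z. f (z, r) \<partial>lborel) \<partial>lborel)"
    by (intro nn_integral_cong nn_integral_cmult) auto
  finally show ?thesis .
qed

lemma ball_incidence_measurable[measurable]:
  "{p. x \<in> pball p} \<in> sets borel" "{q. snd q \<in> pball (fst q)} \<in> sets borel"
  "{q. fst q \<in> pball (snd q)} \<in> sets borel"
  by (auto intro!: borel_open open_Collect_less continuous_intros simp: mem_ball)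

lemma indicator_pball_measurable[measurable]:
  "(\<lambda>p. indicator (pball p) x :: 'b::{real_normed_algebra_1}) \<in> borel_measurable borel" for x :: "'a::euclidean_space"
  using borel_measurable_indicator[OF ball_incidence_measurable(1)[of x]]
  by (simp add: indicator_def[abs_def])

lemma indicator_pball_measurable_ennreal[measurable]:
  "(\<lambda>p. indicator (pball p) x :: ennreal) \<in> borel_measurable borel" for x :: "'a::euclidean_space"
  using borel_measurable_indicator[OF ball_incidence_measurable(1)[of x]]
  by (simp add: indicator_def[abs_def])

text \<open>The mass of all balls that contain a given point and have radius between a and b; by
  translation invariance it is the same for every point. The type argument supplies the
  dimension.\<close>

definition ball_weight :: "'a::euclidean_space itself \<Rightarrow> real \<Rightarrow> real \<Rightarrow> real \<Rightarrow> real \<Rightarrow> ennreal" where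
  "ball_weight _ c \<beta> a b = (\<integral>\<^sup>+r. ennreal (c * r powr \<beta>) * indicator {0<..} r *
     (ennreal (unit_ball_vol (real DIM('a)) * r ^ DIM('a)) * indicator {a..b} r) \<partial>lborel)"

lemma ball_weight:
  fixes x :: "'a::euclidean_space" assumes "0 < a"
  shows "(\<integral>\<^sup>+p. indicator (pball p) x * indicator {a..b} (snd p) \<partial>ball_measure c \<beta>) = ball_weight TYPE('a) c \<beta> a b"
proof -
  have "(\<integral>\<^sup>+z. indicator (pball (z, r)) x * indicator {a..b} (snd (z, r)) \<partial>lborel)
     = ennreal (unit_ball_vol (real DIM('a)) * r ^ DIM('a)) * indicator {a..b} r" for r
  proof (cases "0 \<le> r")
    case True
    have "(\<lambda>z. indicator (pball (z, r)) x * indicator {a..b} (snd (z, r))) = (\<lambda>z. indicator {a..b} r * indicator (ball x r) z :: ennreal)"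
      by (auto simp: fun_eq_iff indicator_def dist_commute)
    then show ?thesis using True
      by (simp only: nn_integral_cmult_indicator[of "ball x r" lborel] sets_lborel borel_open open_ball emeasure_ball)
         (simp only: mult.commute)
  qed (use assms in \<open>auto simp: indicator_def\<close>)
  then show ?thesis unfolding ball_weight_def
    by (subst nn_integral_ball_measure) auto
qed

text \<open>For \<beta> \<le> -1 the density is not integrable at radius 0, hence the positive lower
  bound a on the radius.\<close>

lemma ball_measure_bounded_finite:
  fixes R :: real assumes "0 < a"
  shows "emeasure (ball_measure c \<beta>) (cball (0::'a::euclidean_space) R \<times> {a..b}) < \<infinity>"
proof -
  have "bounded ((\<lambda>r. r powr \<beta>) ` {a..b})"
    using assms by (intro compact_imp_bounded compact_continuous_image continuous_intros) auto
  then obtain B where B: "\<And>r. r \<in> {a..b} \<Longrightarrow> \<bar>r powr \<beta>\<bar> \<le> B" by (fastforce simp: bounded_iff)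
  have cl: "cball (0::'a) R \<times> {a..b} \<in> sets borel" by (intro borel_closed closed_Times) auto
  have "emeasure (ball_measure c \<beta>) (cball (0::'a) R \<times> {a..b})
     = (\<integral>\<^sup>+p. ennreal (c * snd p powr \<beta>) * indicator {0<..} (snd p) * indicator (cball (0::'a) R \<times> {a..b}) p \<partial>lborel)"
    unfolding ball_measure_def using cl by (subst emeasure_density) auto
  also have "\<dots> \<le> (\<integral>\<^sup>+p. ennreal (\<bar>c\<bar> * B) * indicator (cball (0::'a) R \<times> {a..b}) p \<partial>lborel)"
  proof (intro nn_integral_mono)
    fix p :: "'a \<times> real"
    have "c * snd p powr \<beta> \<le> \<bar>c\<bar> * B" if "snd p \<in> {a..b}"
    proof -
      have "c * snd p powr \<beta> \<le> \<bar>c\<bar> * \<bar>snd p powr \<beta>\<bar>" by (metis abs_ge_self abs_mult)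
      also have "\<dots> \<le> \<bar>c\<bar> * B" using B[OF that] by (intro mult_left_mono) auto
      finally show ?thesis .
    qed
    then show "ennreal (c * snd p powr \<beta>) * indicator {0<..} (snd p) * indicator (cball 0 R \<times> {a..b}) p
      \<le> ennreal (\<bar>c\<bar> * B) * indicator (cball 0 R \<times> {a..b}) p"
      by (auto simp: indicator_def mem_Times_iff intro: ennreal_leI)
  qed
  also have "\<dots> = ennreal (\<bar>c\<bar> * B) * emeasure lborel (cball (0::'a) R \<times> {a..b})"
    using cl by (subst nn_integral_cmult_indicator) auto
  also have "\<dots> < \<infinity>"
  proof -
    have "bounded (cball (0::'a) R \<times> {a..b})" by (intro bounded_Times) auto
    then have "emeasure lborel (cball (0::'a) R \<times> {a..b}) < \<infinity>" by (rule emeasure_bounded_finite)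
    then show ?thesis by (simp add: ennreal_mult_less_top)
  qed
  finally show ?thesis .
qed

lemma ball_weight_finite_pos:
  assumes "0 < c" "0 < a" "a < b"
  shows "0 < ball_weight TYPE('a::euclidean_space) c \<beta> a b" "ball_weight TYPE('a) c \<beta> a b < \<infinity>"
proof -
  have "ball_weight TYPE('a) c \<beta> a b \<noteq> 0"
  proof
    assume "ball_weight TYPE('a) c \<beta> a b = 0"
    then have "AE r in lborel. ennreal (c * r powr \<beta>) * indicator {0<..} r *
     (ennreal (unit_ball_vol (real DIM('a)) * r ^ DIM('a)) * indicator {a..b} r) = 0"
      unfolding ball_weight_def by (subst (asm) nn_integral_0_iff_AE) auto
    then have "AE r in lborel. r \<notin> {a<..<b}"
    proof (rule AE_mp, intro AE_I2 impI notI)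
      fix r :: real assume r: "r \<in> {a<..<b}" "ennreal (c * r powr \<beta>) * indicator {0<..} r *
         (ennreal (unit_ball_vol (real DIM('a)) * r ^ DIM('a)) * indicator {a..b} r) = 0"
      have "0 < unit_ball_vol (real DIM('a)) * r ^ DIM('a)" "0 < c * r powr \<beta>"
        using r assms unit_ball_vol_pos[of "real DIM('a)"] by auto
      then show False using r assms by (auto simp: indicator_def ennreal_eq_0_iff)
    qed
    then have "emeasure lborel {a<..<b} = 0" by (subst (asm) AE_iff_measurable[of "{a<..<b}"]) auto
    then show False using assms by simp
  qed
  then show "0 < ball_weight TYPE('a) c \<beta> a b" by (simp add: zero_less_iff_neq_zero)
  have "ball_weight TYPE('a) c \<beta> a b = (\<integral>\<^sup>+p. indicator (pball p) (0::'a) * indicator {a..b} (snd p) \<partial>ball_measure c \<beta>)"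
    using assms by (simp add: ball_weight)
  also have "\<dots> \<le> (\<integral>\<^sup>+p. indicator (cball (0::'a) b \<times> {a..b}) p \<partial>ball_measure c \<beta>)"
    by (intro nn_integral_mono) (auto simp: indicator_def mem_Times_iff)
  also have "\<dots> = emeasure (ball_measure c \<beta>) (cball (0::'a) b \<times> {a..b})"
    by (intro nn_integral_indicator) (auto intro!: borel_closed closed_Times)
  also have "\<dots> < \<infinity>" by (rule ball_measure_bounded_finite) fact
  finally show "ball_weight TYPE('a) c \<beta> a b < \<infinity>" .
qed

section \<open>Ball masses of a Radon measure\<close>

text \<open>The balls whose boundary passes through a fixed x are the pairs (z, dist z x): one
  radius for each centre, a Lebesgue null set. Tonelli's theorem turns this into a statement about
  almost every ball.\<close>

lemma AE_not_on_sphere: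
  fixes P :: "'a::euclidean_space measure"
  assumes P: "radon_measure P"
  shows "AE p in ball_measure c \<beta>. emeasure P (sphere (fst p) (snd p)) = 0"
proof -
  interpret P: sigma_finite_measure P by (rule radon_sigma_finite[OF P])
  interpret B: sigma_finite_measure "ball_measure c \<beta> :: ('a \<times> real) measure" by (rule sigma_finite_ball_measure)
  interpret PB: pair_sigma_finite P "ball_measure c \<beta> :: ('a \<times> real) measure" ..
  define S where "S = {q :: 'a \<times> ('a \<times> real). dist (fst (snd q)) (fst q) = snd (snd q)}"
  have "closed S" unfolding S_def by (intro closed_Collect_eq continuous_intros)
  then have "S \<in> sets borel" by (rule borel_closed)
  then have "S \<in> sets (borel \<Otimes>\<^sub>M borel)" unfolding borel_prod .
  then have mS[measurable]: "S \<in> sets (P \<Otimes>\<^sub>M ball_measure c \<beta>)"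
    by (simp only: sets_pair_measure_cong[OF radon_sets[OF P] sets_ball_measure])
  have null: "emeasure (ball_measure c \<beta>) (Pair x -` S) = 0" for x
  proof -
    have cl: "closed (Pair x -` S)" unfolding S_def vimage_def by (auto intro!: closed_Collect_eq continuous_intros)
    then have s: "Pair x -` S \<in> sets (lborel \<Otimes>\<^sub>M lborel)"
      unfolding lborel_prod sets_lborel by (rule borel_closed)
    have "emeasure lborel (Pair x -` S) = emeasure (lborel \<Otimes>\<^sub>M lborel) (Pair x -` S)"
      by (simp only: lborel_prod)
    also have "\<dots> = (\<integral>\<^sup>+z. emeasure lborel (Pair z -` (Pair x -` S)) \<partial>lborel)"
      using s by (rule lborel.emeasure_pair_measure_alt)
    also have "\<dots> = (\<integral>\<^sup>+z. emeasure lborel {dist z x} \<partial>(lborel :: 'a measure))"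
      by (intro nn_integral_cong arg_cong[where f="emeasure lborel"]) (auto simp: S_def)
    finally have "emeasure lborel (Pair x -` S) = 0" by simp
    then have "Pair x -` S \<in> null_sets lborel" using cl by auto
    then have "Pair x -` S \<in> null_sets (ball_measure c \<beta>)"
      unfolding ball_measure_def
      using absolutely_continuousI_density[of "\<lambda>p. ennreal (c * snd p powr \<beta>) * indicator {0<..} (snd p)" "lborel :: ('a \<times> real) measure"]
      by (auto simp: absolutely_continuous_def)
    then show ?thesis by auto
  qed
  have "(\<integral>\<^sup>+p. emeasure P ((\<lambda>x. (x, p)) -` S) \<partial>ball_measure c \<beta>) = emeasure (P \<Otimes>\<^sub>M ball_measure c \<beta>) S"
    by (rule PB.emeasure_pair_measure_alt2[symmetric]) measurable
  also have "\<dots> = (\<integral>\<^sup>+x. emeasure (ball_measure c \<beta>) (Pair x -` S) \<partial>P)"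
    by (rule B.emeasure_pair_measure_alt) measurable
  also have "\<dots> = 0" by (simp add: null)
  finally have 0: "(\<integral>\<^sup>+p. emeasure P ((\<lambda>x. (x, p)) -` S) \<partial>ball_measure c \<beta>) = 0" .
  have "AE p in ball_measure c \<beta>. emeasure P ((\<lambda>x. (x, p)) -` S) = 0"
    using 0 nn_integral_0_iff_AE[OF PB.measurable_emeasure_Pair2[OF mS]] by blast
  moreover have "(\<lambda>x. (x, p)) -` S = sphere (fst p) (snd p)" for p
    by (auto simp: S_def)
  ultimately show ?thesis by simp
qed

lemma measure_pball_measurable[measurable]:
  assumes P: "radon_measure P"
  shows "(\<lambda>p. emeasure P (pball p)) \<in> borel_measurable (borel :: ('a::euclidean_space \<times> real) measure)"
    "(\<lambda>p. measure P (pball p)) \<in> borel_measurable (borel :: ('a::euclidean_space \<times> real) measure)"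
proof -
  interpret P: sigma_finite_measure P by (rule radon_sigma_finite[OF P])
  have "{q :: ('a \<times> real) \<times> 'a. snd q \<in> pball (fst q)} \<in> sets (borel \<Otimes>\<^sub>M borel)"
    unfolding borel_prod by measurable
  then have "{q :: ('a \<times> real) \<times> 'a. snd q \<in> pball (fst q)} \<in> sets (borel \<Otimes>\<^sub>M P)"
    by (simp only: sets_pair_measure_cong[OF refl radon_sets[OF P]])
  from P.measurable_emeasure_Pair[OF this]
  show *: "(\<lambda>p. emeasure P (pball p)) \<in> borel_measurable (borel :: ('a \<times> real) measure)"
    by (simp add: vimage_def ball_def)
  show "(\<lambda>p. measure P (pball p)) \<in> borel_measurable (borel :: ('a \<times> real) measure)"
    unfolding measure_def using * by measurable
qed

text \<open>The function \<open>g\<close> is chosen so that testing it against \<open>p \<mapsto> P (pball p)\<close> amounts to integrating,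
  with respect to \<open>P\<close>, the mean of the averages of \<open>\<phi>\<close> over the balls of radius between \<open>a\<close> and \<open>2 a\<close>.\<close>

lemma smoothing:
  fixes \<phi> :: "'a::euclidean_space \<Rightarrow> real"
  assumes c: "0 < c" and \<phi>: "\<phi> \<in> Cc" and R0: "\<And>x. R0 < norm x \<Longrightarrow> \<phi> x = 0" and e: "0 < e"
  shows "\<exists>(g :: 'a \<times> real \<Rightarrow> real) a b B. g \<in> borel_measurable borel \<and> 0 < a \<and> 0 < B \<and>
    (\<forall>p. \<bar>g p\<bar> \<le> B * indicator (cball 0 (R0 + 1) \<times> {a..b}) p) \<and>
    (\<forall>P. radon_measure P \<longrightarrow> integrable (ball_measure c \<beta>) (\<lambda>p. g p * measure P (pball p))) \<and>
    (\<forall>P. radon_measure P \<longrightarrow>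
      \<bar>(\<integral>x. \<phi> x \<partial>P) - (\<integral>p. g p * measure P (pball p) \<partial>ball_measure c \<beta>)\<bar> \<le> e * measure P (cball 0 (R0 + 1)))"
proof -
  obtain d where d: "d > 0" "\<And>x y. dist x y < d \<Longrightarrow> \<bar>\<phi> x - \<phi> y\<bar> < e"
    using Cc_uniformly_continuous[OF \<phi> e] by metis
  obtain B0 where B0: "0 < B0" "\<And>x. \<bar>\<phi> x\<bar> \<le> B0" using Cc_bounded[OF \<phi>] by metis
  \<comment> \<open>Radii up to 2 a are at most d, so \<phi> differs by less than e between a point
    of such a ball and its centre; they are at most 1, so balls centred in the support stay within
    radius R0 + 1.\<close>
  define a where "a = min (d / 2) (1 / 2)"
  have a: "0 < a" "a < 2 * a" "2 * a \<le> d" "2 * a \<le> 1" using d(1) by (auto simp: a_def)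
  define M where "M = (ball_measure c \<beta> :: ('a \<times> real) measure)"
  define Q where "Q = ball_weight TYPE('a) c \<beta> a (2 * a)"
  define q where "q = enn2real Q"
  have Q: "0 < Q" "Q < \<infinity>" using ball_weight_finite_pos[OF c a(1,2)] unfolding Q_def by auto
  then have q: "0 < q" and Qq: "Q = ennreal q" by (auto simp: q_def enn2real_positive_iff)
  define R where "R = R0 + 1"
  define K where "K = cball (0::'a) R \<times> {a..2*a}"
  have sM[measurable_cong]: "sets M = sets borel" by (simp add: M_def)
  have sK[measurable]: "K \<in> sets borel" unfolding K_def by (intro borel_closed closed_Times) auto
  have Kfin: "emeasure M K < \<infinity>" unfolding M_def K_def by (rule ball_measure_bounded_finite[OF a(1)])
  \<comment> \<open>Dividing by q, the mass of the balls around a point with radius in the chosen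
    range, turns the integral of \<open>g p * indicator (pball p) x\<close> over p into a weighted
    mean of \<phi> at centres near x.\<close>
  define g where "g p = \<phi> (fst p) * indicator {a..2*a} (snd p) / q" for p :: "'a \<times> real"
  have \<phi>m[measurable]: "\<phi> \<in> borel_measurable borel" using \<phi> by (rule Cc_measurable)
  have gm[measurable]: "g \<in> borel_measurable borel" unfolding g_def by measurable
  have gb: "\<bar>g p\<bar> \<le> (B0 / q) * indicator K p" for p
    using B0 R0[of "fst p"] q a(1)
    by (cases "norm (fst p) \<le> R") (auto simp: g_def K_def R_def indicator_def mem_Times_iff field_simps)
  have k_int: "has_bochner_integral M (\<lambda>p. indicator (pball p) x * indicator {a..2*a} (snd p)) q" for x :: 'a
  proof (rule has_bochner_integral_nn_integral)
    show "(\<lambda>p. indicator (pball p) x * indicator {a..2*a} (snd p) :: real) \<in> borel_measurable M" by measurable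
    have "(\<integral>\<^sup>+p. ennreal (indicator (pball p) x * indicator {a..2*a} (snd p)) \<partial>M)
      = (\<integral>\<^sup>+p. indicator (pball p) x * indicator {a..2*a} (snd p) \<partial>M)"
      by (intro nn_integral_cong) (auto simp: indicator_def)
    also have "\<dots> = ennreal q" unfolding Qq[symmetric] Q_def M_def by (rule ball_weight[OF a(1)])
    finally show "(\<integral>\<^sup>+p. ennreal (indicator (pball p) x * indicator {a..2*a} (snd p)) \<partial>M) = ennreal q" .
  qed (use q in auto)
  define S where "S x = (\<integral>p. g p * indicator (pball p) x \<partial>M)" for x
  have gi: "integrable M (\<lambda>p. g p * indicator (pball p) x)" for x
  proof (rule Bochner_Integration.integrable_bound)
    show "integrable M (\<lambda>p. (B0 / q) * indicator K p :: real)"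
      using Kfin by (intro integrable_mult_right integrable_real_indicator) auto
    show "AE p in M. norm (g p * indicator (pball p) x) \<le> norm ((B0 / q) * indicator K p :: real)"
    proof (intro AE_I2)
      fix p show "norm (g p * indicator (pball p) x) \<le> norm ((B0 / q) * indicator K p :: real)"
        using gb[of p] q B0(1) by (auto simp: indicator_def)
    qed
  qed measurable
  \<comment> \<open>By \<open>k_int\<close> the value \<phi> x is itself such a mean, of a constant,
    so the two integrands can be compared ball by ball.\<close>
  have S1: "\<bar>\<phi> x - S x\<bar> \<le> e" for x
  proof -
    have "\<phi> x = (\<integral>p. \<phi> x * (indicator (pball p) x * indicator {a..2*a} (snd p)) / q \<partial>M)"
      using has_bochner_integral_integral_eq[OF k_int[of x]] q by simp
    moreover have i1: "integrable M (\<lambda>p. \<phi> x * (indicator (pball p) x * indicator {a..2*a} (snd p)) / q)"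
      using has_bochner_integral_iff k_int[of x] by (intro integrable_divide integrable_mult_right) blast
    ultimately have "\<phi> x - S x = (\<integral>p. \<phi> x * (indicator (pball p) x * indicator {a..2*a} (snd p)) / q
        - g p * indicator (pball p) x \<partial>M)"
      unfolding S_def using gi[of x] by simp
    also have "\<bar>\<dots>\<bar> \<le> (\<integral>p. e * (indicator (pball p) x * indicator {a..2*a} (snd p)) / q \<partial>M)"
    proof (rule integral_abs_bound_integral)
      show "integrable M (\<lambda>p. \<phi> x * (indicator (pball p) x * indicator {a..2*a} (snd p)) / q - g p * indicator (pball p) x)"
        using i1 gi by (rule Bochner_Integration.integrable_diff)
      show "integrable M (\<lambda>p. e * (indicator (pball p) x * indicator {a..2*a} (snd p)) / q)"
        using has_bochner_integral_iff k_int[of x] by (intro integrable_divide integrable_mult_right) blast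
      fix p
      have "\<bar>\<phi> x - \<phi> (fst p)\<bar> \<le> e" if "x \<in> pball p" "snd p \<in> {a..2*a}"
        using d(2)[of x "fst p"] that a(3) by (auto simp: dist_commute)
      then show "\<bar>\<phi> x * (indicator (pball p) x * indicator {a..2*a} (snd p)) / q - g p * indicator (pball p) x\<bar>
        \<le> e * (indicator (pball p) x * indicator {a..2*a} (snd p)) / q"
        using q by (auto simp: g_def indicator_def diff_divide_distrib[symmetric] divide_right_mono)
    qed
    also have "\<dots> = e" using has_bochner_integral_integral_eq[OF k_int[of x]] q by simp
    finally show ?thesis .
  qed
  have S0: "S x = 0" "\<phi> x = 0" if "R < norm x" for x
  proof -
    show "\<phi> x = 0" using that R0[of x] a by (simp add: R_def)
    have z: "g p * indicator (pball p) x = 0" for p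
    proof (cases "x \<in> pball p \<and> snd p \<in> {a..2*a}")
      case True
      then have "norm x \<le> norm (fst p) + 1"
        using norm_triangle_ineq2[of x "fst p"] a(4) by (auto simp: dist_norm norm_minus_commute)
      then show ?thesis using that R0[of "fst p"] by (auto simp: g_def R_def)
    qed (auto simp: g_def)
    show "S x = 0" unfolding S_def z by simp
  qed
  have Sb: "\<bar>\<phi> x - S x\<bar> \<le> e * indicator (cball 0 R) x" for x
    using S1[of x] S0[of x] by (cases "norm x \<le> R") auto
  show ?thesis
  proof (rule exI[of _ g], rule exI[of _ a], rule exI[of _ "2 * a"], rule exI[of _ "B0 / q"], intro conjI allI impI)
    show "0 < a" "0 < B0 / q" using a B0 q by auto
    show "\<bar>g p\<bar> \<le> B0 / q * indicator (cball 0 (R0 + 1) \<times> {a..2*a}) p" for p using gb[of p] by (simp add: K_def R_def)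
    show "g \<in> borel_measurable borel" by measurable
    fix P :: "'a measure" assume P: "radon_measure P"
    have sP[measurable_cong]: "sets P = sets borel" using P by (rule radon_sets)
    interpret P: sigma_finite_measure P by (rule radon_sigma_finite[OF P])
    interpret M: sigma_finite_measure M unfolding M_def by (rule sigma_finite_ball_measure)
    interpret PM: pair_sigma_finite P M ..
    have "{q :: 'a \<times> ('a \<times> real). fst q \<in> pball (snd q)} \<in> sets (borel \<Otimes>\<^sub>M borel)"
      unfolding borel_prod by measurable
    then have s: "{q :: 'a \<times> ('a \<times> real). fst q \<in> pball (snd q)} \<in> sets (P \<Otimes>\<^sub>M M)"
      by (simp only: sets_pair_measure_cong[OF sP sM])
    then have ind: "(\<lambda>q. indicator (pball (snd q)) (fst q) :: real) \<in> borel_measurable (P \<Otimes>\<^sub>M M)"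
      using borel_measurable_indicator[OF s] by (simp add: indicator_def[abs_def])
    have int: "integrable (P \<Otimes>\<^sub>M M) (\<lambda>q. g (snd q) * indicator (pball (snd q)) (fst q))"
    proof (rule Bochner_Integration.integrable_bound)
      show "integrable (P \<Otimes>\<^sub>M M) (\<lambda>w. (B0 / q) * indicator (cball 0 (R + 2 * a) \<times> K) w :: real)"
      proof (intro integrable_mult_right integrable_real_indicator)
        have "emeasure P (cball 0 (R + 2 * a)) < \<infinity>" by (rule radon_finite_bounded[OF P]) auto
        then show "emeasure (P \<Otimes>\<^sub>M M) (cball 0 (R + 2 * a) \<times> K) < \<infinity>"
          using Kfin by (subst M.emeasure_pair_measure_Times) (auto simp: ennreal_mult_less_top)
      qed auto
      show "(\<lambda>q. g (snd q) * indicator (pball (snd q)) (fst q)) \<in> borel_measurable (P \<Otimes>\<^sub>M M)"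
        using ind by measurable
      show "AE r in P \<Otimes>\<^sub>M M. norm (g (snd r) * indicator (pball (snd r)) (fst r))
          \<le> norm ((B0 / q) * indicator (cball 0 (R + 2 * a) \<times> K) r :: real)"
      proof (intro AE_I2)
        fix r :: "'a \<times> ('a \<times> real)"
        show "norm (g (snd r) * indicator (pball (snd r)) (fst r))
          \<le> norm ((B0 / q) * indicator (cball 0 (R + 2 * a) \<times> K) r :: real)"
        proof (cases "fst r \<in> pball (snd r) \<and> snd r \<in> K")
          case True
          then have "norm (fst r) \<le> R + 2 * a"
            using norm_triangle_ineq2[of "fst r" "fst (snd r)"] by (auto simp: dist_norm norm_minus_commute K_def mem_Times_iff)
          then show ?thesis using True gb[of "snd r"] q B0(1) by (simp add: mem_Times_iff indicator_def)
        next
          case False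
          then show ?thesis using gb[of "snd r"] q B0(1) by (auto simp: indicator_def)
        qed
      qed
    qed
    have inner: "(\<integral>x. g p * indicator (pball p) x \<partial>P) = g p * measure P (pball p)" for p
      by (simp add: radon_space[OF P])
    show "integrable (ball_measure c \<beta>) (\<lambda>p. g p * measure P (pball p))"
      using PM.integrable_snd[of "\<lambda>x p. g p * indicator (pball p) x"] int
      by (simp add: inner case_prod_unfold M_def)
    have "(\<integral>p. g p * measure P (pball p) \<partial>M) = (\<integral>p. (\<integral>x. g p * indicator (pball p) x \<partial>P) \<partial>M)"
      by (simp only: inner)
    also have "\<dots> = (\<integral>x. S x \<partial>P)"
      unfolding S_def using int by (intro PM.Fubini_integral) (simp add: case_prod_unfold)
    finally have F: "(\<integral>p. g p * measure P (pball p) \<partial>M) = (\<integral>x. S x \<partial>P)" .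
    have Sint: "integrable P S"
      using PM.integrable_fst'[OF int] by (simp add: S_def[abs_def])
    have "(\<integral>x. \<phi> x \<partial>P) - (\<integral>x. S x \<partial>P) = (\<integral>x. \<phi> x - S x \<partial>P)"
      using Sint radon_integrable_Cc[OF P \<phi>] by simp
    also have "\<bar>\<dots>\<bar> \<le> (\<integral>x. e * indicator (cball 0 R) x \<partial>P)"
    proof (rule integral_abs_bound_integral)
      show "integrable P (\<lambda>x. e * indicator (cball 0 R) x :: real)"
        using radon_finite_bounded[OF P, of "cball 0 R"]
        by (intro integrable_mult_right integrable_real_indicator) auto
    qed (use Sb Sint radon_integrable_Cc[OF P \<phi>] in auto)
    also have "\<dots> = e * measure P (cball 0 R)" by (simp add: radon_space[OF P])
    finally show "\<bar>(\<integral>x. \<phi> x \<partial>P) - (\<integral>p. g p * measure P (pball p) \<partial>ball_measure c \<beta>)\<bar> \<le> e * measure P (cball 0 (R0 + 1))"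
      using F by (simp add: M_def R_def)
  qed
qed

text \<open>Smoothing recovers integrals of test functions from ball masses up to a small error, and
  it reads these masses only through an integral over balls, so agreement almost everywhere
  suffices.\<close>

lemma radon_eqI_pball:
  fixes P Q :: "'a::euclidean_space measure"
  assumes P: "radon_measure P" and Q: "radon_measure Q" and c: "0 < c"
    and eq: "AE p in ball_measure c \<beta>. measure P (pball p) = measure Q (pball p)"
  shows "P = Q"
proof (rule radon_eqI_Cc[OF P Q])
  fix \<phi> :: "'a \<Rightarrow> real" assume \<phi>: "\<phi> \<in> Cc"
  obtain R0 where R0: "\<And>x. R0 < norm x \<Longrightarrow> \<phi> x = 0" using \<phi> by (auto simp: Cc_iff)
  show "(\<integral>x. \<phi> x \<partial>P) = (\<integral>x. \<phi> x \<partial>Q)"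
  proof (rule ccontr)
    assume neq: "(\<integral>x. \<phi> x \<partial>P) \<noteq> (\<integral>x. \<phi> x \<partial>Q)"
    define D where "D = \<bar>(\<integral>x. \<phi> x \<partial>P) - (\<integral>x. \<phi> x \<partial>Q)\<bar>"
    define m where "m = measure P (cball 0 (R0 + 1)) + measure Q (cball 0 (R0 + 1))"
    have "0 < D" using neq by (simp add: D_def)
    have "0 \<le> m" by (simp add: m_def)
    \<comment> \<open>The two smoothing errors add up to at most \<open>e * m\<close>, which is
      below D.\<close>
    define e where "e = D / (m + 1)"
    have e: "0 < e" using \<open>0 < D\<close> \<open>0 \<le> m\<close> by (simp add: e_def)
    obtain g :: "'a \<times> real \<Rightarrow> real" and a b B where g: "g \<in> borel_measurable borel" "0 < a" "0 < B"
      "\<And>p. \<bar>g p\<bar> \<le> B * indicator (cball 0 (R0 + 1) \<times> {a..b}) p"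
      "\<And>P. radon_measure P \<Longrightarrow> integrable (ball_measure c \<beta>) (\<lambda>p. g p * measure P (pball p))"
      "\<And>P. radon_measure P \<Longrightarrow>
      \<bar>(\<integral>x. \<phi> x \<partial>P) - (\<integral>p. g p * measure P (pball p) \<partial>ball_measure c \<beta>)\<bar> \<le> e * measure P (cball 0 (R0 + 1))"
      using smoothing[OF c \<phi> R0 e, where \<beta>=\<beta>] by blast
    have "(\<integral>p. g p * measure P (pball p) \<partial>ball_measure c \<beta>) = (\<integral>p. g p * measure Q (pball p) \<partial>ball_measure c \<beta>)"
    proof (rule integral_cong_AE)
      show "AE p in ball_measure c \<beta>. g p * measure P (pball p) = g p * measure Q (pball p)"
        using eq by eventually_elim simp
    qed (use g(1) measure_pball_measurable(2)[OF P] measure_pball_measurable(2)[OF Q] in measurable)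
    then have "D \<le> e * m"
      using g(6)[OF P] g(6)[OF Q] unfolding D_def m_def distrib_left by linarith
    also have "\<dots> < e * (m + 1)" using e by simp
    also have "\<dots> = D" using \<open>0 \<le> m\<close> by (simp add: e_def)
    finally show False by simp
  qed
qed

section \<open>The Riesz kernel as an integral over balls\<close>

text \<open>Rotation invariance of Lebesgue measure enters through the uniqueness of a measure with given
  values on balls.\<close>

lemma scaled_ball_intersection:
  fixes x y e :: "real ^ 'n"
  assumes d: "0 < d" and xy: "norm (y - x) = d * norm e"
  shows "emeasure lborel (ball x (d * u) \<inter> ball y (d * u)) = ennreal (d ^ CARD('n)) * emeasure lborel (ball 0 u \<inter> ball e u)"
proof -
  let ?n = "CARD('n)"
  \<comment> \<open>Vectors of equal norm are related by an orthogonal map; with it, F below becomes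
    a similarity of ratio d that takes 0 and e to x and y.\<close>
  have "norm e = norm ((1 / d) *\<^sub>R (y - x))" using d xy by simp
  then obtain f where f: "orthogonal_transformation f" "f e = (1 / d) *\<^sub>R (y - x)"
    using orthogonal_transformation_exists by metis
  define F where "F z = x + d *\<^sub>R f z" for z
  have lin: "linear f" using f(1) by (rule orthogonal_transformation_linear)
  have Fd: "dist (F z) (F w) = d * dist z w" for z w
  proof -
    have "dist (F z) (F w) = norm (d *\<^sub>R f (z - w))"
      by (simp add: F_def dist_norm linear_diff[OF lin] scaleR_diff_right)
    then show ?thesis using d f(1) by (simp add: dist_norm orthogonal_transformation)
  qed
  have F0: "F 0 = x" "F e = y" using d f(2) by (auto simp: F_def linear_0[OF lin])
  have surj: "\<exists>w. F w = z" for z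
  proof -
    obtain w where "f w = (1 / d) *\<^sub>R (z - x)" using orthogonal_transformation_surj[OF f(1)] by (metis surj_def)
    then show ?thesis using d by (intro exI[of _ w]) (simp add: F_def)
  qed
  have cF: "continuous_on UNIV F"
    unfolding F_def using linear_continuous_on[OF lin[unfolded linear_conv_bounded_linear]] by (intro continuous_intros)
  then have [measurable]: "F \<in> borel_measurable borel" by (rule borel_measurable_continuous_onI)
  \<comment> \<open>The image of Lebesgue measure under F, rescaled by the volume factor that a
    similarity of ratio d should have. Preimages of balls are balls, so agreement on balls needs
    only the formula for their volume.\<close>
  define D where "D = scale_measure (ennreal (d ^ ?n)) (distr lborel borel F)"
  have pre: "F -` ball (F w) (d * r) = ball w r" for w r
    using d by (auto simp: Fd)
  have De: "emeasure D A = ennreal (d ^ ?n) * emeasure lborel (F -` A)" if "A \<in> sets borel" for A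
    using that by (simp add: D_def emeasure_distr)
  have eq: "emeasure D (ball z r) = emeasure lborel (ball z r)" for z r
  proof (cases "0 \<le> r")
    case True
    obtain w where w: "F w = z" using surj by auto
    have "emeasure D (ball z r) = ennreal (d ^ ?n) * emeasure lborel (ball w (r / d))"
      using pre[of w "r / d"] d by (simp add: De w)
    also have "\<dots> = ennreal (d ^ ?n * (unit_ball_vol (real ?n) * (r / d) ^ ?n))"
      using d True by (simp add: emeasure_ball ennreal_mult)
    also have "d ^ ?n * (unit_ball_vol (real ?n) * (r / d) ^ ?n) = unit_ball_vol (real ?n) * r ^ ?n"
      using d by (simp add: power_divide)
    also have "ennreal \<dots> = emeasure lborel (ball z r)" using True by (simp add: emeasure_ball)
    finally show ?thesis .
  next
    case False
    then have "ball z r = {}" by (simp add: not_le)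
    then show ?thesis by (simp only: emeasure_empty)
  qed
  have rl: "radon_measure (lborel :: (real ^ 'n) measure)"
    using emeasure_compact_finite by (auto simp: radon_measure_def)
  have rD: "radon_measure D"
    unfolding radon_measure_def
  proof (intro conjI allI impI)
    show "sets D = sets borel" by (simp add: D_def)
    fix K :: "(real ^ 'n) set" assume "compact K"
    then obtain R where "K \<subseteq> ball 0 R" using compact_imp_bounded bounded_subset_ballD by metis
    then have "emeasure D K \<le> emeasure D (ball 0 R)" by (intro emeasure_mono) (auto simp: D_def)
    also have "\<dots> < \<infinity>" unfolding eq by (rule emeasure_lborel_ball_finite)
    finally show "emeasure D K < \<infinity>" .
  qed
  \<comment> \<open>The two measures agree on every ball, so the choice of the weight 1 and the
    exponent 0 for the ball measure is arbitrary.\<close>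
  have "D = lborel"
    by (rule radon_eqI_pball[OF rD rl, of 1 0]) (simp_all add: measure_def eq)
  then have "emeasure lborel (ball x (d * u) \<inter> ball y (d * u)) = emeasure D (ball x (d * u) \<inter> ball y (d * u))" by simp
  also have "\<dots> = ennreal (d ^ ?n) * emeasure lborel (F -` ball x (d * u) \<inter> F -` ball y (d * u))"
    by (simp add: De)
  also have "\<dots> = ennreal (d ^ ?n) * emeasure lborel (ball 0 u \<inter> ball e u)"
    using pre[of 0 u] pre[of e u] by (simp add: F0)
  finally show ?thesis .
qed

definition ball_kernel :: "real \<Rightarrow> real \<Rightarrow> 'a::euclidean_space \<Rightarrow> 'a \<Rightarrow> ennreal" where
  "ball_kernel c \<beta> x y = (\<integral>\<^sup>+p. indicator (pball p) x * indicator (pball p) y \<partial>ball_measure c \<beta>)"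

lemma ball_kernel_eq:
  fixes x y :: "'a::euclidean_space"
  shows "ball_kernel c \<beta> x y = (\<integral>\<^sup>+r. ennreal (c * r powr \<beta>) * indicator {0<..} r * emeasure lborel (ball x r \<inter> ball y r) \<partial>lborel)"
proof -
  have "(\<integral>\<^sup>+z. indicator (pball (z, r)) x * indicator (pball (z, r)) y \<partial>lborel) = emeasure lborel (ball x r \<inter> ball y r)" for r
  proof -
    have "(\<integral>\<^sup>+z. indicator (pball (z, r)) x * indicator (pball (z, r)) y \<partial>lborel) = (\<integral>\<^sup>+z. indicator (ball x r \<inter> ball y r) z \<partial>lborel)"
      by (intro nn_integral_cong) (auto simp: indicator_def dist_commute)
    then show ?thesis by simp
  qed
  then show ?thesis unfolding ball_kernel_def by (subst nn_integral_ball_measure) auto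
qed

lemma ball_inter_measurable[measurable]:
  fixes x y :: "'a::euclidean_space"
  shows "(\<lambda>r. emeasure lborel (ball x r \<inter> ball y r)) \<in> borel_measurable borel"
proof -
  have "{q :: real \<times> 'a. dist x (snd q) < fst q \<and> dist y (snd q) < fst q} \<in> sets borel"
    by (intro borel_open open_Collect_conj open_Collect_less continuous_intros)
  then have "{q :: real \<times> 'a. dist x (snd q) < fst q \<and> dist y (snd q) < fst q} \<in> sets (borel \<Otimes>\<^sub>M borel)"
    unfolding borel_prod .
  then have "{q :: real \<times> 'a. dist x (snd q) < fst q \<and> dist y (snd q) < fst q} \<in> sets (borel \<Otimes>\<^sub>M lborel)"
    by (simp only: sets_pair_measure_cong[OF refl sets_lborel])
  from lborel.measurable_emeasure_Pair[OF this] show ?thesis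
    by (simp add: vimage_def ball_def Int_def)
qed

lemma ball_kernel_scale_const:
  assumes "0 \<le> c" shows "ball_kernel c \<beta> x y = ennreal c * ball_kernel 1 \<beta> x y"
  unfolding ball_kernel_eq using assms
  by (subst nn_integral_cmult[symmetric]) (auto simp: ennreal_mult mult_ac)

text \<open>Substituting r = d u contributes 1 to the exponent from dr, \<beta> from the density and
  the dimension from the volume of the intersection of two balls. With e = 0 this also covers the
  diagonal.\<close>

lemma ball_kernel_scaling:
  fixes x y e :: "real ^ 'n"
  assumes d: "0 < d" and xy: "norm (y - x) = d * norm e"
  shows "ball_kernel 1 \<beta> x y = ennreal (d powr (1 + \<beta> + real CARD('n))) * ball_kernel 1 \<beta> 0 e"
proof -
  have "ball_kernel 1 \<beta> x y = ennreal \<bar>d\<bar> * (\<integral>\<^sup>+u. ennreal ((0 + d * u) powr \<beta>) * indicator {0<..} (0 + d * u)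
      * emeasure lborel (ball x (0 + d * u) \<inter> ball y (0 + d * u)) \<partial>lborel)"
    unfolding ball_kernel_eq using d by (subst nn_integral_real_affine[where c=d and t=0]) auto
  also have "\<dots> = ennreal d * (\<integral>\<^sup>+u. ennreal (d powr \<beta> * d ^ CARD('n)) * (ennreal (1 * u powr \<beta>) * indicator {0<..} u
      * emeasure lborel (ball 0 u \<inter> ball e u)) \<partial>lborel)"
  proof (rule arg_cong2[where f="(*)"], use d in simp, rule nn_integral_cong)
    fix u
    show "ennreal ((0 + d * u) powr \<beta>) * indicator {0<..} (0 + d * u)
      * emeasure lborel (ball x (0 + d * u) \<inter> ball y (0 + d * u)) = ennreal (d powr \<beta> * d ^ CARD('n)) * (ennreal (1 * u powr \<beta>) * indicator {0<..} u
      * emeasure lborel (ball 0 u \<inter> ball e u))"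
    proof (cases "0 < u")
      case True
      then show ?thesis using d scaled_ball_intersection[OF d xy, of u]
        by (simp add: powr_mult ennreal_mult mult_ac)
    next
      case False
      then have "\<not> 0 < d * u" using d by (simp add: zero_less_mult_iff)
      then show ?thesis using False by simp
    qed
  qed
  also have "\<dots> = ennreal (d * (d powr \<beta> * d ^ CARD('n))) * ball_kernel 1 \<beta> 0 e"
    unfolding ball_kernel_eq using d by (subst nn_integral_cmult) (auto simp: ennreal_mult mult.assoc)
  also have "d * (d powr \<beta> * d ^ CARD('n)) = d powr (1 + \<beta> + real CARD('n))"
    using d by (simp add: powr_add powr_realpow)
  finally show ?thesis .
qed

text \<open>For centres at distance 1 the balls of radius below 1/2 are disjoint, which hides the
  singularity of the density at 0; at infinity the integrand is of order r^(\<beta> + n) with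
  \<beta> + n < -1. Radii between 2 and 3 already contribute a positive amount, since both balls
  then contain the unit ball.\<close>

lemma ball_kernel_finite_pos:
  fixes e :: "'a::euclidean_space"
  assumes e: "norm e = 1" and \<beta>: "\<beta> + real DIM('a) < -1"
  shows "0 < ball_kernel 1 \<beta> 0 e" "ball_kernel 1 \<beta> 0 e < \<infinity>"
proof -
  have "ball_kernel 1 \<beta> 0 e \<noteq> 0"
  proof
    assume "ball_kernel 1 \<beta> 0 e = 0"
    then have "AE r in lborel. ennreal (1 * r powr \<beta>) * indicator {0<..} r * emeasure lborel (ball 0 r \<inter> ball e r) = 0"
      unfolding ball_kernel_eq by (subst (asm) nn_integral_0_iff_AE) auto
    then have "AE r in lborel. r \<notin> {2<..<3::real}"
    proof (rule AE_mp, intro AE_I2 impI notI)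
      fix r :: real assume r: "r \<in> {2<..<3}" "ennreal (1 * r powr \<beta>) * indicator {0<..} r * emeasure lborel (ball 0 r \<inter> ball e r) = 0"
      have "ball (0::'a) 1 \<subseteq> ball 0 r \<inter> ball e r"
      proof
        fix x :: 'a assume "x \<in> ball 0 1"
        then show "x \<in> ball 0 r \<inter> ball e r" using r(1) e norm_triangle_ineq4[of e x] by (simp add: dist_norm)
      qed
      then have "emeasure lborel (ball (0::'a) 1) \<le> emeasure lborel (ball 0 r \<inter> ball e r)"
        by (intro emeasure_mono) auto
      moreover have "0 < emeasure lborel (ball (0::'a) 1)"
        using unit_ball_vol_pos[of "real DIM('a)"] by (simp add: emeasure_ball)
      ultimately show False using r by (auto simp: ennreal_eq_0_iff)
    qed
    then have "emeasure lborel {2<..<3::real} = 0" by (subst (asm) AE_iff_measurable[of "{2<..<3}"]) auto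
    then show False by simp
  qed
  then show "0 < ball_kernel 1 \<beta> 0 e" by (simp add: zero_less_iff_neq_zero)
  define V where "V = unit_ball_vol (real DIM('a))"
  define \<gamma> where "\<gamma> = \<beta> + real DIM('a) + 1"
  have \<gamma>: "\<gamma> < 0" using \<beta> by (simp add: \<gamma>_def)
  have "V > 0" unfolding V_def by (rule unit_ball_vol_pos) simp
  have "ball_kernel 1 \<beta> 0 e \<le> (\<integral>\<^sup>+r. ennreal (V * r powr (\<gamma> - 1)) * indicator {1/2..} r \<partial>lborel)"
    unfolding ball_kernel_eq
  proof (intro nn_integral_mono)
    fix r :: real
    show "ennreal (1 * r powr \<beta>) * indicator {0<..} r * emeasure lborel (ball 0 r \<inter> ball e r)
      \<le> ennreal (V * r powr (\<gamma> - 1)) * indicator {1/2..} r"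
    proof (cases "1 / 2 \<le> r")
      case True
      have "emeasure lborel (ball 0 r \<inter> ball e r) \<le> emeasure lborel (ball (0::'a) r)" by (intro emeasure_mono) auto
      also have "\<dots> = ennreal (V * r ^ DIM('a))" using True by (simp add: emeasure_ball V_def)
      finally have "ennreal (r powr \<beta>) * emeasure lborel (ball 0 r \<inter> ball e r) \<le> ennreal (r powr \<beta>) * ennreal (V * r ^ DIM('a))"
        by (intro mult_left_mono) auto
      also have "\<dots> = ennreal (V * r powr (\<gamma> - 1))"
        using True \<open>V > 0\<close> by (simp add: ennreal_mult[symmetric] \<gamma>_def powr_add powr_realpow mult_ac)
      finally show ?thesis using True by simp
    next
      case False
      have "ball 0 r \<inter> ball e r = {}"
      proof -
        have False if "norm x < r" "dist e x < r" for x
          using that norm_triangle_ineq2[of e x] False e by (simp add: dist_norm)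
        then show ?thesis by auto
      qed
      then show ?thesis by simp
    qed
  qed
  also have "\<dots> = ennreal (0 - V * (1/2) powr \<gamma> / \<gamma>)"
  proof (rule nn_integral_FTC_atLeast)
    show "((\<lambda>r. V * r powr \<gamma> / \<gamma>) has_real_derivative V * r powr (\<gamma> - 1)) (at r)" if "1/2 \<le> r" for r
      using that \<gamma> by (auto intro!: derivative_eq_intros)
    have "((\<lambda>r. r powr \<gamma>) \<longlongrightarrow> 0) at_top" using \<gamma> by (intro tendsto_neg_powr filterlim_ident)
    from tendsto_mult[OF tendsto_const[of "V / \<gamma>"] this]
    show "((\<lambda>r. V * r powr \<gamma> / \<gamma>) \<longlongrightarrow> 0) at_top" by simp
  qed (use \<open>V > 0\<close> in auto)
  also have "\<dots> < \<infinity>" by simp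
  finally show "ball_kernel 1 \<beta> 0 e < \<infinity>" .
qed

text \<open>Scaling reduces each pair of distinct points to a pair at distance 1 and produces the
  right power of the distance; the constant is the reciprocal of the value C at distance 1.\<close>

theorem riesz_kernel_eq_ball_kernel:
  assumes \<alpha>: "\<alpha> < real CARD('n)"
  obtains c where "0 < c" "\<And>x y :: real ^ 'n. riesz_kernel \<alpha> x y = ball_kernel c (\<alpha> - 2 * real CARD('n) - 1) x y"
proof -
  let ?n = "real CARD('n)"
  define \<beta> where "\<beta> = \<alpha> - 2 * ?n - 1"
  obtain e :: "real ^ 'n" where e: "norm e = 1" using vector_choose_size[of 1] by auto
  have C: "0 < ball_kernel 1 \<beta> 0 e" "ball_kernel 1 \<beta> 0 e < \<infinity>"
    using ball_kernel_finite_pos[OF e, of \<beta>] \<alpha> by (auto simp: \<beta>_def)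
  define C where "C = enn2real (ball_kernel 1 \<beta> 0 e)"
  have C': "0 < C" "ball_kernel 1 \<beta> 0 e = ennreal C" using C by (auto simp: C_def enn2real_positive_iff)
  have exp: "1 + \<beta> + ?n = \<alpha> - ?n" by (simp add: \<beta>_def)
  \<comment> \<open>Scaling by 2 multiplies the diagonal value by \<open>2 powr (\<alpha> - n) < 1\<close>, so it cannot be finite and positive.\<close>
  have diag: "ball_kernel 1 \<beta> x x = \<infinity>" for x :: "real ^ 'n"
  proof (rule ccontr)
    assume fin: "ball_kernel 1 \<beta> x x \<noteq> \<infinity>"
    have s: "ball_kernel 1 \<beta> x x = ennreal (d powr (\<alpha> - ?n)) * ball_kernel 1 \<beta> 0 (0 :: real ^ 'n)" if "0 < d" for d
      using ball_kernel_scaling[OF that, of x x 0 \<beta>] exp by simp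
    have "ball_kernel 1 \<beta> x x = ball_kernel 1 \<beta> 0 (0 :: real ^ 'n)" using s[of 1] by simp
    then have *: "ball_kernel 1 \<beta> x x = ennreal (2 powr (\<alpha> - ?n)) * ball_kernel 1 \<beta> x x"
      using s[of 2] by simp
    obtain j where j: "ball_kernel 1 \<beta> x x = ennreal j" "0 \<le> j" using fin by (cases "ball_kernel 1 \<beta> x x") auto
    \<comment> \<open>Equal centres give the largest intersections, so a finite diagonal value would
      be positive.\<close>
    have "ball_kernel 1 \<beta> 0 e \<le> ball_kernel 1 \<beta> 0 (0 :: real ^ 'n)"
      unfolding ball_kernel_eq by (intro nn_integral_mono mult_left_mono emeasure_mono) auto
    then have "0 < j" using C(1) j \<open>ball_kernel 1 \<beta> x x = ball_kernel 1 \<beta> 0 (0 :: real ^ 'n)\<close>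
      by (metis ennreal_less_zero_iff less_le_trans)
    have "ennreal j = ennreal (2 powr (\<alpha> - ?n) * j)" using * j by (simp add: ennreal_mult)
    then have "j = 2 powr (\<alpha> - ?n) * j" using j(2) by (subst (asm) ennreal_inj) auto
    then have "2 powr (\<alpha> - ?n) = 1" using \<open>0 < j\<close> by simp
    then show False using \<alpha> powr_eq_one_iff[of 2 "\<alpha> - ?n"] by simp
  qed
  show ?thesis
  proof (rule that[of "1 / C"])
    show "0 < 1 / C" using C' by simp
    fix x y :: "real ^ 'n"
    show "riesz_kernel \<alpha> x y = ball_kernel (1 / C) (\<alpha> - 2 * real CARD('n) - 1) x y"
    proof (cases "x = y")
      case True
      then show ?thesis using C' diag[of x] ball_kernel_scale_const[of "1 / C" \<beta> x x]
        by (simp add: riesz_kernel_def \<beta>_def ennreal_mult_top)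
    next
      case False
      have "ball_kernel 1 \<beta> x y = ennreal (norm (y - x) powr (\<alpha> - ?n)) * ennreal C"
        using ball_kernel_scaling[of "norm (y - x)" y x e \<beta>] e False exp C' by simp
      then have "ball_kernel (1 / C) \<beta> x y = ennreal (1 / C) * (ennreal (norm (y - x) powr (\<alpha> - ?n)) * ennreal C)"
        using ball_kernel_scale_const[of "1 / C" \<beta> x y] C' by simp
      also have "\<dots> = ennreal (norm (x - y) powr (\<alpha> - ?n))"
        using C' by (simp add: ennreal_mult[symmetric] norm_minus_commute)
      finally show ?thesis using False by (simp add: riesz_kernel_def \<beta>_def)
    qed
  qed
qed

section \<open>The energy as a square integral\<close>

lemma square_integrable_mult:
  fixes f g :: "'a \<Rightarrow> real"
  assumes [measurable]: "f \<in> borel_measurable M" "g \<in> borel_measurable M"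
    and "integrable M (\<lambda>x. (f x)\<^sup>2)" "integrable M (\<lambda>x. (g x)\<^sup>2)"
  shows "integrable M (\<lambda>x. f x * g x)"
proof (rule Bochner_Integration.integrable_bound[OF Bochner_Integration.integrable_add[OF assms(3,4)]])
  have "\<bar>a * b\<bar> \<le> a\<^sup>2 + b\<^sup>2" for a b :: real
  proof -
    have "2 * (\<bar>a\<bar> * \<bar>b\<bar>) \<le> a\<^sup>2 + b\<^sup>2" using sum_squares_bound[of "\<bar>a\<bar>" "\<bar>b\<bar>"] by simp
    moreover have "0 \<le> \<bar>a\<bar> * \<bar>b\<bar>" by simp
    ultimately show ?thesis unfolding abs_mult by linarith
  qed
  then show "AE x in M. norm (f x * g x) \<le> norm ((f x)\<^sup>2 + (g x)\<^sup>2)" by simp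
qed measurable

lemma Cauchy_Schwarz_integral:
  fixes f g :: "'a \<Rightarrow> real"
  assumes [measurable]: "f \<in> borel_measurable M" "g \<in> borel_measurable M"
    and f: "integrable M (\<lambda>x. (f x)\<^sup>2)" and g: "integrable M (\<lambda>x. (g x)\<^sup>2)"
  shows "(\<integral>x. f x * g x \<partial>M)\<^sup>2 \<le> (\<integral>x. (f x)\<^sup>2 \<partial>M) * (\<integral>x. (g x)\<^sup>2 \<partial>M)"
proof -
  define A B C where "A = (\<integral>x. (f x)\<^sup>2 \<partial>M)" and "B = (\<integral>x. f x * g x \<partial>M)" and "C = (\<integral>x. (g x)\<^sup>2 \<partial>M)"
  have fg: "integrable M (\<lambda>x. f x * g x)" using assms by (rule square_integrable_mult)
  have q: "0 \<le> A + 2 * t * B + t\<^sup>2 * C" for t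
  proof -
    have "0 \<le> (\<integral>x. (f x + t * g x)\<^sup>2 \<partial>M)" by simp
    also have "\<dots> = (\<integral>x. (f x)\<^sup>2 + 2 * t * (f x * g x) + t\<^sup>2 * (g x)\<^sup>2 \<partial>M)"
      by (intro Bochner_Integration.integral_cong) (auto simp: power2_eq_square algebra_simps)
    also have "\<dots> = A + 2 * t * B + t\<^sup>2 * C" using f g fg by (simp add: A_def B_def C_def)
    finally show ?thesis .
  qed
  have C0: "0 \<le> C" by (simp add: C_def)
  have "B\<^sup>2 \<le> A * C"
  proof (cases "C = 0")
    case True
    have "B = 0"
    proof (rule ccontr)
      assume "B \<noteq> 0"
      \<comment> \<open>For C = 0 the quadratic is affine in t, and this t gives it the value
        -1.\<close>
      then have "A + 2 * (- (A + 1) / (2 * B)) * B = -1" by (simp add: field_simps)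
      then show False using q[of "- (A + 1) / (2 * B)"] True by simp
    qed
    then show ?thesis using True by simp
  next
    case False
    then have "0 < C" using C0 by simp
    have "A + 2 * (- B / C) * B + (- B / C)\<^sup>2 * C = A - B\<^sup>2 / C"
      using False by (simp add: field_simps power2_eq_square)
    then have "B\<^sup>2 / C \<le> A" using q[of "- B / C"] by simp
    then show ?thesis using \<open>0 < C\<close> by (simp add: field_simps)
  qed
  then show ?thesis by (simp add: A_def B_def C_def)
qed

lemma Minkowski_integral:
  fixes f g :: "'a \<Rightarrow> real"
  assumes [measurable]: "f \<in> borel_measurable M" "g \<in> borel_measurable M"
    and f: "integrable M (\<lambda>x. (f x)\<^sup>2)" and g: "integrable M (\<lambda>x. (g x)\<^sup>2)"
  shows "sqrt (\<integral>x. (f x + g x)\<^sup>2 \<partial>M) \<le> sqrt (\<integral>x. (f x)\<^sup>2 \<partial>M) + sqrt (\<integral>x. (g x)\<^sup>2 \<partial>M)"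
proof -
  define A B C where "A = (\<integral>x. (f x)\<^sup>2 \<partial>M)" and "B = (\<integral>x. f x * g x \<partial>M)" and "C = (\<integral>x. (g x)\<^sup>2 \<partial>M)"
  have fg: "integrable M (\<lambda>x. f x * g x)" using assms by (rule square_integrable_mult)
  have "0 \<le> A" "0 \<le> C" by (auto simp: A_def C_def)
  have "(\<integral>x. (f x + g x)\<^sup>2 \<partial>M) = (\<integral>x. (f x)\<^sup>2 + 2 * (f x * g x) + (g x)\<^sup>2 \<partial>M)"
    by (intro Bochner_Integration.integral_cong) (auto simp: power2_eq_square algebra_simps)
  also have "\<dots> = A + 2 * B + C" using f g fg by (simp add: A_def B_def C_def)
  also have "\<dots> \<le> A + 2 * (sqrt A * sqrt C) + C"
  proof -
    have "B\<^sup>2 \<le> A * C" unfolding A_def B_def C_def using assms by (rule Cauchy_Schwarz_integral)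
    then have "B \<le> sqrt (A * C)" by (rule real_le_rsqrt)
    then show ?thesis by (simp add: real_sqrt_mult)
  qed
  also have "\<dots> = (sqrt A + sqrt C)\<^sup>2" using \<open>0 \<le> A\<close> \<open>0 \<le> C\<close> by (simp add: power2_sum)
  finally have "sqrt (\<integral>x. (f x + g x)\<^sup>2 \<partial>M) \<le> sqrt ((sqrt A + sqrt C)\<^sup>2)" by (rule real_sqrt_le_mono)
  also have "\<dots> = sqrt A + sqrt C" using \<open>0 \<le> A\<close> \<open>0 \<le> C\<close> by simp
  finally show ?thesis by (simp add: A_def C_def)
qed

text \<open>The parameter \<open>ty\<close> only makes the type of the space visible to the locale.\<close>

locale ball_represented_kernel =
  fixes \<alpha> c \<beta> :: real and ty :: "'a::euclidean_space itself"
  assumes c: "0 < c" and kernel: "\<And>x y :: 'a. riesz_kernel \<alpha> x y = ball_kernel c \<beta> x y"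
begin

abbreviation BM :: "('a \<times> real) measure" where "BM \<equiv> ball_measure c \<beta>"

abbreviation ES :: "('a set \<Rightarrow> real) set" where "ES \<equiv> energy_space \<alpha>"

abbreviation EC :: "('a set \<Rightarrow> real) set" where "EC \<equiv> energy_cone \<alpha>"

abbreviation nrm :: "('a set \<Rightarrow> real) \<Rightarrow> real" where "nrm \<equiv> energy_norm \<alpha>"

section \<open>The energy as an inner product of ball masses\<close>

text \<open>Everything is nonnegative, so Tonelli's theorem allows integrating over the pair of
  points first. For a fixed ball this yields the product measure of ball times ball.\<close>

lemma pos_energy_eq:
  fixes P Q :: "'a measure"
  assumes P: "radon_measure P" and Q: "radon_measure Q"
  shows "pos_energy \<alpha> P Q = (\<integral>\<^sup>+p. ennreal (measure P (pball p) * measure Q (pball p)) \<partial>BM)"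
proof -
  interpret P: sigma_finite_measure P by (rule radon_sigma_finite[OF P])
  interpret Q: sigma_finite_measure Q by (rule radon_sigma_finite[OF Q])
  interpret PQ: pair_sigma_finite P Q ..
  interpret M: sigma_finite_measure BM by (rule sigma_finite_ball_measure)
  interpret PQM: pair_sigma_finite "P \<Otimes>\<^sub>M Q" BM ..
  have sPQ: "sets (P \<Otimes>\<^sub>M Q) = sets (borel \<Otimes>\<^sub>M borel)"
    by (rule sets_pair_measure_cong[OF radon_sets[OF P] radon_sets[OF Q]])
  have s: "sets ((P \<Otimes>\<^sub>M Q) \<Otimes>\<^sub>M BM) = sets ((borel \<Otimes>\<^sub>M borel) \<Otimes>\<^sub>M borel)"
    by (rule sets_pair_measure_cong[OF sPQ sets_ball_measure])
  define D where "D = {w :: ('a \<times> 'a) \<times> ('a \<times> real). fst (fst w) \<in> pball (snd w) \<and> snd (fst w) \<in> pball (snd w)}"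
  have "D \<in> sets borel" unfolding D_def mem_ball
    by (intro borel_open open_Collect_conj open_Collect_less continuous_intros)
  then have "D \<in> sets ((borel \<Otimes>\<^sub>M borel) \<Otimes>\<^sub>M borel)" unfolding borel_prod .
  then have mD: "D \<in> sets ((P \<Otimes>\<^sub>M Q) \<Otimes>\<^sub>M BM)" by (simp only: s)
  have "pos_energy \<alpha> P Q = (\<integral>\<^sup>+w. (\<integral>\<^sup>+p. indicator D (w, p) \<partial>BM) \<partial>(P \<Otimes>\<^sub>M Q))"
    unfolding pos_energy_def kernel ball_kernel_def
    by (intro nn_integral_cong) (auto simp: D_def indicator_def case_prod_unfold intro!: nn_integral_cong)
  also have "\<dots> = (\<integral>\<^sup>+p. (\<integral>\<^sup>+w. indicator D (w, p) \<partial>(P \<Otimes>\<^sub>M Q)) \<partial>BM)"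
    using borel_measurable_indicator[OF mD] by (intro PQM.Fubini'[symmetric]) (simp add: case_prod_unfold)
  also have "\<dots> = (\<integral>\<^sup>+p. ennreal (measure P (pball p) * measure Q (pball p)) \<partial>BM)"
  proof (intro nn_integral_cong)
    fix p :: "'a \<times> real"
    have "(\<integral>\<^sup>+w. indicator D (w, p) \<partial>(P \<Otimes>\<^sub>M Q)) = (\<integral>\<^sup>+w. indicator (pball p \<times> pball p) w \<partial>(P \<Otimes>\<^sub>M Q))"
      by (intro nn_integral_cong) (auto simp: D_def indicator_def mem_Times_iff)
    also have "\<dots> = emeasure (P \<Otimes>\<^sub>M Q) (pball p \<times> pball p)"
      by (intro nn_integral_indicator) (auto simp: radon_sets P Q)
    also have "\<dots> = emeasure P (pball p) * emeasure Q (pball p)"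
      by (intro Q.emeasure_pair_measure_Times) (auto simp: radon_sets P Q)
    also have "\<dots> = ennreal (measure P (pball p) * measure Q (pball p))"
      by (simp add: radon_emeasure_eq P Q ennreal_mult)
    finally show "(\<integral>\<^sup>+w. indicator D (w, p) \<partial>(P \<Otimes>\<^sub>M Q)) = ennreal (measure P (pball p) * measure Q (pball p))" .
  qed
  finally show ?thesis .
qed

lemma measure_pball_BM[measurable]:
  "radon_measure P \<Longrightarrow> (\<lambda>p. measure P (pball p)) \<in> borel_measurable BM"
  using measure_pball_measurable(2)[of P] by simp

lemma pos_energy_finite_iff:
  assumes P: "radon_measure P" and Q: "radon_measure Q"
  shows "pos_energy \<alpha> P Q < \<infinity> \<longleftrightarrow> integrable BM (\<lambda>p. measure P (pball p) * measure Q (pball p))"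
  unfolding pos_energy_eq[OF P Q] using measure_pball_BM[OF P] measure_pball_BM[OF Q]
  by (subst integrable_iff_bounded) (simp add: abs_mult)

lemma enn2real_pos_energy:
  assumes P: "radon_measure P" and Q: "radon_measure Q"
  shows "enn2real (pos_energy \<alpha> P Q) = (\<integral>p. measure P (pball p) * measure Q (pball p) \<partial>BM)"
  unfolding pos_energy_eq[OF P Q] using measure_pball_BM[OF P] measure_pball_BM[OF Q]
  by (subst integral_eq_nn_integral) auto

text \<open>A condition on a single measure suffices: products of square integrable functions are
  integrable, so the mixed energies of two such measures are finite too.\<close>

definition finite_self_energy :: "'a measure \<Rightarrow> bool" where
  "finite_self_energy P \<longleftrightarrow> radon_measure P \<and> integrable BM (\<lambda>p. (measure P (pball p))\<^sup>2)"

lemma finite_self_energyD: "finite_self_energy P \<Longrightarrow> radon_measure P"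
  by (simp add: finite_self_energy_def)

lemma finite_self_energy_mult:
  "finite_self_energy P \<Longrightarrow> finite_self_energy Q \<Longrightarrow> integrable BM (\<lambda>p. measure P (pball p) * measure Q (pball p))"
  unfolding finite_self_energy_def by (intro square_integrable_mult) auto

lemma finite_self_energy_mono:
  assumes P: "finite_self_energy P" and Q: "radon_measure Q"
    and le: "\<And>A. A \<in> sets borel \<Longrightarrow> emeasure Q A \<le> emeasure P A"
  shows "finite_self_energy Q"
  unfolding finite_self_energy_def
proof (intro conjI Q)
  have le': "measure Q (pball p) \<le> measure P (pball p)" for p
    using le[of "pball p"] by (simp add: radon_emeasure_eq Q finite_self_energyD[OF P])
  show "integrable BM (\<lambda>p. (measure Q (pball p))\<^sup>2)"
  proof (rule Bochner_Integration.integrable_bound)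
    show "integrable BM (\<lambda>p. (measure P (pball p))\<^sup>2)" using P by (simp add: finite_self_energy_def)
    show "AE p in BM. norm ((measure Q (pball p))\<^sup>2) \<le> norm ((measure P (pball p))\<^sup>2)"
      using le' by (intro AE_I2) (simp add: power_mono)
  qed (use measure_pball_BM[OF Q] in measurable)
qed

lemma finite_self_energy_add:
  assumes P: "finite_self_energy P" and Q: "finite_self_energy Q"
  shows "finite_self_energy (add_measure P Q)"
  unfolding finite_self_energy_def
proof (intro conjI radon_add)
  show r: "radon_measure P" "radon_measure Q" using P Q by (auto simp: finite_self_energyD)
  have "integrable BM (\<lambda>p. (measure P (pball p))\<^sup>2 + 2 * (measure P (pball p) * measure Q (pball p)) + (measure Q (pball p))\<^sup>2)"
    using P Q finite_self_energy_mult[OF P Q] by (intro Bochner_Integration.integrable_add integrable_mult_right)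
      (auto simp: finite_self_energy_def)
  then show "integrable BM (\<lambda>p. (measure (add_measure P Q) (pball p))\<^sup>2)"
    by (simp add: measure_add_measure r power2_sum algebra_simps)
qed

lemma finite_self_energy_null: "finite_self_energy (null_measure borel)"
  by (simp add: finite_self_energy_def radon_null)

text \<open>Finite energy is defined through the Jordan parts, but these are dominated by the terms
  of any representation as a difference. Freedom in the representation makes closure under
  subtraction evident.\<close>

lemma energy_space_iff:
  "\<nu> \<in> ES \<longleftrightarrow> (\<exists>P N. finite_self_energy P \<and> finite_self_energy N \<and> \<nu> = measure_diff P N)"
proof
  assume "\<nu> \<in> ES"
  then have \<nu>: "\<nu> \<in> signed_radon" "finite_energy \<alpha> \<nu> \<nu>" by (auto simp: energy_space_def)
  then obtain P0 N0 where "radon_measure P0" "radon_measure N0" "\<nu> = measure_diff P0 N0"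
    by (auto simp: signed_radon_def)
  then obtain P N where J: "is_jordan_decomp \<nu> P N" using jordan_decomp_exists[of P0 N0] by metis
  then have r: "radon_measure P" "radon_measure N" "\<nu> = measure_diff P N" by (auto simp: is_jordan_decomp_def)
  have "pos_energy \<alpha> P P < \<infinity>" "pos_energy \<alpha> N N < \<infinity>"
    using \<nu>(2) jordan_parts[OF J] by (auto simp: finite_energy_def)
  then have "finite_self_energy P" "finite_self_energy N"
    using r pos_energy_finite_iff[of P P] pos_energy_finite_iff[of N N]
    by (auto simp: finite_self_energy_def power2_eq_square)
  then show "\<exists>P N. finite_self_energy P \<and> finite_self_energy N \<and> \<nu> = measure_diff P N" using r by blast
next
  assume "\<exists>P N. finite_self_energy P \<and> finite_self_energy N \<and> \<nu> = measure_diff P N"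
  then obtain P N where PN: "finite_self_energy P" "finite_self_energy N" "\<nu> = measure_diff P N" by auto
  then obtain P' N' where J: "is_jordan_decomp \<nu> P' N'"
    and le: "\<And>A. A \<in> sets borel \<Longrightarrow> emeasure P' A \<le> emeasure P A" "\<And>A. A \<in> sets borel \<Longrightarrow> emeasure N' A \<le> emeasure N A"
    using jordan_decomp_exists[of P N] finite_self_energyD by metis
  have r: "radon_measure P'" "radon_measure N'" using J by (auto simp: is_jordan_decomp_def)
  have f: "finite_self_energy P'" "finite_self_energy N'"
    using finite_self_energy_mono[OF PN(1) r(1) le(1)] finite_self_energy_mono[OF PN(2) r(2) le(2)] by auto
  have "finite_energy \<alpha> \<nu> \<nu>"
    unfolding finite_energy_def jordan_parts[OF J]
    using finite_self_energy_mult f by (auto simp: pos_energy_finite_iff[unfolded infinity_ennreal_def] r)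
  moreover have "\<nu> \<in> signed_radon" using PN finite_self_energyD by (auto simp: signed_radon_def)
  ultimately show "\<nu> \<in> ES" by (simp add: energy_space_def)
qed

lemma measure_diff_pball: "measure_diff P N (pball p) = measure P (pball p) - measure N (pball p)"
  by (simp add: measure_diff_def)

lemma energy_space_measurable[measurable]:
  "\<nu> \<in> ES \<Longrightarrow> (\<lambda>p. \<nu> (pball p)) \<in> borel_measurable BM"
  unfolding energy_space_iff using measure_pball_BM finite_self_energyD
  by (auto simp: measure_diff_pball)

lemma energy_space_square_integrable:
  assumes "\<nu> \<in> ES" shows "integrable BM (\<lambda>p. (\<nu> (pball p))\<^sup>2)"
proof -
  obtain P N where PN: "finite_self_energy P" "finite_self_energy N" "\<nu> = measure_diff P N"
    using assms unfolding energy_space_iff by auto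
  have "integrable BM (\<lambda>p. (measure P (pball p))\<^sup>2 + (measure N (pball p))\<^sup>2 - 2 * (measure P (pball p) * measure N (pball p)))"
    using PN finite_self_energy_mult[OF PN(1,2)]
    by (intro Bochner_Integration.integrable_add Bochner_Integration.integrable_diff integrable_mult_right)
      (auto simp: finite_self_energy_def)
  then show ?thesis by (simp add: PN(3) measure_diff_pball power2_diff algebra_simps)
qed

lemma energy_eq:
  assumes \<nu>: "\<nu> \<in> ES" shows "energy \<alpha> \<nu> = (\<integral>p. (\<nu> (pball p))\<^sup>2 \<partial>BM)"
proof -
  obtain P0 N0 where "radon_measure P0" "radon_measure N0" "\<nu> = measure_diff P0 N0"
    using \<nu> by (auto simp: signed_radon_def energy_space_def)
  then obtain P N where J: "is_jordan_decomp \<nu> P N" using jordan_decomp_exists[of P0 N0] by metis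
  then have r: "radon_measure P" "radon_measure N" "\<nu> = measure_diff P N" by (auto simp: is_jordan_decomp_def)
  have i: "integrable BM (\<lambda>p. measure P (pball p) * measure P (pball p))" "integrable BM (\<lambda>p. measure P (pball p) * measure N (pball p))"
    "integrable BM (\<lambda>p. measure N (pball p) * measure P (pball p))" "integrable BM (\<lambda>p. measure N (pball p) * measure N (pball p))"
    using \<nu> r jordan_parts[OF J] by (auto simp: energy_space_def finite_energy_def simp flip: pos_energy_finite_iff)
  have "(\<integral>p. (\<nu> (pball p))\<^sup>2 \<partial>BM) = (\<integral>p. measure P (pball p) * measure P (pball p)
      + measure N (pball p) * measure N (pball p) - measure P (pball p) * measure N (pball p)
      - measure N (pball p) * measure P (pball p) \<partial>BM)"
    by (intro Bochner_Integration.integral_cong refl) (simp add: r(3) measure_diff_pball power2_eq_square algebra_simps)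
  also have "\<dots> = energy \<alpha> \<nu>"
    unfolding mutual_energy_def jordan_parts[OF J] using i by (simp add: enn2real_pos_energy r mult.commute)
  finally show ?thesis by simp
qed

lemma energy_norm_eq: "\<nu> \<in> ES \<Longrightarrow> nrm \<nu> = sqrt (\<integral>p. (\<nu> (pball p))\<^sup>2 \<partial>BM)"
  by (simp add: energy_norm_def energy_eq)

lemma energy_norm_nonneg: "\<nu> \<in> ES \<Longrightarrow> 0 \<le> nrm \<nu>"
  by (simp add: energy_norm_eq)

lemma energy_norm_square: "\<nu> \<in> ES \<Longrightarrow> (nrm \<nu>)\<^sup>2 = (\<integral>p. (\<nu> (pball p))\<^sup>2 \<partial>BM)"
  by (simp add: energy_norm_eq)

lemma measure_diff_add:
  assumes "radon_measure P" "radon_measure N" "radon_measure P'" "radon_measure N'"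
  shows "measure_diff P N - measure_diff P' N' = measure_diff (add_measure P N') (add_measure N P')"
  using assms by (auto simp: fun_eq_iff measure_diff_def measure_add_measure)

lemma energy_space_diff:
  assumes "\<nu> \<in> ES" "\<nu>' \<in> ES" shows "\<nu> - \<nu>' \<in> ES"
proof -
  obtain P N where PN: "finite_self_energy P" "finite_self_energy N" "\<nu> = measure_diff P N"
    using assms(1) unfolding energy_space_iff by auto
  obtain P' N' where PN': "finite_self_energy P'" "finite_self_energy N'" "\<nu>' = measure_diff P' N'"
    using assms(2) unfolding energy_space_iff by auto
  have "\<nu> - \<nu>' = measure_diff (add_measure P N') (add_measure N P')"
    unfolding PN(3) PN'(3) by (intro measure_diff_add finite_self_energyD PN PN')
  then show ?thesis unfolding energy_space_iff using PN PN' finite_self_energy_add by blast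
qed

lemma energy_norm_sym:
  assumes "\<nu> \<in> ES" "\<nu>' \<in> ES"
  shows "nrm (\<nu> - \<nu>') = nrm (\<nu>' - \<nu>)"
  using assms by (simp add: energy_norm_eq energy_space_diff power2_commute)

lemma energy_norm_triangle:
  assumes "\<kappa> \<in> ES" "\<mu> \<in> ES" "\<nu> \<in> ES"
  shows "nrm (\<kappa> - \<nu>) \<le> nrm (\<kappa> - \<mu>) + nrm (\<mu> - \<nu>)"
proof -
  have d: "\<kappa> - \<mu> \<in> ES" "\<mu> - \<nu> \<in> ES" "\<kappa> - \<nu> \<in> ES"
    using assms by (auto intro: energy_space_diff)
  have "nrm (\<kappa> - \<nu>) = sqrt (\<integral>p. ((\<kappa> - \<mu>) (pball p) + (\<mu> - \<nu>) (pball p))\<^sup>2 \<partial>BM)"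
    unfolding energy_norm_eq[OF d(3)] by simp
  also have "\<dots> \<le> nrm (\<kappa> - \<mu>) + nrm (\<mu> - \<nu>)"
    unfolding energy_norm_eq[OF d(1)] energy_norm_eq[OF d(2)]
    using d by (intro Minkowski_integral energy_space_measurable energy_space_square_integrable)
  finally show ?thesis .
qed

text \<open>Norm zero means equal values on almost every ball. Moving the negative terms across
  gives two positive measures to which \<open>radon_eqI_pball\<close> applies; on bounded sets all
  masses are finite, so they can be moved back.\<close>

lemma energy_norm_definite:
  assumes "\<nu> \<in> ES" "\<nu>' \<in> ES" and 0: "nrm (\<nu> - \<nu>') = 0"
  shows "\<nu> = \<nu>'"
proof -
  obtain P N where PN: "finite_self_energy P" "finite_self_energy N" "\<nu> = measure_diff P N"
    using assms(1) unfolding energy_space_iff by auto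
  obtain P' N' where PN': "finite_self_energy P'" "finite_self_energy N'" "\<nu>' = measure_diff P' N'"
    using assms(2) unfolding energy_space_iff by auto
  have r: "radon_measure P" "radon_measure N" "radon_measure P'" "radon_measure N'"
    using PN PN' finite_self_energyD by auto
  have d: "\<nu> - \<nu>' \<in> ES" using assms by (auto intro: energy_space_diff)
  have "(\<integral>p. ((\<nu> - \<nu>') (pball p))\<^sup>2 \<partial>BM) = 0" using 0 by (simp add: energy_norm_eq[OF d])
  then have "AE p in BM. ((\<nu> - \<nu>') (pball p))\<^sup>2 = 0"
    using integral_nonneg_eq_0_iff_AE[OF energy_space_square_integrable[OF d]] by simp
  then have "AE p in BM. measure (add_measure P N') (pball p) = measure (add_measure P' N) (pball p)"
  proof eventually_elim
    case (elim p)
    then have "\<nu> (pball p) = \<nu>' (pball p)" by simp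
    then show ?case unfolding PN(3) PN'(3) measure_diff_pball using r by (simp add: measure_add_measure)
  qed
  then have eq: "add_measure P N' = add_measure P' N"
    by (intro radon_eqI_pball[OF _ _ c]) (auto intro: radon_add r)
  show "\<nu> = \<nu>'"
  proof
    fix B
    have "measure (add_measure P N') B = measure (add_measure P' N) B" by (simp add: eq)
    then show "\<nu> B = \<nu>' B" unfolding PN(3) PN'(3) using r
      by (auto simp: measure_diff_def measure_add_measure)
  qed
qed

lemma energy_cone_iff: "\<nu> \<in> EC \<longleftrightarrow> (\<exists>P. finite_self_energy P \<and> \<nu> = signed_of P)"
proof
  assume \<nu>: "\<nu> \<in> EC"
  then have "\<nu> \<in> signed_radon" "\<And>B. 0 \<le> \<nu> B" by (auto simp: energy_cone_def energy_space_def)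
  then obtain P where P: "radon_measure P" "\<nu> = signed_of P" by (rule nonneg_signed_radon)
  have "pos_energy \<alpha> P P < \<infinity>"
    using \<nu> parts_signed_of[OF P(1)] by (auto simp: energy_cone_def energy_space_def finite_energy_def P(2))
  then have "finite_self_energy P"
    using P pos_energy_finite_iff[of P P] by (auto simp: finite_self_energy_def power2_eq_square)
  then show "\<exists>P. finite_self_energy P \<and> \<nu> = signed_of P" using P by blast
next
  assume "\<exists>P. finite_self_energy P \<and> \<nu> = signed_of P"
  then obtain P where P: "finite_self_energy P" "\<nu> = signed_of P" by auto
  then have "\<nu> \<in> ES" unfolding energy_space_iff signed_of_def using finite_self_energy_null by blast
  moreover have "0 \<le> \<nu> B" for B by (simp add: P(2) signed_of_def measure_diff_def)
  ultimately show "\<nu> \<in> EC" by (simp add: energy_cone_def)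
qed

lemma energy_cone_space: "\<nu> \<in> EC \<Longrightarrow> \<nu> \<in> ES"
  by (simp add: energy_cone_def)

lemma signed_of_energy_cone: "finite_self_energy P \<Longrightarrow> signed_of P \<in> EC"
  by (auto simp: energy_cone_iff)

lemma signed_of_pball: "signed_of P (pball p) = measure P (pball p)"
  by (simp add: signed_of_apply)

section \<open>The strong topology\<close>

lemma openin_strong_ball:
  assumes "\<nu> \<in> ES"
  shows "openin (strong_topology \<alpha>) {\<xi> \<in> ES. nrm (\<xi> - \<nu>) < e}"
  unfolding openin_strong_topology
proof (intro conjI ballI)
  fix \<xi> assume "\<xi> \<in> {\<xi> \<in> ES. nrm (\<xi> - \<nu>) < e}"
  then have \<xi>: "\<xi> \<in> ES" "nrm (\<xi> - \<nu>) < e" by auto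
  show "\<exists>\<epsilon>>0. \<forall>\<eta>\<in>ES. nrm (\<eta> - \<xi>) < \<epsilon> \<longrightarrow> \<eta> \<in> {\<xi> \<in> ES. nrm (\<xi> - \<nu>) < e}"
  proof (intro exI[of _ "e - nrm (\<xi> - \<nu>)"] conjI ballI impI)
    fix \<eta> :: "'a set \<Rightarrow> real" assume \<eta>: "\<eta> \<in> ES" "nrm (\<eta> - \<xi>) < e - nrm (\<xi> - \<nu>)"
    then show "\<eta> \<in> {\<xi> \<in> ES. nrm (\<xi> - \<nu>) < e}"
      using energy_norm_triangle[OF \<eta>(1) \<xi>(1) assms] by simp
  qed (use \<xi> in simp)
qed auto

lemma topspace_strong: "topspace (strong_topology \<alpha>) = ES"
proof
  show "topspace (strong_topology \<alpha>) \<subseteq> ES"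
    using openin_topspace[of "strong_topology \<alpha>"] unfolding openin_strong_topology by blast
  have "openin (strong_topology \<alpha>) ES"
    unfolding openin_strong_topology by (auto intro: exI[of _ 1])
  then show "ES \<subseteq> topspace (strong_topology \<alpha>)" by (rule openin_subset)
qed

lemma energy_norm_self: "nrm (\<nu> - \<nu>) = 0" if "\<nu> \<in> ES"
  using that by (simp add: energy_norm_eq energy_space_diff)

lemma limitin_strong_iff:
  fixes f :: "'b \<Rightarrow> 'a set \<Rightarrow> real"
  shows "limitin (strong_topology \<alpha>) f l F \<longleftrightarrow>
    l \<in> ES \<and> (\<forall>e>0. \<forall>\<^sub>F x in F. f x \<in> ES \<and> nrm (f x - l) < e)"
proof
  assume L: "limitin (strong_topology \<alpha>) f l F"
  then have l: "l \<in> ES" by (simp add: limitin_def topspace_strong)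
  have "\<forall>\<^sub>F x in F. f x \<in> {\<xi> \<in> ES. nrm (\<xi> - l) < e}" if "0 < e" for e
    using L openin_strong_ball[OF l, of e] l that energy_norm_self[OF l] unfolding limitin_def by auto
  then show "l \<in> ES \<and> (\<forall>e>0. \<forall>\<^sub>F x in F. f x \<in> ES \<and> nrm (f x - l) < e)"
    using l by simp
next
  assume L: "l \<in> ES \<and> (\<forall>e>0. \<forall>\<^sub>F x in F. f x \<in> ES \<and> nrm (f x - l) < e)"
  show "limitin (strong_topology \<alpha>) f l F"
    unfolding limitin_def topspace_strong
  proof (intro conjI allI impI)
    fix U assume "openin (strong_topology \<alpha>) U \<and> l \<in> U"
    then obtain e where e: "e > 0" "\<forall>\<xi>\<in>ES. nrm (\<xi> - l) < e \<longrightarrow> \<xi> \<in> U"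
      unfolding openin_strong_topology by blast
    then have "\<forall>\<^sub>F x in F. f x \<in> ES \<and> nrm (f x - l) < e" using L by blast
    then show "\<forall>\<^sub>F x in F. f x \<in> U" by eventually_elim (use e in auto)
  qed (use L in simp)
qed

lemma closure_strong_iff:
  assumes "S \<subseteq> ES"
  shows "\<nu> \<in> strong_topology \<alpha> closure_of S \<longleftrightarrow>
    \<nu> \<in> ES \<and> (\<forall>e>0. \<exists>\<xi>\<in>S. nrm (\<xi> - \<nu>) < e)"
proof
  assume C: "\<nu> \<in> strong_topology \<alpha> closure_of S"
  then have \<nu>: "\<nu> \<in> ES" by (simp add: in_closure_of topspace_strong)
  have "\<exists>\<xi>\<in>S. nrm (\<xi> - \<nu>) < e" if "0 < e" for e
  proof -
    have "\<nu> \<in> {\<xi> \<in> ES. nrm (\<xi> - \<nu>) < e}" using \<nu> that energy_norm_self[OF \<nu>] by simp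
    moreover have "\<forall>T. \<nu> \<in> T \<and> openin (strong_topology \<alpha>) T \<longrightarrow> (\<exists>y. y \<in> S \<and> y \<in> T)"
      using C unfolding in_closure_of by (rule conjunct2)
    ultimately have "\<exists>y. y \<in> S \<and> y \<in> {\<xi> \<in> ES. nrm (\<xi> - \<nu>) < e}"
      using openin_strong_ball[OF \<nu>, of e] by (metis (no_types, lifting))
    then show ?thesis by auto
  qed
  then show "\<nu> \<in> ES \<and> (\<forall>e>0. \<exists>\<xi>\<in>S. nrm (\<xi> - \<nu>) < e)" using \<nu> by blast
next
  assume C: "\<nu> \<in> ES \<and> (\<forall>e>0. \<exists>\<xi>\<in>S. nrm (\<xi> - \<nu>) < e)"
  show "\<nu> \<in> strong_topology \<alpha> closure_of S"
    unfolding in_closure_of topspace_strong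
  proof (intro conjI allI impI)
    fix U assume "\<nu> \<in> U \<and> openin (strong_topology \<alpha>) U"
    then obtain e where e: "e > 0" "\<forall>\<xi>\<in>ES. nrm (\<xi> - \<nu>) < e \<longrightarrow> \<xi> \<in> U"
      unfolding openin_strong_topology by blast
    then obtain \<xi> where "\<xi> \<in> S" "nrm (\<xi> - \<nu>) < e" using C by blast
    then show "\<exists>y. y \<in> S \<and> y \<in> U" using e assms by blast
  qed (use C in simp)
qed

end

section \<open>Vague convergence\<close>

text \<open>A test function vanishing outside U has integral 0 against every member of the sequence,
  hence against the limit, and such functions exhaust the bounded pieces of U.\<close>

lemma vague_limit_open_null:
  fixes P :: "'a::euclidean_space measure"
  assumes X: "\<And>n. radon_measure (X n)" and P: "radon_measure P"
    and lim: "\<And>f. f \<in> Cc \<Longrightarrow> (\<lambda>n. \<integral>x. f x \<partial>X n) \<longlonglongrightarrow> (\<integral>x. f x \<partial>P)"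
    and U: "open U" "\<And>n. emeasure (X n) U = 0"
  shows "emeasure P U = 0"
proof -
  have null: "emeasure P (U \<inter> ball 0 (real j)) = 0" for j :: nat
  proof -
    let ?V = "U \<inter> ball 0 (real j)"
    have V: "open ?V" "bounded ?V" using U by (auto simp: bounded_Int)
    obtain d :: "'a \<Rightarrow> real" where d: "continuous_on UNIV d" "\<And>x. 0 \<le> d x" "\<And>x. 0 < d x \<longleftrightarrow> x \<in> ?V"
      using open_positive_function[OF V(1)] by metis
    have "(\<integral>x. min 1 (real k * d x) \<partial>P) = 0" for k
    proof -
      have "(\<integral>x. min 1 (real k * d x) \<partial>X n) = 0" for n
      proof -
        have "AE x in X n. x \<notin> U" using U X by (auto intro!: AE_not_in simp: null_sets_def radon_sets)
        then have "AE x in X n. min 1 (real k * d x) = 0"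
        proof eventually_elim
          case (elim x) then show ?case using d(2)[of x] d(3)[of x] by simp
        qed
        then show ?thesis by (rule integral_eq_zero_AE)
      qed
      then have "(\<lambda>n. \<integral>x. min 1 (real k * d x) \<partial>X n) \<longlonglongrightarrow> 0" by simp
      with lim[OF bounded_open_Cc_limit(2)[OF V P d]] show ?thesis by (rule LIMSEQ_unique)
    qed
    then have "(\<lambda>k. \<integral>x. min 1 (real k * d x) \<partial>P) \<longlonglongrightarrow> 0" by simp
    with bounded_open_Cc_limit(1)[OF V P d] have "measure P ?V = 0" by (rule LIMSEQ_unique)
    then show ?thesis using radon_emeasure_eq[OF P V(2)] by simp
  qed
  have "U = (\<Union>j::nat. U \<inter> ball 0 (real j))" using reals_Archimedean2 by auto
  moreover have "(\<Union>j::nat. U \<inter> ball 0 (real j)) \<in> null_sets P"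
    using null U P by (intro null_sets_UN') (auto simp: null_sets_def radon_sets)
  ultimately show ?thesis by auto
qed

text \<open>Test functions increasing to the indicator of the open ball bound the masses from below,
  and test functions decreasing to that of the closed ball bound them from above. For P the two
  bounds meet because the sphere is null.\<close>

lemma vague_limit_ball:
  fixes P :: "'a::euclidean_space measure"
  assumes X: "\<And>n. radon_measure (X n)" and P: "radon_measure P"
    and lim: "\<And>f. f \<in> Cc \<Longrightarrow> (\<lambda>n. \<integral>x. f x \<partial>X n) \<longlonglongrightarrow> (\<integral>x. f x \<partial>P)"
    and sphere: "emeasure P (sphere z r) = 0"
  shows "(\<lambda>n. measure (X n) (ball z r)) \<longlonglongrightarrow> measure P (ball z r)"
proof (rule order_tendstoI)
  fix t assume t: "t < measure P (ball z r)"
  define d where "d x = max 0 (r - dist z x)" for x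
  have U: "open (ball z r)" "bounded (ball z r)" by auto
  have d: "continuous_on UNIV d" "\<And>x. 0 \<le> d x" "\<And>x. 0 < d x \<longleftrightarrow> x \<in> ball z r"
    unfolding d_def by (auto intro!: continuous_intros)
  note L = bounded_open_Cc_limit[OF U P d]
  obtain k where k: "t < (\<integral>x. min 1 (real k * d x) \<partial>P)"
    using order_tendstoD(1)[OF L(1) t] by (auto simp: eventually_sequentially)
  have "\<forall>\<^sub>F n in sequentially. t < (\<integral>x. min 1 (real k * d x) \<partial>X n)"
    by (rule order_tendstoD(1)[OF lim[OF L(2)] k])
  then show "\<forall>\<^sub>F n in sequentially. t < measure (X n) (ball z r)"
  proof eventually_elim
    case (elim n)
    have "(\<integral>x. min 1 (real k * d x) \<partial>X n) \<le> (\<integral>x. indicator (ball z r) x \<partial>X n)"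
    proof (rule integral_mono)
      show "integrable (X n) (\<lambda>x. min 1 (real k * d x))" by (rule radon_integrable_Cc[OF X L(2)])
      show "integrable (X n) (indicator (ball z r) :: 'a \<Rightarrow> real)"
        using radon_finite_bounded[OF X U(2)] by (intro integrable_real_indicator) (auto simp: radon_sets[OF X])
      show "min 1 (real k * d x) \<le> indicator (ball z r) x" for x
        by (auto simp: d_def indicator_def)
    qed
    also have "\<dots> = measure (X n) (ball z r)" by (simp add: radon_space[OF X])
    finally show ?case using elim by simp
  qed
next
  fix t assume t: "measure P (ball z r) < t"
  \<comment> \<open>Equal to 1 on the closed ball and to 0 from distance r + 1 / (k + 1) on;
    \<open>h 0\<close> dominates the whole sequence.\<close>
  define h where "h k x = max 0 (min 1 (1 - real (Suc k) * (dist z x - r)))" for k x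
  have hC: "h k \<in> Cc" for k
  proof (rule CcI)
    show "continuous_on UNIV (h k)" unfolding h_def by (intro continuous_intros)
    fix x :: 'a assume "norm z + \<bar>r\<bar> + 1 < norm x"
    then have "1 \<le> dist z x - r" using norm_triangle_ineq2[of x z] by (simp add: dist_norm norm_minus_commute)
    then have "1 * 1 \<le> real (Suc k) * (dist z x - r)" by (intro mult_mono) auto
    then show "h k x = 0" by (simp add: h_def)
  qed
  have mono: "h k x \<le> h 0 x" for k x
  proof (cases "dist z x \<le> r")
    case True then show ?thesis by (simp add: h_def)
  next
    case False
    then have "1 * (dist z x - r) \<le> real (Suc k) * (dist z x - r)" by (intro mult_right_mono) auto
    then show ?thesis by (simp add: h_def)
  qed
  have "(\<lambda>k. \<integral>x. h k x \<partial>P) \<longlonglongrightarrow> (\<integral>x. indicator (cball z r) x \<partial>P)"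
  proof (rule integral_dominated_convergence[where w="h 0"])
    show "h k \<in> borel_measurable P" for k by (rule borel_measurable_integrable[OF radon_integrable_Cc[OF P hC]])
    show "integrable P (h 0)" by (rule radon_integrable_Cc[OF P hC])
    show "(indicator (cball z r) :: 'a \<Rightarrow> real) \<in> borel_measurable P"
      by (intro borel_measurable_indicator) (simp add: radon_sets[OF P])
    show "AE x in P. norm (h k x) \<le> h 0 x" for k using mono[of k] by (intro AE_I2) (simp add: h_def)
    show "AE x in P. (\<lambda>k. h k x) \<longlonglongrightarrow> indicator (cball z r) x"
    proof (intro AE_I2)
      fix x show "(\<lambda>k. h k x) \<longlonglongrightarrow> indicator (cball z r) x"
      proof (cases "dist z x \<le> r")
        case True then show ?thesis by (simp add: h_def mult_nonneg_nonpos)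
      next
        case False
        then obtain N :: nat where N: "1 / (dist z x - r) < real N" using reals_Archimedean2 by blast
        have "\<forall>\<^sub>F k in sequentially. h k x = 0"
        proof (rule eventually_sequentiallyI[of N])
          fix k assume "N \<le> k"
          then have "1 / (dist z x - r) < real (Suc k)" using N by linarith
          then have "1 < real (Suc k) * (dist z x - r)" using False by (simp add: field_simps)
          then show "h k x = 0" by (simp add: h_def)
        qed
        then show ?thesis using False by (simp add: tendsto_eventually)
      qed
    qed
  qed
  moreover have "(\<integral>x. indicator (cball z r) x \<partial>P) = measure P (ball z r)"
  proof -
    have "emeasure P (cball z r) = emeasure P (ball z r \<union> sphere z r)"
      by (rule arg_cong[where f="emeasure P"]) auto
    also have "\<dots> = emeasure P (ball z r)"
      using sphere by (intro emeasure_Un_null_set) (auto simp: radon_sets[OF P] null_sets_def)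
    finally show ?thesis by (simp add: radon_space[OF P] measure_def)
  qed
  ultimately have "(\<lambda>k. \<integral>x. h k x \<partial>P) \<longlonglongrightarrow> measure P (ball z r)" by simp
  from order_tendstoD(2)[OF this t] obtain k where k: "(\<integral>x. h k x \<partial>P) < t"
    by (auto simp: eventually_sequentially)
  have "\<forall>\<^sub>F n in sequentially. (\<integral>x. h k x \<partial>X n) < t" by (rule order_tendstoD(2)[OF lim[OF hC] k])
  then show "\<forall>\<^sub>F n in sequentially. measure (X n) (ball z r) < t"
  proof eventually_elim
    case (elim n)
    have "(\<integral>x. indicator (ball z r) x \<partial>X n) \<le> (\<integral>x. h k x \<partial>X n)"
    proof (rule integral_mono)
      show "integrable (X n) (h k)" by (rule radon_integrable_Cc[OF X hC])
      show "integrable (X n) (indicator (ball z r) :: 'a \<Rightarrow> real)"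
        using radon_finite_bounded[OF X, of "ball z r"] by (intro integrable_real_indicator) (auto simp: radon_sets[OF X])
      show "indicator (ball z r) x \<le> h k x" for x
        by (auto simp: h_def indicator_def mult_nonneg_nonpos)
    qed
    then show ?case using elim by (simp add: radon_space[OF X])
  qed
qed

lemma ball_measure_open_pos:
  assumes "0 < c" "open U" "U \<noteq> {}" "U \<subseteq> {p. 0 < snd p}"
  shows "emeasure (ball_measure c \<beta>) (U :: ('a::euclidean_space \<times> real) set) \<noteq> 0"
proof
  assume 0: "emeasure (ball_measure c \<beta>) U = 0"
  have m: "U \<in> sets lborel" using assms by auto
  have w: "(\<lambda>p. ennreal (c * snd p powr \<beta>) * indicator {0<..} (snd p)) \<in> borel_measurable (lborel :: ('a \<times> real) measure)"
    by simp
  have "U \<in> null_sets (ball_measure c \<beta>)" using 0 assms(2) by (auto simp: null_sets_def)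
  then have "AE p in lborel. p \<in> U \<longrightarrow> ennreal (c * snd p powr \<beta>) * indicator {0<..} (snd p) = 0"
    unfolding ball_measure_def null_sets_density_iff[OF w] by (rule conjunct2)
  then have "AE p in lborel. p \<notin> U"
  proof eventually_elim
    case (elim p)
    show ?case
    proof
      assume p: "p \<in> U"
      then have "0 < c * snd p powr \<beta>" using assms by auto
      then show False using elim p assms by (auto simp: indicator_def)
    qed
  qed
  then have "U \<in> null_sets lborel" using m by (simp add: AE_iff_null_sets)
  then have "negligible U" by (simp add: negligible_iff_null_sets null_sets_completionI)
  then show False using assms open_not_negligible by blast
qed

context ball_represented_kernel begin

section \<open>Strong convergence of positive measures\<close>

lemma signed_of_null: "signed_of (null_measure borel) = (\<lambda>_. 0)"
  by (simp add: signed_of_def measure_diff_def fun_eq_iff)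

lemma energy_norm_signed_of:
  "finite_self_energy P \<Longrightarrow> (nrm (signed_of P))\<^sup>2 = (\<integral>p. (measure P (pball p))\<^sup>2 \<partial>BM)"
  using energy_norm_square[OF energy_cone_space[OF signed_of_energy_cone]] by (simp add: signed_of_pball)

text \<open>If all balls of a set U contain \<open>cball 0 R\<close>, the energy is at least the
  square of the mass of \<open>cball 0 R\<close> times the ball measure of U; it remains to choose U
  with positive finite measure.\<close>

lemma local_mass_bound:
  obtains C where "0 < C" "\<And>P. finite_self_energy P \<Longrightarrow> measure P (cball 0 R) \<le> C * nrm (signed_of P)"
proof -
  \<comment> \<open>With centres within 1 of the origin, radii above |R| + 2 make every ball contain
    \<open>cball 0 R\<close> and stay away from 0.\<close>
  define a where "a = \<bar>R\<bar> + 2"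
  define U where "U = ball (0::'a) 1 \<times> {a<..<a + 1}"
  have U: "open U" unfolding U_def by (intro open_Times) auto
  have sub: "U \<subseteq> cball 0 1 \<times> {a..a+1}" by (auto simp: U_def)
  have "emeasure BM U \<le> emeasure BM (cball 0 1 \<times> {a..a+1})"
    using sub by (intro emeasure_mono) (auto intro!: borel_closed closed_Times)
  also have "\<dots> < \<infinity>" by (rule ball_measure_bounded_finite) (simp add: a_def)
  finally have fin: "emeasure BM U < \<infinity>" .
  have "emeasure BM U \<noteq> 0"
  proof (rule ball_measure_open_pos[OF c U])
    have "(0, a + 1/2) \<in> U" by (simp add: U_def)
    then show "U \<noteq> {}" by blast
  qed (auto simp: U_def a_def)
  define k where "k = measure BM U"
  have k: "0 < k" "emeasure BM U = ennreal k"
    using fin \<open>emeasure BM U \<noteq> 0\<close> unfolding k_def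
    by (auto simp: emeasure_eq_ennreal_measure zero_less_measure_iff)
  show ?thesis
  proof (rule that[of "1 / sqrt k"])
    show "0 < 1 / sqrt k" using k by simp
    fix P :: "'a measure" assume P: "finite_self_energy P"
    let ?m = "measure P (cball 0 R)"
    have rP: "radon_measure P" using P by (rule finite_self_energyD)
    have "?m\<^sup>2 * k = (\<integral>p. ?m\<^sup>2 * indicator U p \<partial>BM)" by (simp add: k_def)
    also have "\<dots> \<le> (\<integral>p. (measure P (pball p))\<^sup>2 \<partial>BM)"
    proof (rule integral_mono)
      show "integrable BM (\<lambda>p. ?m\<^sup>2 * indicator U p)"
        using fin U by (intro integrable_mult_right integrable_real_indicator) auto
      show "integrable BM (\<lambda>p. (measure P (pball p))\<^sup>2)" using P by (simp add: finite_self_energy_def)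
      fix p
      have "?m \<le> measure P (pball p)" if p: "p \<in> U"
      proof -
        have "cball 0 R \<subseteq> pball p"
        proof
          fix x :: 'a assume "x \<in> cball 0 R"
          then show "x \<in> pball p" using p norm_triangle_ineq4[of "fst p" x] by (auto simp: U_def a_def dist_norm mem_Times_iff)
        qed
        then have "emeasure P (cball 0 R) \<le> emeasure P (pball p)" by (intro emeasure_mono) (auto simp: radon_sets[OF rP])
        then show ?thesis by (simp add: radon_emeasure_eq[OF rP])
      qed
      then show "?m\<^sup>2 * indicator U p \<le> (measure P (pball p))\<^sup>2" by (auto simp: indicator_def power_mono)
    qed
    also have "\<dots> = (nrm (signed_of P))\<^sup>2" using energy_norm_signed_of[OF P] by simp
    finally have "(?m * sqrt k)\<^sup>2 \<le> (nrm (signed_of P))\<^sup>2" using k by (simp add: power_mult_distrib)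
    then have "?m * sqrt k \<le> nrm (signed_of P)"
      by (rule power2_le_imp_le) (rule energy_norm_nonneg[OF energy_cone_space[OF signed_of_energy_cone[OF P]]])
    then show "?m \<le> 1 / sqrt k * nrm (signed_of P)" using k by (simp add: field_simps)
  qed
qed

text \<open>In smoothed form the two integrals differ by an L2 pairing of g with the difference of
  the ball masses, to which Cauchy-Schwarz applies; the smoothing errors are proportional to local
  masses, hence to norms. D is fixed before P and Q, so the estimate is uniform in the
  measures.\<close>

lemma Cc_integral_bound:
  assumes \<phi>: "\<phi> \<in> Cc" and e: "0 < e"
  obtains D where "0 \<le> D" "\<And>P Q. finite_self_energy P \<Longrightarrow> finite_self_energy Q \<Longrightarrow>
    \<bar>(\<integral>x. \<phi> x \<partial>P) - (\<integral>x. \<phi> x \<partial>Q)\<bar> \<le> D * nrm (signed_of P - signed_of Q)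
      + e * (nrm (signed_of P) + nrm (signed_of Q))"
proof -
  obtain R0 where R0: "\<And>x :: 'a. R0 < norm x \<Longrightarrow> \<phi> x = 0" using \<phi> by (auto simp: Cc_iff)
  obtain C where C: "0 < C" "\<And>P. finite_self_energy P \<Longrightarrow> measure P (cball 0 (R0 + 1)) \<le> C * nrm (signed_of P)"
    using local_mass_bound[of "R0 + 1"] by metis
  \<comment> \<open>The constant of the mass bound is divided out in advance, so that the error
    comes out as e times the norms.\<close>
  have "0 < e / C" using e C by simp
  from smoothing[OF c \<phi> R0 this, where \<beta>=\<beta>]
  obtain g :: "'a \<times> real \<Rightarrow> real" and a b B where g: "g \<in> borel_measurable borel" "0 < a" "0 < B"
    "\<And>p. \<bar>g p\<bar> \<le> B * indicator (cball 0 (R0 + 1) \<times> {a..b}) p"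
    "\<And>P. radon_measure P \<Longrightarrow> integrable BM (\<lambda>p. g p * measure P (pball p))"
    "\<And>P. radon_measure P \<Longrightarrow>
      \<bar>(\<integral>x. \<phi> x \<partial>P) - (\<integral>p. g p * measure P (pball p) \<partial>BM)\<bar> \<le> e / C * measure P (cball 0 (R0 + 1))"
    by blast
  have gM: "g \<in> borel_measurable BM" using g(1) by simp
  have g2: "integrable BM (\<lambda>p. (g p)\<^sup>2)"
  proof (rule Bochner_Integration.integrable_bound)
    show "integrable BM (\<lambda>p. B\<^sup>2 * indicator (cball 0 (R0 + 1) \<times> {a..b}) p :: real)"
      using ball_measure_bounded_finite[OF g(2)]
      by (intro integrable_mult_right integrable_real_indicator) (auto intro!: borel_closed closed_Times)
    show "AE p in BM. norm ((g p)\<^sup>2) \<le> norm (B\<^sup>2 * indicator (cball 0 (R0 + 1) \<times> {a..b}) p :: real)"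
    proof (intro AE_I2)
      fix p
      have "\<bar>g p\<bar>\<^sup>2 \<le> (B * indicator (cball 0 (R0 + 1) \<times> {a..b}) p)\<^sup>2" using g(4) by (intro power_mono) auto
      then show "norm ((g p)\<^sup>2) \<le> norm (B\<^sup>2 * indicator (cball 0 (R0 + 1) \<times> {a..b}) p :: real)"
        by (auto simp: indicator_def split: if_splits)
    qed
  qed (use gM in measurable)
  define D where "D = sqrt (\<integral>p. (g p)\<^sup>2 \<partial>BM)"
  show ?thesis
  proof (rule that[of D])
    show "0 \<le> D" by (simp add: D_def)
    fix P Q :: "'a measure" assume PQ: "finite_self_energy P" "finite_self_energy Q"
    have r: "radon_measure P" "radon_measure Q" using PQ finite_self_energyD by auto
    let ?d = "signed_of P - signed_of Q"
    have d: "?d \<in> ES" using PQ by (intro energy_space_diff energy_cone_space signed_of_energy_cone)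
    have "(\<integral>p. g p * measure P (pball p) \<partial>BM) - (\<integral>p. g p * measure Q (pball p) \<partial>BM) = (\<integral>p. g p * ?d (pball p) \<partial>BM)"
      using g(5)[OF r(1)] g(5)[OF r(2)] by (simp add: signed_of_pball right_diff_distrib)
    also have "\<bar>\<dots>\<bar> \<le> D * nrm ?d"
    proof -
      have "(\<integral>p. g p * ?d (pball p) \<partial>BM)\<^sup>2 \<le> (\<integral>p. (g p)\<^sup>2 \<partial>BM) * (\<integral>p. (?d (pball p))\<^sup>2 \<partial>BM)"
        by (rule Cauchy_Schwarz_integral[OF gM energy_space_measurable[OF d] g2 energy_space_square_integrable[OF d]])
      then have "\<bar>\<integral>p. g p * ?d (pball p) \<partial>BM\<bar> \<le> sqrt ((\<integral>p. (g p)\<^sup>2 \<partial>BM) * (\<integral>p. (?d (pball p))\<^sup>2 \<partial>BM))"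
        by (intro real_le_rsqrt) (simp only: power2_abs)
      then show ?thesis unfolding D_def energy_norm_eq[OF d] real_sqrt_mult .
    qed
    finally have 1: "\<bar>(\<integral>p. g p * measure P (pball p) \<partial>BM) - (\<integral>p. g p * measure Q (pball p) \<partial>BM)\<bar> \<le> D * nrm ?d" .
    have 2: "e / C * measure S (cball 0 (R0 + 1)) \<le> e * nrm (signed_of S)" if "finite_self_energy S" for S
    proof -
      have "e / C * measure S (cball 0 (R0 + 1)) \<le> e / C * (C * nrm (signed_of S))"
        using C(2)[OF that] e C(1) by (intro mult_left_mono) auto
      then show ?thesis using C(1) by simp
    qed
    show "\<bar>(\<integral>x. \<phi> x \<partial>P) - (\<integral>x. \<phi> x \<partial>Q)\<bar> \<le> D * nrm ?d
      + e * (nrm (signed_of P) + nrm (signed_of Q))"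
      using 1 g(6)[OF r(1)] g(6)[OF r(2)] 2[OF PQ(1)] 2[OF PQ(2)] unfolding distrib_left by linarith
  qed
qed

lemma energy_norm_bound_of_dist:
  assumes "\<nu> \<in> ES" "\<nu>' \<in> ES"
  shows "nrm \<nu> \<le> nrm \<nu>' + nrm (\<nu> - \<nu>')"
proof -
  have z: "(\<lambda>_. 0) \<in> ES"
    using energy_cone_space[OF signed_of_energy_cone[OF finite_self_energy_null]] unfolding signed_of_null .
  have e: "\<kappa> - (\<lambda>_. 0) = \<kappa>" for \<kappa> :: "'a set \<Rightarrow> real" by (simp add: fun_eq_iff)
  show ?thesis using energy_norm_triangle[OF assms z] unfolding e by simp
qed

text \<open>Fatou's lemma is applied to X k - X j as j tends to infinity. It bounds the distance
  from X k to the limit before the limit is known to have finite energy, and so yields finite energy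
  and convergence at once.\<close>

lemma strong_Cauchy_limit:
  assumes X: "\<And>n. finite_self_energy (X n)"
    and Cau: "\<And>e. 0 < e \<Longrightarrow> \<exists>N. \<forall>m\<ge>N. \<forall>n\<ge>N. nrm (signed_of (X m) - signed_of (X n)) < e"
  obtains P where "finite_self_energy P" "(\<lambda>n. nrm (signed_of (X n) - signed_of P)) \<longlonglongrightarrow> 0"
    "\<And>f. f \<in> Cc \<Longrightarrow> (\<lambda>n. \<integral>x. f x \<partial>X n) \<longlonglongrightarrow> (\<integral>x. f x \<partial>P)"
proof -
  have rX: "radon_measure (X n)" for n using X finite_self_energyD by auto
  have XS: "signed_of (X n) \<in> ES" for n using X by (intro energy_cone_space signed_of_energy_cone)
  have Xd: "signed_of (X m) - signed_of (X n) \<in> ES" for m n using XS by (intro energy_space_diff)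
  obtain N0 where N0: "\<And>m n. m \<ge> N0 \<Longrightarrow> n \<ge> N0 \<Longrightarrow> nrm (signed_of (X m) - signed_of (X n)) < 1"
    using Cau[of 1] by auto
  \<comment> \<open>A bound for the norms along the tail, which caps the second term of
    \<open>Cc_integral_bound\<close>.\<close>
  define b where "b = nrm (signed_of (X N0)) + 1"
  have b: "nrm (signed_of (X n)) \<le> b" if "n \<ge> N0" for n
    using energy_norm_bound_of_dist[OF XS XS, of n N0] N0[of n N0] that by (simp add: b_def)
  have b1: "1 \<le> b" using energy_norm_nonneg[OF XS] by (simp add: b_def)
  have conv: "convergent (\<lambda>n. \<integral>x. f x \<partial>X n)" if f: "f \<in> Cc" for f
    unfolding Cauchy_convergent_iff[symmetric]
  proof (rule CauchyI)
    fix e :: real assume e: "0 < e"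
    have "0 < e / (4 * b)" using e b1 by simp
    then obtain D where D: "0 \<le> D" "\<And>P Q. finite_self_energy P \<Longrightarrow> finite_self_energy Q \<Longrightarrow>
      \<bar>(\<integral>x. f x \<partial>P) - (\<integral>x. f x \<partial>Q)\<bar> \<le> D * nrm (signed_of P - signed_of Q)
      + e / (4 * b) * (nrm (signed_of P) + nrm (signed_of Q))"
      using Cc_integral_bound[OF f] by metis
    have "0 < e / (2 * (D + 1))" using e D by simp
    then obtain N where N: "\<And>m n. m \<ge> N \<Longrightarrow> n \<ge> N \<Longrightarrow> nrm (signed_of (X m) - signed_of (X n)) < e / (2 * (D + 1))"
      using Cau by metis
    show "\<exists>M. \<forall>m\<ge>M. \<forall>n\<ge>M. norm ((\<integral>x. f x \<partial>X m) - (\<integral>x. f x \<partial>X n)) < e"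
    proof (intro exI[of _ "max N N0"] allI impI)
      fix m n assume mn: "max N N0 \<le> m" "max N N0 \<le> n"
      have "D * nrm (signed_of (X m) - signed_of (X n)) \<le> D * (e / (2 * (D + 1)))"
        using N[of m n] mn D(1) by (intro mult_left_mono) auto
      also have "\<dots> < e / 2" using e D(1) by (simp add: field_simps)
      finally have 1: "D * nrm (signed_of (X m) - signed_of (X n)) < e / 2" .
      have "e / (4 * b) * (nrm (signed_of (X m)) + nrm (signed_of (X n))) \<le> e / (4 * b) * (b + b)"
        using b[of m] b[of n] mn e b1 by (intro mult_left_mono add_mono) auto
      also have "\<dots> = e / 2" using b1 by simp
      finally show "norm ((\<integral>x. f x \<partial>X m) - (\<integral>x. f x \<partial>X n)) < e"
        using D(2)[OF X X, of m n] 1 by simp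
    qed
  qed
  define L where "L f = lim (\<lambda>n. \<integral>x. f x \<partial>X n)" for f :: "'a \<Rightarrow> real"
  have L: "(\<lambda>n. \<integral>x. f x \<partial>X n) \<longlonglongrightarrow> L f" if "f \<in> Cc" for f
    using conv[OF that] unfolding L_def by (simp add: convergent_LIMSEQ_iff)
  interpret L: positive_functional L
  proof
    fix f g :: "'a \<Rightarrow> real" and k :: real assume f: "f \<in> Cc"
    show "0 \<le> L f" if "\<And>x. 0 \<le> f x"
      using that by (intro LIMSEQ_le_const[OF L[OF f]]) (auto intro!: exI[of _ 0] integral_nonneg)
    have "(\<lambda>n. \<integral>x. k * f x \<partial>X n) \<longlonglongrightarrow> k * L f" using tendsto_mult_left[OF L[OF f], of k] by simp
    with L[OF Cc_scale[OF f]] show "L (\<lambda>x. k * f x) = k * L f" by (rule LIMSEQ_unique)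
    assume g: "g \<in> Cc"
    have "(\<lambda>n. \<integral>x. f x + g x \<partial>X n) \<longlonglongrightarrow> L f + L g"
      using tendsto_add[OF L[OF f] L[OF g]] radon_integrable_Cc[OF rX f] radon_integrable_Cc[OF rX g] by simp
    with L[OF Cc_add[OF f g]] show "L (\<lambda>x. f x + g x) = L f + L g" by (rule LIMSEQ_unique)
  qed
  define P where "P = L.riesz_measure"
  have rP: "radon_measure P" unfolding P_def by (rule L.radon_riesz_measure)
  have vague: "(\<lambda>n. \<integral>x. f x \<partial>X n) \<longlonglongrightarrow> (\<integral>x. f x \<partial>P)" if "f \<in> Cc" for f
    using L[OF that] L.riesz_markov[OF that] by (simp add: P_def)
  have AElim: "AE p in BM. (\<lambda>n. measure (X n) (pball p)) \<longlonglongrightarrow> measure P (pball p)"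
    using AE_not_on_sphere[OF rP, of c \<beta>]
    by eventually_elim (rule vague_limit_ball[OF rX rP vague])
  let ?D = "\<lambda>k p. measure (X k) (pball p) - measure P (pball p)"
  have mX: "(\<lambda>p. measure (X n) (pball p)) \<in> borel_measurable BM" for n by (rule measure_pball_BM[OF rX])
  have mP: "(\<lambda>p. measure P (pball p)) \<in> borel_measurable BM" by (rule measure_pball_BM[OF rP])
  \<comment> \<open>Formulated in \<open>ennreal\<close>, because square integrability of the
    difference is still to be shown.\<close>
  have fatou: "\<exists>N. \<forall>k\<ge>N. (\<integral>\<^sup>+p. ennreal ((?D k p)\<^sup>2) \<partial>BM) \<le> ennreal (e\<^sup>2)" if e: "0 < e" for e
  proof -
    obtain N where N: "\<And>m n. m \<ge> N \<Longrightarrow> n \<ge> N \<Longrightarrow> nrm (signed_of (X m) - signed_of (X n)) < e"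
      using Cau[OF e] by metis
    show ?thesis
    proof (intro exI[of _ N] allI impI)
      fix k assume k: "N \<le> k"
      have "(\<integral>\<^sup>+p. ennreal ((?D k p)\<^sup>2) \<partial>BM)
        = (\<integral>\<^sup>+p. liminf (\<lambda>j. ennreal ((measure (X k) (pball p) - measure (X j) (pball p))\<^sup>2)) \<partial>BM)"
      proof (rule nn_integral_cong_AE)
        show "AE p in BM. ennreal ((?D k p)\<^sup>2) = liminf (\<lambda>j. ennreal ((measure (X k) (pball p) - measure (X j) (pball p))\<^sup>2))"
          using AElim
        proof eventually_elim
          case (elim p)
          then have "(\<lambda>j. ennreal ((measure (X k) (pball p) - measure (X j) (pball p))\<^sup>2)) \<longlonglongrightarrow> ennreal ((?D k p)\<^sup>2)"
            by (intro tendsto_ennrealI tendsto_intros)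
          then show ?case using lim_imp_Liminf[OF sequentially_bot] by metis
        qed
      qed
      also have "\<dots> \<le> liminf (\<lambda>j. \<integral>\<^sup>+p. ennreal ((measure (X k) (pball p) - measure (X j) (pball p))\<^sup>2) \<partial>BM)"
      proof (rule nn_integral_liminf)
        fix j
        note [measurable] = mX[of k] mX[of j]
        show "(\<lambda>p. ennreal ((measure (X k) (pball p) - measure (X j) (pball p))\<^sup>2)) \<in> borel_measurable BM"
          by measurable
      qed
      also have "\<dots> \<le> liminf (\<lambda>j. ennreal (e\<^sup>2))"
      proof (rule Liminf_mono)
        show "\<forall>\<^sub>F j in sequentially. (\<integral>\<^sup>+p. ennreal ((measure (X k) (pball p) - measure (X j) (pball p))\<^sup>2) \<partial>BM) \<le> ennreal (e\<^sup>2)"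
        proof (rule eventually_sequentiallyI[of N])
          fix j assume j: "N \<le> j"
          have "(\<integral>\<^sup>+p. ennreal ((measure (X k) (pball p) - measure (X j) (pball p))\<^sup>2) \<partial>BM)
            = ennreal ((nrm (signed_of (X k) - signed_of (X j)))\<^sup>2)"
            using energy_space_square_integrable[OF Xd, of k j] energy_norm_square[OF Xd, of k j]
            by (subst nn_integral_eq_integral) (auto simp: signed_of_pball)
          also have "\<dots> \<le> ennreal (e\<^sup>2)"
            using N[OF k j] energy_norm_nonneg[OF Xd] by (intro ennreal_leI power_mono) auto
          finally show "(\<integral>\<^sup>+p. ennreal ((measure (X k) (pball p) - measure (X j) (pball p))\<^sup>2) \<partial>BM) \<le> ennreal (e\<^sup>2)" .
        qed
      qed
      also have "\<dots> = ennreal (e\<^sup>2)" by (rule Liminf_const) simp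
      finally show "(\<integral>\<^sup>+p. ennreal ((?D k p)\<^sup>2) \<partial>BM) \<le> ennreal (e\<^sup>2)" .
    qed
  qed
  have Dint: "integrable BM (\<lambda>p. (?D k p)\<^sup>2)" if "(\<integral>\<^sup>+p. ennreal ((?D k p)\<^sup>2) \<partial>BM) \<le> ennreal t" for k t
    using that mX[of k] mP by (intro integrableI_bounded) (auto intro: le_less_trans)
  have fP: "finite_self_energy P"
  proof -
    \<comment> \<open>The ball masses of P differ from those of a single X N by a square integrable
      function.\<close>
    obtain N where N: "(\<integral>\<^sup>+p. ennreal ((?D N p)\<^sup>2) \<partial>BM) \<le> ennreal (1\<^sup>2)" using fatou[of 1] by auto
    have "integrable BM (\<lambda>p. 2 * (measure (X N) (pball p))\<^sup>2 + 2 * (?D N p)\<^sup>2)"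
      using Dint[OF N] X[of N] by (intro Bochner_Integration.integrable_add integrable_mult_right) (auto simp: finite_self_energy_def)
    then have "integrable BM (\<lambda>p. (measure P (pball p))\<^sup>2)"
    proof (rule Bochner_Integration.integrable_bound)
      show "(\<lambda>p. (measure P (pball p))\<^sup>2) \<in> borel_measurable BM" using mP by measurable
      have "y\<^sup>2 \<le> 2 * x\<^sup>2 + 2 * (x - y)\<^sup>2" for x y :: real
        using zero_le_power2[of "2 * x - y"] by (simp add: power2_eq_square algebra_simps)
      then show "AE p in BM. norm ((measure P (pball p))\<^sup>2) \<le> norm (2 * (measure (X N) (pball p))\<^sup>2 + 2 * (?D N p)\<^sup>2)"
        by (intro AE_I2) simp
    qed
    then show ?thesis using rP by (simp add: finite_self_energy_def)
  qed
  have PS: "signed_of P \<in> ES" using fP by (intro energy_cone_space signed_of_energy_cone)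
  have "(\<lambda>n. nrm (signed_of (X n) - signed_of P)) \<longlonglongrightarrow> 0"
  proof (rule LIMSEQ_I)
    fix e :: real assume e: "0 < e"
    obtain N where N: "\<And>k. k \<ge> N \<Longrightarrow> (\<integral>\<^sup>+p. ennreal ((?D k p)\<^sup>2) \<partial>BM) \<le> ennreal ((e/2)\<^sup>2)" using fatou[of "e/2"] e by auto
    show "\<exists>N. \<forall>n\<ge>N. norm (nrm (signed_of (X n) - signed_of P) - 0) < e"
    proof (intro exI[of _ N] allI impI)
      fix n assume n: "N \<le> n"
      have d: "signed_of (X n) - signed_of P \<in> ES" by (rule energy_space_diff[OF XS PS])
      have "ennreal ((nrm (signed_of (X n) - signed_of P))\<^sup>2) = (\<integral>\<^sup>+p. ennreal ((?D n p)\<^sup>2) \<partial>BM)"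
        using Dint[OF N[OF n]] energy_norm_square[OF d]
        by (subst nn_integral_eq_integral) (auto simp: signed_of_pball)
      also have "\<dots> \<le> ennreal ((e/2)\<^sup>2)" by (rule N[OF n])
      finally have "(nrm (signed_of (X n) - signed_of P))\<^sup>2 \<le> (e/2)\<^sup>2" by simp
      then have "nrm (signed_of (X n) - signed_of P) \<le> e/2" by (rule power2_le_imp_le) (use e in simp)
      then show "norm (nrm (signed_of (X n) - signed_of P) - 0) < e"
        using e energy_norm_nonneg[OF d] by simp
    qed
  qed
  then show ?thesis using that fP vague by blast
qed

end

section \<open>Measures carried by a set\<close>

text \<open>Null sets of the completion are the subsets of Borel null sets. Thus a set that is not
  Borel can be handled through a Borel cover of its complement.\<close>

lemma carried_by_iff:
  assumes P: "radon_measure P"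
  shows "carried_by P Q \<longleftrightarrow> (\<exists>N\<in>sets borel. - Q \<subseteq> N \<and> emeasure P N = 0)"
proof -
  have iff: "- Q \<in> null_sets (completion P) \<longleftrightarrow> (\<exists>N\<in>sets borel. - Q \<subseteq> N \<and> emeasure P N = 0)"
    unfolding null_sets_completion_iff2 by (auto simp: null_sets_def radon_sets[OF P])
  have "Q \<in> sets (completion P)" if "- Q \<in> null_sets (completion P)"
  proof -
    have "space (completion P) - (- Q) \<in> sets (completion P)" using that by (intro sets.compl_sets) auto
    then show ?thesis by (simp add: radon_space[OF P] Diff_eq)
  qed
  then show ?thesis unfolding carried_by_def using iff by blast
qed

lemma emeasure_density_indicator:
  assumes P: "radon_measure P" and K: "K \<in> sets borel" and B: "B \<in> sets borel"
  shows "emeasure (density P (indicator K)) B = emeasure P (K \<inter> B)"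
proof -
  have "emeasure (density P (indicator K)) B = (\<integral>\<^sup>+x. indicator K x * indicator B x \<partial>P)"
    using K B by (intro emeasure_density borel_measurable_indicator) (auto simp: radon_sets[OF P])
  also have "\<dots> = (\<integral>\<^sup>+x. indicator (K \<inter> B) x \<partial>P)" by (intro nn_integral_cong) (auto simp: indicator_def)
  also have "\<dots> = emeasure P (K \<inter> B)" using K B by (intro nn_integral_indicator) (auto simp: radon_sets[OF P])
  finally show ?thesis .
qed

definition half_sum :: "'a::euclidean_space measure \<Rightarrow> 'a measure \<Rightarrow> 'a measure" where
  "half_sum P Q = scale_measure (1 / 2) (add_measure P Q)"

lemma emeasure_half_sum:
  assumes "radon_measure P" "radon_measure Q" "B \<in> sets borel"
  shows "emeasure (half_sum P Q) B = (1 / 2) * (emeasure P B + emeasure Q B)"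
  using assms by (simp add: half_sum_def emeasure_add_measure radon_sets)

lemma radon_half_sum:
  assumes "radon_measure P" "radon_measure Q" shows "radon_measure (half_sum P Q)"
  unfolding radon_measure_def
proof (intro conjI allI impI)
  show "sets (half_sum P Q) = sets borel" by (simp add: half_sum_def sets_add_measure)
  fix K :: "'a set" assume K: "compact K"
  have "emeasure P K < \<infinity>" "emeasure Q K < \<infinity>" using assms K by (auto simp: radon_measure_def)
  moreover have "(1 / 2 :: ennreal) < \<infinity>" by (simp add: ennreal_divide_eq_top_iff less_top[symmetric])
  ultimately show "emeasure (half_sum P Q) K < \<infinity>"
    using emeasure_half_sum[OF assms borel_compact[OF K]] by (simp add: ennreal_mult_less_top)
qed

lemma measure_half_sum:
  assumes "radon_measure P" "radon_measure Q" "B \<in> sets borel" "bounded B"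
  shows "measure (half_sum P Q) B = (measure P B + measure Q B) / 2"
proof -
  have "emeasure (half_sum P Q) B = ennreal (1 / 2) * (ennreal (measure P B) + ennreal (measure Q B))"
    using emeasure_half_sum[OF assms(1-3)] divide_ennreal[of 1 2]
    unfolding radon_emeasure_eq[OF assms(1,4)] radon_emeasure_eq[OF assms(2,4)] by simp
  also have "\<dots> = ennreal (1 / 2 * (measure P B + measure Q B))"
    by (subst ennreal_mult) (simp_all only: ennreal_plus measure_nonneg add_nonneg_nonneg zero_le_divide_1_iff zero_le_numeral)
  finally show ?thesis by (simp add: measure_def)
qed

context ball_represented_kernel begin

definition midpoint_cone :: "('a set \<Rightarrow> real) \<Rightarrow> ('a set \<Rightarrow> real) \<Rightarrow> 'a set \<Rightarrow> real" where
  "midpoint_cone \<nu> \<nu>' = (\<lambda>B. (\<nu> B + \<nu>' B) / 2)"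

lemma midpoint_signed_of:
  assumes "radon_measure P" "radon_measure Q"
  shows "midpoint_cone (signed_of P) (signed_of Q) = signed_of (half_sum P Q)"
  using assms by (auto simp: midpoint_cone_def signed_of_def measure_diff_def measure_half_sum fun_eq_iff)

lemma finite_self_energy_half_sum:
  assumes "finite_self_energy P" "finite_self_energy Q" shows "finite_self_energy (half_sum P Q)"
proof (rule finite_self_energy_mono[OF finite_self_energy_add[OF assms]])
  have r: "radon_measure P" "radon_measure Q" using assms finite_self_energyD by auto
  show "radon_measure (half_sum P Q)" using r by (rule radon_half_sum)
  fix B :: "'a set" assume B: "B \<in> sets borel"
  have "(1 / 2 :: ennreal) * (emeasure P B + emeasure Q B) \<le> 1 * (emeasure P B + emeasure Q B)"
    by (intro mult_right_mono) (auto simp: divide_le_posI_ennreal)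
  then show "emeasure (half_sum P Q) B \<le> emeasure (add_measure P Q) B"
    using r B by (simp add: emeasure_half_sum emeasure_add_measure radon_sets)
qed

lemma energy_cone_on_iff:
  "\<nu> \<in> energy_cone_on \<alpha> Q \<longleftrightarrow> (\<exists>P. finite_self_energy P \<and> carried_by P Q \<and> \<nu> = signed_of P)"
proof
  assume "\<nu> \<in> energy_cone_on \<alpha> Q"
  then have \<nu>: "\<nu> \<in> EC" "carried_by (pos_part \<nu>) Q" by (auto simp: energy_cone_on_def)
  then obtain P where P: "finite_self_energy P" "\<nu> = signed_of P" by (auto simp: energy_cone_iff)
  then show "\<exists>P. finite_self_energy P \<and> carried_by P Q \<and> \<nu> = signed_of P"
    using \<nu>(2) parts_signed_of(1)[OF finite_self_energyD[OF P(1)]] by auto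
next
  assume "\<exists>P. finite_self_energy P \<and> carried_by P Q \<and> \<nu> = signed_of P"
  then obtain P where P: "finite_self_energy P" "carried_by P Q" "\<nu> = signed_of P" by auto
  then show "\<nu> \<in> energy_cone_on \<alpha> Q"
    using parts_signed_of(1)[OF finite_self_energyD[OF P(1)]] signed_of_energy_cone[OF P(1)]
    by (simp add: energy_cone_on_def)
qed

lemma energy_cone_on_EC: "\<nu> \<in> energy_cone_on \<alpha> Q \<Longrightarrow> \<nu> \<in> EC"
  by (simp add: energy_cone_on_def)

lemma energy_cone_on_mono:
  fixes Q Q' :: "'a set"
  assumes "Q \<subseteq> Q'" "\<nu> \<in> energy_cone_on \<alpha> Q" shows "\<nu> \<in> energy_cone_on \<alpha> Q'"
proof -
  obtain P where P: "finite_self_energy P" "carried_by P Q" "\<nu> = signed_of P"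
    using assms(2) unfolding energy_cone_on_iff by auto
  then have "carried_by P Q'"
    using assms(1) unfolding carried_by_iff[OF finite_self_energyD[OF P(1)]] by blast
  then show ?thesis unfolding energy_cone_on_iff using P by auto
qed

lemma energy_cone_on_midpoint:
  assumes "\<nu> \<in> energy_cone_on \<alpha> Q" "\<nu>' \<in> energy_cone_on \<alpha> Q"
  shows "midpoint_cone \<nu> \<nu>' \<in> energy_cone_on \<alpha> Q"
proof -
  obtain P where P: "finite_self_energy P" "carried_by P Q" "\<nu> = signed_of P"
    using assms(1) unfolding energy_cone_on_iff by auto
  obtain P' where P': "finite_self_energy P'" "carried_by P' Q" "\<nu>' = signed_of P'"
    using assms(2) unfolding energy_cone_on_iff by auto
  have r: "radon_measure P" "radon_measure P'" using P P' finite_self_energyD by auto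
  obtain N where N: "N \<in> sets borel" "- Q \<subseteq> N" "emeasure P N = 0" using P(2) carried_by_iff[OF r(1)] by blast
  obtain N' where N': "N' \<in> sets borel" "- Q \<subseteq> N'" "emeasure P' N' = 0" using P'(2) carried_by_iff[OF r(2)] by blast
  \<comment> \<open>Both null sets cover the complement of Q; so does their intersection, which is
    null for both measures.\<close>
  have "emeasure P (N \<inter> N') = 0" "emeasure P' (N \<inter> N') = 0"
    using emeasure_mono[of "N \<inter> N'" N P] emeasure_mono[of "N \<inter> N'" N' P'] N N' r by (simp_all add: radon_sets)
  then have "emeasure (half_sum P P') (N \<inter> N') = 0"
    using N N' emeasure_half_sum[OF r, of "N \<inter> N'"] by simp
  then have "carried_by (half_sum P P') Q"
    unfolding carried_by_iff[OF radon_half_sum[OF r]] using N N' by (intro bexI[of _ "N \<inter> N'"]) auto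
  then show ?thesis
    unfolding energy_cone_on_iff P(3) P'(3) midpoint_signed_of[OF r]
    using finite_self_energy_half_sum[OF P(1) P'(1)] by blast
qed

lemma zero_energy_cone_on: "(\<lambda>_. 0) \<in> energy_cone_on \<alpha> (Q :: 'a set)"
proof -
  have "carried_by (null_measure borel :: 'a measure) Q"
    unfolding carried_by_iff[OF radon_null] by (intro bexI[of _ UNIV]) auto
  then show ?thesis unfolding energy_cone_on_iff using finite_self_energy_null signed_of_null[symmetric] by blast
qed

lemma restrict_finite_self_energy:
  assumes P: "finite_self_energy P" and K: "K \<in> sets borel"
  shows "finite_self_energy (density P (indicator K))"
proof -
  have r: "radon_measure P" using P by (rule finite_self_energyD)
  note e = emeasure_density_indicator[OF r K]
  have le: "emeasure (density P (indicator K)) B \<le> emeasure P B" if "B \<in> sets borel" for B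
    using that K by (auto simp: e radon_sets[OF r] intro!: emeasure_mono)
  have "radon_measure (density P (indicator K))"
    unfolding radon_measure_def
  proof (intro conjI allI impI)
    show "sets (density P (indicator K)) = sets borel" by (simp add: radon_sets[OF r])
    fix C :: "'a set" assume C: "compact C"
    have "emeasure (density P (indicator K)) C \<le> emeasure P C" using C by (intro le borel_compact)
    also have "\<dots> < \<infinity>" using r C by (auto simp: radon_measure_def)
    finally show "emeasure (density P (indicator K)) C < \<infinity>" .
  qed
  then show "finite_self_energy (density P (indicator K))" using finite_self_energy_mono[OF P _ le] by blast
qed

section \<open>Approximation from inside by compact sets\<close>

text \<open>Inner regularity is applied to finite restrictions of P, namely on the bounded pieces
  \<open>B \<inter> cball 0 j\<close>, with error 1 / (j + 1). Each piece lies in all later ones, so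
  what the union of the compact sets misses of it has mass below every later error.\<close>

lemma compact_exhaustion:
  fixes P :: "'a measure"
  assumes P: "radon_measure P" and B: "B \<in> sets borel"
  obtains K :: "nat \<Rightarrow> 'a set" where "\<And>n. compact (K n)" "\<And>n. K n \<subseteq> B" "incseq K" "emeasure P (B - (\<Union>n. K n)) = 0"
proof -
  have "\<exists>C. compact C \<and> C \<subseteq> B \<inter> cball 0 (real j) \<and> emeasure P (B \<inter> cball 0 (real j)) \<le> emeasure P C + ennreal (1 / Suc j)" for j :: nat
  proof -
    let ?D = "B \<inter> cball 0 (real j)"
    define M where "M = density P (indicator (cball 0 (real j)))"
    have e: "emeasure M S = emeasure P (cball 0 (real j) \<inter> S)" if "S \<in> sets borel" for S
      unfolding M_def using P that by (intro emeasure_density_indicator) auto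
    have D: "?D \<in> sets borel" using B by auto
    have sM: "sets M = sets borel" by (simp add: M_def radon_sets[OF P])
    have "emeasure M (space M) \<noteq> \<infinity>"
      using e[of UNIV] radon_finite_bounded[OF P, of "cball 0 (real j)"] sets_eq_imp_space_eq[OF sM] by auto
    from inner_regular[OF sM this D]
    have SUP: "emeasure M ?D = (SUP K\<in>{K. K \<subseteq> ?D \<and> compact K}. emeasure M K)" .
    have fin: "emeasure M ?D < \<infinity>" using e[OF D] radon_finite_bounded[OF P, of "cball 0 (real j) \<inter> ?D"]
      by (auto simp: bounded_Int)
    have MP: "emeasure M S = emeasure P S" if "S \<in> sets borel" "S \<subseteq> ?D" for S
      using e[OF that(1)] that(2) by (simp add: Int_absorb1)
    show ?thesis
    proof (cases "emeasure M ?D = 0")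
      case True
      then show ?thesis using MP[OF D] by (intro exI[of _ "{}"]) auto
    next
      case False
      then have "emeasure M ?D - ennreal (1 / Suc j) < emeasure M ?D"
        using fin by (intro ennreal_between) (auto simp: zero_less_iff_neq_zero)
      then obtain C where C: "C \<subseteq> ?D" "compact C" "emeasure M ?D - ennreal (1 / Suc j) < emeasure M C"
        unfolding SUP less_SUP_iff by auto
      then have "emeasure M ?D \<le> emeasure M C + ennreal (1 / Suc j)"
        by (metis add.commute ennreal_minus_le_iff less_imp_le)
      then show ?thesis using C MP[OF D] MP[OF borel_compact[OF C(2)] C(1)] by auto
    qed
  qed
  then obtain C where C: "\<And>j. compact (C j)" "\<And>j. C j \<subseteq> B \<inter> cball 0 (real j)"
    "\<And>j::nat. emeasure P (B \<inter> cball 0 (real j)) \<le> emeasure P (C j) + ennreal (1 / Suc j)" by metis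
  define K where "K n = (\<Union>j\<le>n. C j)" for n
  have Cm: "C j \<in> sets borel" for j using C(1) by (rule borel_compact)
  show ?thesis
  proof (rule that[of K])
    show "compact (K n)" for n unfolding K_def using C(1) by (intro compact_UN) auto
    show "K n \<subseteq> B" for n unfolding K_def using C(2) by blast
    show "incseq K" unfolding K_def incseq_def by (intro allI impI UN_mono) auto
    have UK: "(\<Union>n. K n) = (\<Union>n. C n)" unfolding K_def by auto
    have null: "emeasure P (B \<inter> cball 0 (real i) - (\<Union>n. C n)) = 0" for i :: nat
    proof -
      have "emeasure P (B \<inter> cball 0 (real i) - (\<Union>n. C n)) \<le> ennreal (1 / Suc j)" if j: "i \<le> j" for j
      proof -
        have Bj: "B \<inter> cball 0 (real j) \<in> sets P" using B by (auto simp: radon_sets[OF P])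
        have "cball (0::'a) (real i) \<subseteq> cball 0 (real j)" using j by (intro subset_cball) simp
        then have "emeasure P (B \<inter> cball 0 (real i) - (\<Union>n. C n)) \<le> emeasure P (B \<inter> cball 0 (real j) - C j)"
          using B Cm by (intro emeasure_mono) (auto simp: radon_sets[OF P])
        also have "\<dots> = emeasure P (B \<inter> cball 0 (real j)) - emeasure P (C j)"
          using C(2) Cm B radon_finite_bounded[OF P compact_imp_bounded[OF C(1)]]
          by (intro emeasure_Diff) (auto simp: radon_sets[OF P] less_top)
        also have "\<dots> \<le> ennreal (1 / Suc j)"
          using C(3)[of j] radon_finite_bounded[OF P compact_imp_bounded[OF C(1)], of j]
          by (auto simp: ennreal_minus_le_iff add.commute)
        finally show ?thesis .
      qed
      then have "\<forall>\<^sub>F j in sequentially. emeasure P (B \<inter> cball 0 (real i) - (\<Union>n. C n)) \<le> ennreal (1 / Suc j)"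
        by (rule eventually_sequentiallyI)
      moreover have "(\<lambda>j. ennreal (1 / Suc j)) \<longlonglongrightarrow> ennreal 0"
        using LIMSEQ_inverse_real_of_nat by (intro tendsto_ennrealI) (simp add: inverse_eq_divide)
      ultimately have "emeasure P (B \<inter> cball 0 (real i) - (\<Union>n. C n)) \<le> ennreal 0"
        by (intro tendsto_lowerbound) auto
      then show ?thesis by simp
    qed
    have "B - (\<Union>n. K n) = (\<Union>i::nat. B \<inter> cball 0 (real i) - (\<Union>n. C n))"
      unfolding UK using real_arch_simple by auto
    moreover have "(\<Union>i::nat. B \<inter> cball 0 (real i) - (\<Union>n. C n)) \<in> null_sets P"
      using null B Cm by (intro null_sets_UN') (auto simp: null_sets_def radon_sets[OF P])
    ultimately show "emeasure P (B - (\<Union>n. K n)) = 0" by auto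
  qed
qed

text \<open>A need not be Borel, so the exhaustion takes place in the Borel set - N, which lies in A
  and carries P. The ball masses of the restrictions converge to those of P and are dominated by
  them, so dominated convergence gives strong convergence.\<close>

lemma energy_cone_on_compact_dense:
  fixes A :: "'a set"
  assumes \<nu>: "\<nu> \<in> energy_cone_on \<alpha> A" and e: "0 < e"
  obtains K \<xi> where "compact K" "K \<subseteq> A" "\<xi> \<in> energy_cone_on \<alpha> K" "nrm (\<xi> - \<nu>) < e"
proof -
  obtain P where P: "finite_self_energy P" "carried_by P A" "\<nu> = signed_of P"
    using \<nu> unfolding energy_cone_on_iff by auto
  have r: "radon_measure P" using P finite_self_energyD by auto
  obtain N where N: "N \<in> sets borel" "- A \<subseteq> N" "emeasure P N = 0" using P(2) carried_by_iff[OF r] by blast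
  have "- N \<in> sets borel" using N by auto
  then obtain K :: "nat \<Rightarrow> 'a set" where K: "\<And>n. compact (K n)" "\<And>n. K n \<subseteq> - N" "incseq K" "emeasure P (- N - (\<Union>n. K n)) = 0"
    using compact_exhaustion[OF r] by metis
  have Km: "K n \<in> sets borel" for n using K(1) by (rule borel_compact)
  define X where "X n = density P (indicator (K n))" for n
  have fX: "finite_self_energy (X n)" for n unfolding X_def by (rule restrict_finite_self_energy[OF P(1) Km])
  have rX: "radon_measure (X n)" for n using fX finite_self_energyD by auto
  have eX: "emeasure (X n) B = emeasure P (K n \<inter> B)" if "B \<in> sets borel" for n B
    unfolding X_def by (rule emeasure_density_indicator[OF r Km that])
  have mX: "measure (X n) B = measure P (K n \<inter> B)" if "B \<in> sets borel" for n B
    using eX[OF that] by (simp add: measure_def)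
  have lim: "(\<lambda>n. measure (X n) (pball p)) \<longlonglongrightarrow> measure P (pball p)" for p
  proof -
    have "(\<lambda>n. measure P (K n \<inter> pball p)) \<longlonglongrightarrow> measure P (\<Union>n. K n \<inter> pball p)"
    proof (rule Lim_measure_incseq)
      show "range (\<lambda>n. K n \<inter> pball p) \<subseteq> sets P" using Km by (auto simp: radon_sets[OF r])
      show "incseq (\<lambda>n. K n \<inter> pball p)" using K(3) by (auto simp: incseq_def)
      have "bounded (\<Union>n. K n \<inter> pball p)" by (rule bounded_subset[OF bounded_ball[of "fst p" "snd p"]]) auto
      then show "emeasure P (\<Union>n. K n \<inter> pball p) \<noteq> \<infinity>" using radon_finite_bounded[OF r] by (metis less_irrefl)
    qed
    also have "measure P (\<Union>n. K n \<inter> pball p) = measure P (pball p)"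
    proof -
      have n: "N \<union> (- N - (\<Union>n. K n)) \<in> null_sets P"
        using N K(4) Km by (intro null_sets.Un) (auto simp: null_sets_def radon_sets[OF r])
      have "emeasure P (pball p) \<le> emeasure P ((\<Union>n. K n \<inter> pball p) \<union> (N \<union> (- N - (\<Union>n. K n))))"
        using n Km by (intro emeasure_mono) (auto simp: radon_sets[OF r] null_sets_def)
      also have "\<dots> = emeasure P (\<Union>n. K n \<inter> pball p)"
        using n Km by (intro emeasure_Un_null_set) (auto simp: radon_sets[OF r])
      finally have "emeasure P (pball p) \<le> emeasure P (\<Union>n. K n \<inter> pball p)" .
      moreover have "emeasure P (\<Union>n. K n \<inter> pball p) \<le> emeasure P (pball p)"
        by (intro emeasure_mono) (auto simp: radon_sets[OF r])
      ultimately show ?thesis unfolding measure_def by (intro arg_cong[where f=enn2real] antisym)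
    qed
    finally show ?thesis by (simp add: mX)
  qed
  have PS: "signed_of P \<in> ES" "signed_of (X n) \<in> ES" for n
    using P fX by (auto intro: energy_cone_space signed_of_energy_cone)
  have "(\<lambda>n. \<integral>p. (measure (X n) (pball p) - measure P (pball p))\<^sup>2 \<partial>BM) \<longlonglongrightarrow> (\<integral>p. 0 \<partial>BM)"
  proof (rule integral_dominated_convergence[where w="\<lambda>p. (measure P (pball p))\<^sup>2"])
    show "integrable BM (\<lambda>p. (measure P (pball p))\<^sup>2)" using P(1) by (simp add: finite_self_energy_def)
    show "(\<lambda>p. (measure (X n) (pball p) - measure P (pball p))\<^sup>2) \<in> borel_measurable BM" for n
      using measure_pball_BM[OF r] measure_pball_BM[OF rX[of n]] by measurable
    show "AE p in BM. (\<lambda>n. (measure (X n) (pball p) - measure P (pball p))\<^sup>2) \<longlonglongrightarrow> 0"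
    proof (intro AE_I2)
      fix p
      have "(\<lambda>n. (measure (X n) (pball p) - measure P (pball p))\<^sup>2) \<longlonglongrightarrow> (measure P (pball p) - measure P (pball p))\<^sup>2"
        by (intro tendsto_intros lim)
      then show "(\<lambda>n. (measure (X n) (pball p) - measure P (pball p))\<^sup>2) \<longlonglongrightarrow> 0" by simp
    qed
    show "AE p in BM. norm ((measure (X n) (pball p) - measure P (pball p))\<^sup>2) \<le> (measure P (pball p))\<^sup>2" for n
    proof (intro AE_I2)
      fix p
      have "emeasure P (K n \<inter> pball p) \<le> emeasure P (pball p)" by (intro emeasure_mono) (auto simp: radon_sets[OF r])
      then have "measure P (K n \<inter> pball p) \<le> measure P (pball p)"
        using radon_emeasure_eq[OF r, of "pball p"] radon_emeasure_eq[OF r, of "K n \<inter> pball p"] by (auto simp: bounded_Int)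
      then have "\<bar>measure (X n) (pball p) - measure P (pball p)\<bar> \<le> measure P (pball p)"
        by (simp add: mX abs_le_iff)
      then have "\<bar>measure (X n) (pball p) - measure P (pball p)\<bar>\<^sup>2 \<le> (measure P (pball p))\<^sup>2" by (intro power_mono) auto
      then show "norm ((measure (X n) (pball p) - measure P (pball p))\<^sup>2) \<le> (measure P (pball p))\<^sup>2" by simp
    qed
  qed simp
  then have "(\<lambda>n. \<integral>p. (measure (X n) (pball p) - measure P (pball p))\<^sup>2 \<partial>BM) \<longlonglongrightarrow> 0" by simp
  then have "(\<lambda>n. sqrt (\<integral>p. (measure (X n) (pball p) - measure P (pball p))\<^sup>2 \<partial>BM)) \<longlonglongrightarrow> sqrt 0"
    by (rule tendsto_real_sqrt)
  then have "(\<lambda>n. nrm (signed_of (X n) - signed_of P)) \<longlonglongrightarrow> 0"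
    by (simp add: energy_norm_eq energy_space_diff PS signed_of_pball)
  from order_tendstoD(2)[OF this e] obtain n where n: "nrm (signed_of (X n) - signed_of P) < e"
    by (auto simp: eventually_sequentially)
  have "carried_by (X n) (K n)"
    unfolding carried_by_iff[OF rX] using Km[of n] eX[of "- K n" n] by (intro bexI[of _ "- K n"]) auto
  then have "signed_of (X n) \<in> energy_cone_on \<alpha> (K n)" unfolding energy_cone_on_iff using fX by blast
  moreover have "K n \<subseteq> A" using K(2)[of n] N(2) by auto
  ultimately show ?thesis using that[of "K n" "signed_of (X n)"] K(1) n P(3) by simp
qed

section \<open>Orthogonal projections onto closed convex sets\<close>

definition strong_Cauchy :: "(nat \<Rightarrow> 'a set \<Rightarrow> real) \<Rightarrow> bool" where
  "strong_Cauchy X \<longleftrightarrow> (\<forall>e>0. \<exists>N. \<forall>m\<ge>N. \<forall>n\<ge>N. nrm (X m - X n) < e)"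

text \<open>What the projection argument asks of a convex set: midpoints instead of all convex
  combinations, since convexity enters through the parallelogram law, and completeness instead of
  closedness, since the ambient space need not be complete.\<close>

definition projectable :: "('a set \<Rightarrow> real) set \<Rightarrow> bool" where
  "projectable M \<longleftrightarrow> M \<subseteq> EC \<and> M \<noteq> {} \<and> (\<forall>\<nu>\<in>M. \<forall>\<nu>'\<in>M. midpoint_cone \<nu> \<nu>' \<in> M) \<and>
    (\<forall>X. (\<forall>n. X n \<in> M) \<longrightarrow> strong_Cauchy X \<longrightarrow> (\<exists>\<nu>\<in>M. (\<lambda>n. nrm (X n - \<nu>)) \<longlonglongrightarrow> 0))"

lemma parallelogram:
  assumes "\<mu> \<in> ES" "\<nu> \<in> ES" "\<nu>' \<in> ES" "midpoint_cone \<nu> \<nu>' \<in> ES"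
  shows "(nrm (\<nu> - \<nu>'))\<^sup>2 + 4 * (nrm (\<mu> - midpoint_cone \<nu> \<nu>'))\<^sup>2
    = 2 * (nrm (\<mu> - \<nu>))\<^sup>2 + 2 * (nrm (\<mu> - \<nu>'))\<^sup>2"
proof -
  let ?m = "midpoint_cone \<nu> \<nu>'"
  have d: "\<nu> - \<nu>' \<in> ES" "\<mu> - ?m \<in> ES" "\<mu> - \<nu> \<in> ES" "\<mu> - \<nu>' \<in> ES" using assms by (auto intro: energy_space_diff)
  note i = d[THEN energy_space_square_integrable]
  have "(\<integral>p. ((\<nu> - \<nu>') (pball p))\<^sup>2 \<partial>BM) + 4 * (\<integral>p. ((\<mu> - ?m) (pball p))\<^sup>2 \<partial>BM)
     = (\<integral>p. ((\<nu> - \<nu>') (pball p))\<^sup>2 + 4 * ((\<mu> - ?m) (pball p))\<^sup>2 \<partial>BM)"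
    using i(1,2) by simp
  also have "\<dots> = (\<integral>p. 2 * ((\<mu> - \<nu>) (pball p))\<^sup>2 + 2 * ((\<mu> - \<nu>') (pball p))\<^sup>2 \<partial>BM)"
    by (intro Bochner_Integration.integral_cong refl) (simp add: midpoint_cone_def power2_eq_square field_simps)
  also have "\<dots> = 2 * (\<integral>p. ((\<mu> - \<nu>) (pball p))\<^sup>2 \<partial>BM) + 2 * (\<integral>p. ((\<mu> - \<nu>') (pball p))\<^sup>2 \<partial>BM)"
    using i(3,4) by simp
  finally show ?thesis by (simp add: energy_norm_square d)
qed

text \<open>The midpoint of q and p lies in M and cannot be closer to \<mu> than p, so the
  parallelogram law bounds the distance from q to p by the excess of q. No excess means uniqueness;
  small excess will give the convergence along compact sets.\<close>

lemma orth_proj_close: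
  assumes M: "projectable M" and \<mu>: "\<mu> \<in> ES" and p: "is_orth_proj \<alpha> M \<mu> p" and q: "q \<in> M"
  shows "(nrm (q - p))\<^sup>2 \<le> 2 * ((nrm (\<mu> - q))\<^sup>2 - (nrm (\<mu> - p))\<^sup>2)"
proof -
  have pM: "p \<in> M" using p by (simp add: is_orth_proj_def)
  have mM: "midpoint_cone q p \<in> M" using M q pM by (simp add: projectable_def)
  have S: "p \<in> ES" "q \<in> ES" "midpoint_cone q p \<in> ES" using M pM q mM energy_cone_space by (auto simp: projectable_def)
  have "nrm (\<mu> - p) \<le> nrm (\<mu> - midpoint_cone q p)" using p mM by (simp add: is_orth_proj_def)
  then have "(nrm (\<mu> - p))\<^sup>2 \<le> (nrm (\<mu> - midpoint_cone q p))\<^sup>2"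
    using energy_norm_nonneg[OF energy_space_diff[OF \<mu> S(1)]] by (intro power_mono)
  moreover have "x \<le> 2 * (a - b)" if "x + 4 * m = 2 * a + 2 * b" "b \<le> m" for x m a b :: real
    using that by argo
  ultimately show ?thesis using parallelogram[OF \<mu> S(2,1,3)] by blast
qed

lemma orth_proj_unique:
  assumes M: "projectable M" and \<mu>: "\<mu> \<in> ES" and p: "is_orth_proj \<alpha> M \<mu> p" and q: "is_orth_proj \<alpha> M \<mu> q"
  shows "p = q"
proof -
  have pq: "p \<in> M" "q \<in> M" using p q by (auto simp: is_orth_proj_def)
  have S: "p \<in> ES" "q \<in> ES" using M pq energy_cone_space by (auto simp: projectable_def)
  have "nrm (\<mu> - q) = nrm (\<mu> - p)"
    using p q pq unfolding is_orth_proj_def by (intro antisym) auto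
  then have "(nrm (q - p))\<^sup>2 \<le> 0" using orth_proj_close[OF M \<mu> p pq(2)] by simp
  then have "nrm (q - p) = 0" by simp
  then show ?thesis using energy_norm_definite[OF S(2,1)] by simp
qed

lemma orth_proj_exists:
  assumes M: "projectable M" and \<mu>: "\<mu> \<in> ES"
  obtains p where "is_orth_proj \<alpha> M \<mu> p"
proof -
  have MS: "\<nu> \<in> ES" if "\<nu> \<in> M" for \<nu> using M that energy_cone_space by (auto simp: projectable_def)
  have dS: "\<mu> - \<nu> \<in> ES" if "\<nu> \<in> M" for \<nu> using MS[OF that] \<mu> by (intro energy_space_diff)
  define \<delta> where "\<delta> = (INF \<nu>\<in>M. nrm (\<mu> - \<nu>))"
  have bdd: "bdd_below ((\<lambda>\<nu>. nrm (\<mu> - \<nu>)) ` M)"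
    using energy_norm_nonneg[OF dS] by (intro bdd_belowI[of _ 0]) auto
  have ne: "M \<noteq> {}" using M by (simp add: projectable_def)
  have \<delta>le: "\<delta> \<le> nrm (\<mu> - \<nu>)" if "\<nu> \<in> M" for \<nu> unfolding \<delta>_def by (rule cINF_lower[OF bdd that])
  have \<delta>0: "0 \<le> \<delta>" unfolding \<delta>_def using energy_norm_nonneg[OF dS] by (intro cINF_greatest ne)
  have "\<exists>\<nu>\<in>M. nrm (\<mu> - \<nu>) < \<delta> + inverse (real (Suc n))" for n
  proof -
    have "(INF \<nu>\<in>M. nrm (\<mu> - \<nu>)) < \<delta> + inverse (real (Suc n))" unfolding \<delta>_def[symmetric] by simp
    then show ?thesis by (subst (asm) cINF_less_iff[OF ne bdd])
  qed
  then obtain X where X: "\<And>n. X n \<in> M" "\<And>n. nrm (\<mu> - X n) < \<delta> + inverse (real (Suc n))" by metis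
  have "strong_Cauchy X"
    unfolding strong_Cauchy_def
  proof (intro allI impI)
    fix e :: real assume e: "0 < e"
    \<comment> \<open>Chosen so that \<open>4 * ((\<delta> + t)\<^sup>2 - \<delta>\<^sup>2) \<le> 4
      * (t * (2 * \<delta> + 1)) < e\<^sup>2\<close>, using t \<le> 1.\<close>
    have "0 < e\<^sup>2 / (4 * (2 * \<delta> + 1))" using e \<delta>0 by simp
    then obtain N where N: "inverse (real (Suc N)) < e\<^sup>2 / (4 * (2 * \<delta> + 1))" using reals_Archimedean by blast
    define t where "t = inverse (real (Suc N))"
    have t: "0 < t" "t \<le> 1" "4 * (t * (2 * \<delta> + 1)) < e\<^sup>2"
      using N \<delta>0 by (auto simp: t_def field_simps)
    have small: "(nrm (\<mu> - X n))\<^sup>2 \<le> (\<delta> + t)\<^sup>2" if "N \<le> n" for n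
    proof -
      have "inverse (real (Suc n)) \<le> t" unfolding t_def using that by (intro le_imp_inverse_le) auto
      then have "nrm (\<mu> - X n) \<le> \<delta> + t" using X(2)[of n] by simp
      then show ?thesis using energy_norm_nonneg[OF dS[OF X(1)]] by (intro power_mono)
    qed
    show "\<exists>N. \<forall>m\<ge>N. \<forall>n\<ge>N. nrm (X m - X n) < e"
    proof (intro exI[of _ N] allI impI)
      fix m n assume mn: "N \<le> m" "N \<le> n"
      have mid: "midpoint_cone (X m) (X n) \<in> M" using M X(1) by (simp add: projectable_def)
      have "\<delta>\<^sup>2 \<le> (nrm (\<mu> - midpoint_cone (X m) (X n)))\<^sup>2" using \<delta>le[OF mid] \<delta>0 by (intro power_mono)
      then have "(nrm (X m - X n))\<^sup>2 \<le> 4 * (\<delta> + t)\<^sup>2 - 4 * \<delta>\<^sup>2"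
        using parallelogram[OF \<mu> MS[OF X(1)] MS[OF X(1)] MS[OF mid]] small[OF mn(1)] small[OF mn(2)] by linarith
      also have "\<dots> = 4 * (t * (2 * \<delta> + t))" by (simp add: power2_eq_square algebra_simps)
      also have "\<dots> \<le> 4 * (t * (2 * \<delta> + 1))" using t by (intro mult_left_mono) auto
      also have "\<dots> < e\<^sup>2" by (rule t(3))
      finally show "nrm (X m - X n) < e" using e by (rule power2_less_imp_less[OF _ less_imp_le])
    qed
  qed
  then obtain p where p: "p \<in> M" "(\<lambda>n. nrm (X n - p)) \<longlonglongrightarrow> 0"
    using M X(1) unfolding projectable_def by blast
  have "(\<lambda>n. (\<delta> + inverse (real (Suc n))) + nrm (X n - p)) \<longlonglongrightarrow> (\<delta> + 0) + 0"
    by (intro tendsto_add tendsto_const LIMSEQ_inverse_real_of_nat p(2))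
  moreover have "nrm (\<mu> - p) \<le> (\<delta> + inverse (real (Suc n))) + nrm (X n - p)" for n
    using energy_norm_triangle[OF \<mu> MS[OF X(1)[of n]] MS[OF p(1)]] X(2)[of n] by simp
  ultimately have "nrm (\<mu> - p) \<le> \<delta> + 0 + 0" by (intro LIMSEQ_le_const) auto
  then have "is_orth_proj \<alpha> M \<mu> p" unfolding is_orth_proj_def using p(1) \<delta>le by force
  then show ?thesis by (rule that)
qed

lemma is_orth_proj_orth_proj:
  assumes M: "projectable M" and \<mu>: "\<mu> \<in> ES" shows "is_orth_proj \<alpha> M \<mu> (orth_proj \<alpha> M \<mu>)"
proof -
  obtain p where p: "is_orth_proj \<alpha> M \<mu> p" using orth_proj_exists[OF assms] by blast
  show ?thesis unfolding orth_proj_def by (rule theI[of "is_orth_proj \<alpha> M \<mu>", OF p]) (rule orth_proj_unique[OF M \<mu> _ p])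
qed

lemma EC_strong_Cauchy_limit:
  assumes X: "\<And>n. X n \<in> EC" and Cau: "strong_Cauchy X"
  obtains Y P where "\<And>n. finite_self_energy (Y n)" "\<And>n. X n = signed_of (Y n)" "finite_self_energy P"
    "(\<lambda>n. nrm (X n - signed_of P)) \<longlonglongrightarrow> 0"
    "\<And>f. f \<in> Cc \<Longrightarrow> (\<lambda>n. \<integral>x. f x \<partial>Y n) \<longlonglongrightarrow> (\<integral>x. f x \<partial>P)"
proof -
  have "\<exists>Y. finite_self_energy Y \<and> X n = signed_of Y" for n using X[of n] by (simp add: energy_cone_iff)
  then obtain Y where Y: "\<And>n. finite_self_energy (Y n)" "\<And>n. X n = signed_of (Y n)" by metis
  have "\<exists>N. \<forall>m\<ge>N. \<forall>n\<ge>N. nrm (signed_of (Y m) - signed_of (Y n)) < e" if "0 < e" for e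
    using Cau that unfolding strong_Cauchy_def Y(2) by blast
  then obtain P where P: "finite_self_energy P" "(\<lambda>n. nrm (signed_of (Y n) - signed_of P)) \<longlonglongrightarrow> 0"
    "\<And>f. f \<in> Cc \<Longrightarrow> (\<lambda>n. \<integral>x. f x \<partial>Y n) \<longlonglongrightarrow> (\<integral>x. f x \<partial>P)"
    using strong_Cauchy_limit[of Y, OF Y(1)] by metis
  then show ?thesis using that[of Y P] Y by simp
qed

section \<open>Completeness of the cones of closed sets and of the closure\<close>

text \<open>Measures carried by K give no mass to its open complement, and this property passes to
  vague limits.\<close>

lemma projectable_closed:
  assumes K: "closed K" shows "projectable (energy_cone_on \<alpha> K)"
  unfolding projectable_def
proof (intro conjI ballI allI impI)
  show "energy_cone_on \<alpha> K \<subseteq> EC" using energy_cone_on_EC by blast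
  show "energy_cone_on \<alpha> K \<noteq> {}" using zero_energy_cone_on by blast
  show "midpoint_cone \<nu> \<nu>' \<in> energy_cone_on \<alpha> K" if "\<nu> \<in> energy_cone_on \<alpha> K" "\<nu>' \<in> energy_cone_on \<alpha> K" for \<nu> \<nu>'
    using that by (rule energy_cone_on_midpoint)
  fix X assume X: "\<forall>n. X n \<in> energy_cone_on \<alpha> K" and Cau: "strong_Cauchy X"
  have XE: "X n \<in> EC" for n using X energy_cone_on_EC by blast
  obtain Y P where Y: "\<And>n. finite_self_energy (Y n)" "\<And>n. X n = signed_of (Y n)" and P: "finite_self_energy P"
    and lim: "(\<lambda>n. nrm (X n - signed_of P)) \<longlonglongrightarrow> 0"
    "\<And>f. f \<in> Cc \<Longrightarrow> (\<lambda>n. \<integral>x. f x \<partial>Y n) \<longlonglongrightarrow> (\<integral>x. f x \<partial>P)"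
    using EC_strong_Cauchy_limit[of X, OF XE Cau] by metis
  have rY: "radon_measure (Y n)" for n using Y finite_self_energyD by auto
  have rP: "radon_measure P" using P finite_self_energyD by auto
  have "emeasure (Y n) (- K) = 0" for n
  proof -
    obtain Q where Q: "finite_self_energy Q" "carried_by Q K" "X n = signed_of Q"
      using X unfolding energy_cone_on_iff by blast
    then have "Q = Y n" using Y signed_of_inj[OF finite_self_energyD rY] by metis
    then obtain N where "N \<in> sets borel" "- K \<subseteq> N" "emeasure (Y n) N = 0"
      using Q(2) carried_by_iff[OF rY] by blast
    then show ?thesis using emeasure_mono[of "- K" N "Y n"] by (simp add: radon_sets[OF rY])
  qed
  then have "emeasure P (- K) = 0"
    using K by (intro vague_limit_open_null[OF rY rP lim(2)]) auto
  then have "carried_by P K" unfolding carried_by_iff[OF rP] using K by (intro bexI[of _ "- K"]) auto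
  then have "signed_of P \<in> energy_cone_on \<alpha> K" unfolding energy_cone_on_iff using P by blast
  then show "\<exists>\<nu>\<in>energy_cone_on \<alpha> K. (\<lambda>n. nrm (X n - \<nu>)) \<longlonglongrightarrow> 0" using lim(1) by blast
qed

lemma energy_cone_closure_iff:
  "\<nu> \<in> energy_cone_closure \<alpha> A \<longleftrightarrow> \<nu> \<in> ES \<and> (\<forall>e>0. \<exists>\<xi>\<in>energy_cone_on \<alpha> A. nrm (\<xi> - \<nu>) < e)"
  unfolding energy_cone_closure_def
  by (rule closure_strong_iff) (use energy_cone_on_EC energy_cone_space in blast)

text \<open>The closure is taken among signed measures. Positivity survives because an approximating
  sequence also converges to an element of the complete positive cone, and strong limits are
  unique.\<close>

lemma energy_cone_closure_EC:
  assumes \<nu>: "\<nu> \<in> energy_cone_closure \<alpha> A" shows "\<nu> \<in> EC"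
proof -
  have \<nu>S: "\<nu> \<in> ES" using \<nu> by (simp add: energy_cone_closure_iff)
  have "\<exists>\<xi>\<in>energy_cone_on \<alpha> A. nrm (\<xi> - \<nu>) < inverse (real (Suc n))" for n
    using \<nu> unfolding energy_cone_closure_iff by (simp del: of_nat_Suc)
  then obtain X where X: "\<And>n. X n \<in> energy_cone_on \<alpha> A" "\<And>n. nrm (X n - \<nu>) < inverse (real (Suc n))" by metis
  have XE: "X n \<in> EC" for n using X energy_cone_on_EC by blast
  have XS: "X n \<in> ES" for n using XE energy_cone_space by blast
  have "strong_Cauchy X"
    unfolding strong_Cauchy_def
  proof (intro allI impI)
    fix e :: real assume e: "0 < e"
    then obtain N where N: "inverse (real (Suc N)) < e / 2" using reals_Archimedean[of "e/2"] by auto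
    have small: "nrm (X n - \<nu>) < e / 2" if "N \<le> n" for n
    proof -
      have "inverse (real (Suc n)) \<le> inverse (real (Suc N))" using that by (intro le_imp_inverse_le) auto
      then show ?thesis using X(2)[of n] N by linarith
    qed
    show "\<exists>N. \<forall>m\<ge>N. \<forall>n\<ge>N. nrm (X m - X n) < e"
    proof (intro exI[of _ N] allI impI)
      fix m n assume "N \<le> m" "N \<le> n"
      then show "nrm (X m - X n) < e"
        using energy_norm_triangle[OF XS \<nu>S XS, of m n] energy_norm_sym[OF \<nu>S XS, of n] small[of m] small[of n] by linarith
    qed
  qed
  then obtain P where P: "finite_self_energy P" "(\<lambda>n. nrm (X n - signed_of P)) \<longlonglongrightarrow> 0"
    using EC_strong_Cauchy_limit[of X, OF XE] by metis
  have PS: "signed_of P \<in> ES" using P(1) by (intro energy_cone_space signed_of_energy_cone)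
  have "(\<lambda>n. inverse (real (Suc n)) + nrm (X n - signed_of P)) \<longlonglongrightarrow> 0 + 0"
    by (intro tendsto_add LIMSEQ_inverse_real_of_nat P(2))
  moreover have "nrm (\<nu> - signed_of P) \<le> inverse (real (Suc n)) + nrm (X n - signed_of P)" for n
    using energy_norm_triangle[OF \<nu>S XS[of n] PS] energy_norm_sym[OF \<nu>S XS[of n]] X(2)[of n] by linarith
  ultimately have "nrm (\<nu> - signed_of P) \<le> 0 + 0" by (intro LIMSEQ_le_const) auto
  then have "nrm (\<nu> - signed_of P) = 0" using energy_norm_nonneg[OF energy_space_diff[OF \<nu>S PS]] by simp
  then have "\<nu> = signed_of P" by (rule energy_norm_definite[OF \<nu>S PS])
  then show ?thesis using signed_of_energy_cone[OF P(1)] by simp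
qed

lemma midpoint_EC: "\<nu> \<in> EC \<Longrightarrow> \<nu>' \<in> EC \<Longrightarrow> midpoint_cone \<nu> \<nu>' \<in> EC"
  unfolding energy_cone_iff
  using midpoint_signed_of finite_self_energyD finite_self_energy_half_sum by metis

text \<open>Convexity of the square, ball by ball; it carries midpoints over to the closure.\<close>

lemma midpoint_dist:
  assumes "\<nu> \<in> ES" "\<nu>' \<in> ES" "\<xi> \<in> ES" "\<xi>' \<in> ES" "midpoint_cone \<nu> \<nu>' \<in> ES" "midpoint_cone \<xi> \<xi>' \<in> ES"
  shows "(nrm (midpoint_cone \<xi> \<xi>' - midpoint_cone \<nu> \<nu>'))\<^sup>2
    \<le> ((nrm (\<xi> - \<nu>))\<^sup>2 + (nrm (\<xi>' - \<nu>'))\<^sup>2) / 2"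
proof -
  have d: "\<xi> - \<nu> \<in> ES" "\<xi>' - \<nu>' \<in> ES" "midpoint_cone \<xi> \<xi>' - midpoint_cone \<nu> \<nu>' \<in> ES"
    using assms by (auto intro: energy_space_diff)
  note i = d[THEN energy_space_square_integrable]
  have "(\<integral>p. ((midpoint_cone \<xi> \<xi>' - midpoint_cone \<nu> \<nu>') (pball p))\<^sup>2 \<partial>BM)
    \<le> (\<integral>p. (((\<xi> - \<nu>) (pball p))\<^sup>2 + ((\<xi>' - \<nu>') (pball p))\<^sup>2) / 2 \<partial>BM)"
  proof (rule integral_mono)
    show "integrable BM (\<lambda>p. (((\<xi> - \<nu>) (pball p))\<^sup>2 + ((\<xi>' - \<nu>') (pball p))\<^sup>2) / 2)"
      using i by (intro integrable_divide Bochner_Integration.integrable_add)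
    fix p
    have "((a + b) / 2)\<^sup>2 \<le> (a\<^sup>2 + b\<^sup>2) / 2" for a b :: real
      using zero_le_power2[of "a - b"] by (simp add: power2_eq_square field_simps)
    from this[of "(\<xi> - \<nu>) (pball p)" "(\<xi>' - \<nu>') (pball p)"]
    show "((midpoint_cone \<xi> \<xi>' - midpoint_cone \<nu> \<nu>') (pball p))\<^sup>2 \<le> (((\<xi> - \<nu>) (pball p))\<^sup>2 + ((\<xi>' - \<nu>') (pball p))\<^sup>2) / 2"
      by (simp add: midpoint_cone_def diff_divide_distrib[symmetric] algebra_simps)
  qed (rule i(3))
  also have "\<dots> = ((\<integral>p. ((\<xi> - \<nu>) (pball p))\<^sup>2 \<partial>BM) + (\<integral>p. ((\<xi>' - \<nu>') (pball p))\<^sup>2 \<partial>BM)) / 2"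
    using i by simp
  finally show ?thesis unfolding energy_norm_square[OF d(1)] energy_norm_square[OF d(2)] energy_norm_square[OF d(3)] .
qed

lemma projectable_closure: "projectable (energy_cone_closure \<alpha> A)"
  unfolding projectable_def
proof (intro conjI ballI allI impI)
  show "energy_cone_closure \<alpha> A \<subseteq> EC" using energy_cone_closure_EC by blast
  have "(\<lambda>_. 0) \<in> energy_cone_closure \<alpha> A"
    unfolding energy_cone_closure_iff
    using zero_energy_cone_on[of A] energy_cone_space[OF energy_cone_on_EC] energy_norm_self by metis
  then show "energy_cone_closure \<alpha> A \<noteq> {}" by blast
next
  fix \<nu> \<nu>' assume n: "\<nu> \<in> energy_cone_closure \<alpha> A" "\<nu>' \<in> energy_cone_closure \<alpha> A"
  have m: "midpoint_cone \<nu> \<nu>' \<in> ES" using n by (intro energy_cone_space midpoint_EC energy_cone_closure_EC)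
  show "midpoint_cone \<nu> \<nu>' \<in> energy_cone_closure \<alpha> A"
    unfolding energy_cone_closure_iff
  proof (intro conjI m allI impI)
    fix e :: real assume e: "0 < e"
    obtain \<xi> where x: "\<xi> \<in> energy_cone_on \<alpha> A" "nrm (\<xi> - \<nu>) < e" using n(1) e unfolding energy_cone_closure_iff by blast
    obtain \<xi>' where x': "\<xi>' \<in> energy_cone_on \<alpha> A" "nrm (\<xi>' - \<nu>') < e" using n(2) e unfolding energy_cone_closure_iff by blast
    have S: "\<nu> \<in> ES" "\<nu>' \<in> ES" "\<xi> \<in> ES" "\<xi>' \<in> ES" "midpoint_cone \<xi> \<xi>' \<in> ES"
      using n x x' energy_cone_on_midpoint[OF x(1) x'(1)] by (auto simp: energy_cone_closure_iff intro: energy_cone_space energy_cone_on_EC)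
    have "(nrm (\<xi> - \<nu>))\<^sup>2 < e\<^sup>2" "(nrm (\<xi>' - \<nu>'))\<^sup>2 < e\<^sup>2"
      using x(2) x'(2) energy_norm_nonneg[OF energy_space_diff[OF S(3,1)]] energy_norm_nonneg[OF energy_space_diff[OF S(4,2)]]
      by (auto intro!: power_strict_mono)
    moreover have "z < s" if "x < s" "y < s" "z \<le> (x + y) / 2" for x y z s :: real
      using that by argo
    ultimately have "(nrm (midpoint_cone \<xi> \<xi>' - midpoint_cone \<nu> \<nu>'))\<^sup>2 < e\<^sup>2"
      using midpoint_dist[OF S(1-4) m S(5)] by blast
    then have "nrm (midpoint_cone \<xi> \<xi>' - midpoint_cone \<nu> \<nu>') < e"
      by (rule power2_less_imp_less) (use e in simp)
    then show "\<exists>\<eta>\<in>energy_cone_on \<alpha> A. nrm (\<eta> - midpoint_cone \<nu> \<nu>') < e"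
      using energy_cone_on_midpoint[OF x(1) x'(1)] by blast
  qed
next
  fix X assume X: "\<forall>n. X n \<in> energy_cone_closure \<alpha> A" and Cau: "strong_Cauchy X"
  have XE: "X n \<in> EC" for n using X energy_cone_closure_EC by blast
  have XS: "X n \<in> ES" for n using XE energy_cone_space by blast
  obtain P where P: "finite_self_energy P" "(\<lambda>n. nrm (X n - signed_of P)) \<longlonglongrightarrow> 0"
    using EC_strong_Cauchy_limit[of X, OF XE Cau] by metis
  have PS: "signed_of P \<in> ES" using P(1) by (intro energy_cone_space signed_of_energy_cone)
  have "signed_of P \<in> energy_cone_closure \<alpha> A"
    unfolding energy_cone_closure_iff
  proof (intro conjI PS allI impI)
    fix e :: real assume e: "0 < e"
    have "0 < e / 2" using e by simp
    from order_tendstoD(2)[OF P(2) this] obtain n where n: "nrm (X n - signed_of P) < e / 2"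
      by (auto simp: eventually_sequentially)
    obtain \<xi> where x: "\<xi> \<in> energy_cone_on \<alpha> A" "nrm (\<xi> - X n) < e / 2"
      using X \<open>0 < e / 2\<close> unfolding energy_cone_closure_iff by blast
    have "\<xi> \<in> ES" using x(1) energy_cone_on_EC energy_cone_space by blast
    then have "nrm (\<xi> - signed_of P) < e"
      using energy_norm_triangle[OF _ XS PS, of \<xi> n] n x(2) by fastforce
    then show "\<exists>\<xi>\<in>energy_cone_on \<alpha> A. nrm (\<xi> - signed_of P) < e" using x(1) by blast
  qed
  then show "\<exists>\<nu>\<in>energy_cone_closure \<alpha> A. (\<lambda>n. nrm (X n - \<nu>)) \<longlonglongrightarrow> 0" using P(2) by blast
qed

section \<open>Convergence along the compact subsets\<close>

text \<open>The estimate of \<open>Cc_integral_bound\<close> is uniform in the measures, so it works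
  along an arbitrary filter; the norms are eventually at most b, which absorbs its second
  term.\<close>

lemma strong_imp_vague:
  fixes f :: "'b \<Rightarrow> 'a set \<Rightarrow> real"
  assumes l: "l \<in> EC" and f: "\<forall>\<^sub>F x in F. f x \<in> EC"
    and lim: "\<And>e. 0 < e \<Longrightarrow> \<forall>\<^sub>F x in F. nrm (f x - l) < e"
  shows "limitin vague_topology f l F"
proof -
  have si: "signed_integral (signed_of P) \<phi> = (\<integral>x. \<phi> x \<partial>P)" if "radon_measure P" for P :: "'a measure" and \<phi>
    using parts_signed_of[OF that] by (simp add: signed_integral_def integral_null_measure)
  have lS: "l \<in> ES" using l by (rule energy_cone_space)
  obtain Q where Q: "finite_self_energy Q" "l = signed_of Q" using l by (auto simp: energy_cone_iff)
  have comp: "((\<lambda>x. signed_integral (f x) \<phi>) \<longlongrightarrow> signed_integral l \<phi>) F" if \<phi>: "\<phi> \<in> Cc" for \<phi>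
  proof (rule tendstoI)
    fix e :: real assume e: "0 < e"
    define b where "b = nrm l + 1"
    have b: "1 \<le> b" using energy_norm_nonneg[OF lS] by (simp add: b_def)
    have "0 < e / (4 * b)" using e b by simp
    then obtain D where D: "0 \<le> D" "\<And>P Q. finite_self_energy P \<Longrightarrow> finite_self_energy Q \<Longrightarrow>
      \<bar>(\<integral>x. \<phi> x \<partial>P) - (\<integral>x. \<phi> x \<partial>Q)\<bar> \<le> D * nrm (signed_of P - signed_of Q)
      + e / (4 * b) * (nrm (signed_of P) + nrm (signed_of Q))"
      using Cc_integral_bound[OF \<phi>] by metis
    have "0 < min 1 (e / (2 * (D + 1)))" using e D by simp
    from f lim[OF this] show "\<forall>\<^sub>F x in F. dist (signed_integral (f x) \<phi>) (signed_integral l \<phi>) < e"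
    proof eventually_elim
      case (elim x)
      obtain P where P: "finite_self_energy P" "f x = signed_of P" using elim(1) by (auto simp: energy_cone_iff)
      have "nrm (f x) \<le> b"
        using energy_norm_bound_of_dist[OF energy_cone_space[OF elim(1)] lS] elim(2) by (simp add: b_def)
      then have "e / (4 * b) * (nrm (f x) + nrm l) \<le> e / (4 * b) * (b + b)"
        using e b by (intro mult_left_mono add_mono) (auto simp: b_def)
      also have "\<dots> = e / 2" using b by simp
      finally have 1: "e / (4 * b) * (nrm (f x) + nrm l) \<le> e / 2" .
      have "D * nrm (f x - l) \<le> D * (e / (2 * (D + 1)))"
        using elim(2) D(1) by (intro mult_left_mono) auto
      also have "\<dots> < e / 2" using e D(1) by (simp add: field_simps)
      finally have 2: "D * nrm (f x - l) < e / 2" .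
      have "\<bar>(\<integral>x. \<phi> x \<partial>P) - (\<integral>x. \<phi> x \<partial>Q)\<bar> < e"
        using D(2)[OF P(1) Q(1)] 1 2 unfolding P(2) Q(2) by linarith
      then show ?case
        unfolding P(2) Q(2) si[OF finite_self_energyD[OF P(1)]] si[OF finite_self_energyD[OF Q(1)]] dist_real_def .
    qed
  qed
  have sr: "\<nu> \<in> signed_radon" if "\<nu> \<in> EC" for \<nu> using that by (simp add: energy_cone_def energy_space_def)
  define g where "g = (\<lambda>\<nu> :: 'a set \<Rightarrow> real. \<lambda>\<phi>\<in>Cc. signed_integral \<nu> \<phi>)"
  \<comment> \<open>The vague topology is pulled back from a product, so convergence is checked one
    test function at a time.\<close>
  have g: "limitin (product_topology (\<lambda>_. euclideanreal) Cc) (\<lambda>x. g (f x)) (g l) F"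
    unfolding limitin_componentwise
    using comp by (auto simp: g_def topspace_product_topology limitin_canonical_iff)
  show ?thesis
    unfolding limitin_def vague_topology_def g_def[symmetric]
  proof (intro conjI allI impI)
    show "l \<in> topspace (pullback_topology signed_radon g (product_topology (\<lambda>_. euclideanreal) Cc))"
      using sr[OF l] by (simp add: topspace_pullback_topology g_def topspace_product_topology)
    fix U assume "openin (pullback_topology signed_radon g (product_topology (\<lambda>_. euclideanreal) Cc)) U \<and> l \<in> U"
    then obtain V where V: "openin (product_topology (\<lambda>_. euclideanreal) Cc) V" "U = g -` V \<inter> signed_radon" "l \<in> U"
      unfolding openin_pullback_topology by blast
    then have "\<forall>\<^sub>F x in F. g (f x) \<in> V" using g unfolding limitin_def by blast
    with f show "\<forall>\<^sub>F x in F. f x \<in> U"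
    proof eventually_elim
      case (elim x) then show ?case using sr V by auto
    qed
  qed
qed

text \<open>The projection onto the cone of K lies in the closure for A. Once K contains a compact
  set whose cone has an element q near p, this projection is at least as close to \<mu> as q; it
  nearly minimizes the distance over the closure, and \<open>orth_proj_close\<close> puts it near
  p.\<close>

lemma orth_proj_converges:
  assumes \<mu>: "\<mu> \<in> ES" and p: "is_orth_proj \<alpha> (energy_cone_closure \<alpha> A) \<mu> p" and e: "0 < e"
  shows "\<forall>\<^sub>F K in compact_subsets_at_top A. orth_proj \<alpha> (energy_cone_on \<alpha> K) \<mu> \<in> EC \<and>
    nrm (orth_proj \<alpha> (energy_cone_on \<alpha> K) \<mu> - p) < e"
proof -
  define \<delta> where "\<delta> = nrm (\<mu> - p)"
  have pM: "p \<in> energy_cone_closure \<alpha> A" using p by (simp add: is_orth_proj_def)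
  have pS: "p \<in> ES" using pM by (simp add: energy_cone_closure_iff)
  have \<delta>: "0 \<le> \<delta>" unfolding \<delta>_def by (rule energy_norm_nonneg[OF energy_space_diff[OF \<mu> pS]])
  \<comment> \<open>This t gives \<open>2 * ((\<delta> + t)\<^sup>2 - \<delta>\<^sup>2) \<le> 2 * (t
    * (2 * \<delta> + 1)) < e\<^sup>2\<close>, as \<open>orth_proj_close\<close> asks. Half of t is
    spent on approximating p in the cone of A, half on passing to a compact set.\<close>
  define t where "t = min 1 (e\<^sup>2 / (4 * (2 * \<delta> + 1)))"
  have t: "0 < t" "t \<le> 1" using e \<delta> by (auto simp: t_def)
  have "t \<le> e\<^sup>2 / (4 * (2 * \<delta> + 1))" by (simp add: t_def)
  then have "2 * (t * (2 * \<delta> + 1)) \<le> e\<^sup>2 / 2" using \<delta> by (simp add: field_simps)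
  moreover have "0 < e\<^sup>2" using e by simp
  ultimately have te: "2 * (t * (2 * \<delta> + 1)) < e\<^sup>2" by linarith
  obtain \<xi> where x: "\<xi> \<in> energy_cone_on \<alpha> A" "nrm (\<xi> - p) < t / 2"
    using pM t(1) unfolding energy_cone_closure_iff by (meson half_gt_zero)
  obtain K0 q where K0: "compact K0" "K0 \<subseteq> A" and q: "q \<in> energy_cone_on \<alpha> K0" "nrm (q - \<xi>) < t / 2"
    using energy_cone_on_compact_dense[OF x(1), of "t / 2"] t(1) by auto
  have S: "\<xi> \<in> ES" "q \<in> ES" using x q energy_cone_on_EC energy_cone_space by blast+
  have "nrm (q - p) < t" using energy_norm_triangle[OF S(2,1) pS] x(2) q(2) by linarith
  then have \<mu>q: "nrm (\<mu> - q) \<le> \<delta> + t"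
    using energy_norm_triangle[OF \<mu> pS S(2)] energy_norm_sym[OF pS S(2)] by (simp add: \<delta>_def)
  show ?thesis
    unfolding eventually_compact_subsets_at_top
  proof (intro exI[of _ K0] conjI K0 allI impI)
    fix K assume K: "compact K \<and> K \<subseteq> A \<and> K0 \<subseteq> K"
    define r where "r = orth_proj \<alpha> (energy_cone_on \<alpha> K) \<mu>"
    have "projectable (energy_cone_on \<alpha> K)" using K by (intro projectable_closed compact_imp_closed) auto
    then have r: "is_orth_proj \<alpha> (energy_cone_on \<alpha> K) \<mu> r" unfolding r_def using \<mu> by (rule is_orth_proj_orth_proj)
    then have rK: "r \<in> energy_cone_on \<alpha> K" by (simp add: is_orth_proj_def)
    then have rA: "r \<in> energy_cone_on \<alpha> A" using K energy_cone_on_mono by blast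
    have rE: "r \<in> EC" using rK by (rule energy_cone_on_EC)
    have rS: "r \<in> ES" using rE by (rule energy_cone_space)
    have rM: "r \<in> energy_cone_closure \<alpha> A"
      unfolding energy_cone_closure_iff using rS rA energy_norm_self[OF rS] by (metis (no_types))
    have "q \<in> energy_cone_on \<alpha> K" using q(1) K energy_cone_on_mono by blast
    then have "nrm (\<mu> - r) \<le> \<delta> + t" using r \<mu>q unfolding is_orth_proj_def by force
    then have "(nrm (\<mu> - r))\<^sup>2 \<le> (\<delta> + t)\<^sup>2"
      using energy_norm_nonneg[OF energy_space_diff[OF \<mu> rS]] by (intro power_mono)
    then have "(nrm (r - p))\<^sup>2 \<le> 2 * ((\<delta> + t)\<^sup>2 - \<delta>\<^sup>2)"
      using orth_proj_close[OF projectable_closure \<mu> p rM] by (simp add: \<delta>_def)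
    also have "\<dots> = 2 * (t * (2 * \<delta> + t))" by (simp add: power2_eq_square algebra_simps)
    also have "\<dots> \<le> 2 * (t * (2 * \<delta> + 1))" using t by (intro mult_left_mono) auto
    also have "\<dots> < e\<^sup>2" by (rule te)
    finally have "nrm (r - p) < e" by (rule power2_less_imp_less) (use e in simp)
    then show "orth_proj \<alpha> (energy_cone_on \<alpha> K) \<mu> \<in> EC" "nrm (orth_proj \<alpha> (energy_cone_on \<alpha> K) \<mu> - p) < e"
      using rE by (simp_all add: r_def)
  qed
qed

lemma sweeps_to_orth_proj:
  assumes \<mu>: "\<mu> \<in> ES" and p: "is_orth_proj \<alpha> (energy_cone_closure \<alpha> A) \<mu> p"
  shows "p \<in> EC" "sweeps_to \<alpha> A \<mu> p"
proof -
  show pE: "p \<in> EC" using p energy_cone_closure_EC by (auto simp: is_orth_proj_def)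
  note c = orth_proj_converges[OF \<mu> p]
  have ev: "\<forall>\<^sub>F K in compact_subsets_at_top A. orth_proj \<alpha> (energy_cone_on \<alpha> K) \<mu> \<in> EC"
    using c[OF zero_less_one] by eventually_elim simp
  have lim: "\<forall>\<^sub>F K in compact_subsets_at_top A. nrm (orth_proj \<alpha> (energy_cone_on \<alpha> K) \<mu> - p) < e" if "0 < e" for e
    using c[OF that] by eventually_elim simp
  have "limitin (strong_topology \<alpha>) (\<lambda>K. orth_proj \<alpha> (energy_cone_on \<alpha> K) \<mu>) p (compact_subsets_at_top A)"
    unfolding limitin_strong_iff
  proof (intro conjI allI impI)
    fix e :: real assume "0 < e"
    from c[OF this] show "\<forall>\<^sub>F K in compact_subsets_at_top A. orth_proj \<alpha> (energy_cone_on \<alpha> K) \<mu> \<in> ES \<and>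
        nrm (orth_proj \<alpha> (energy_cone_on \<alpha> K) \<mu> - p) < e"
      by eventually_elim (use energy_cone_space in blast)
  qed (rule energy_cone_space[OF pE])
  moreover have "limitin vague_topology (\<lambda>K. orth_proj \<alpha> (energy_cone_on \<alpha> K) \<mu>) p (compact_subsets_at_top A)"
    by (rule strong_imp_vague[OF pE ev lim])
  ultimately show "sweeps_to \<alpha> A \<mu> p"
    unfolding sweeps_to_def limitin_subtopology using pE ev by blast
qed

lemma sweeps_to_unique:
  assumes "sweeps_to \<alpha> A \<mu> \<nu>" "sweeps_to \<alpha> A \<mu> \<nu>'" shows "\<nu> = (\<nu>' :: 'a set \<Rightarrow> real)"
proof -
  let ?f = "\<lambda>K. orth_proj \<alpha> (energy_cone_on \<alpha> K) \<mu>"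
  have L: "limitin (strong_topology \<alpha>) ?f \<nu> (compact_subsets_at_top A)"
    "limitin (strong_topology \<alpha>) ?f \<nu>' (compact_subsets_at_top A)"
    using assms unfolding sweeps_to_def limitin_subtopology by auto
  then have S: "\<nu> \<in> ES" "\<nu>' \<in> ES" unfolding limitin_strong_iff by auto
  have "nrm (\<nu> - \<nu>') \<le> 0 + e" if e: "0 < e" for e
  proof -
    have "0 < e / 2" using e by simp
    then have "\<forall>\<^sub>F K in compact_subsets_at_top A. ?f K \<in> ES \<and> nrm (?f K - \<nu>) < e / 2"
      "\<forall>\<^sub>F K in compact_subsets_at_top A. ?f K \<in> ES \<and> nrm (?f K - \<nu>') < e / 2"
      using L unfolding limitin_strong_iff by blast+
    from eventually_conj[OF this]
    \<comment> \<open>The filter is proper: conditions that hold eventually hold together for some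
      K.\<close>
    obtain K where K: "?f K \<in> ES" "nrm (?f K - \<nu>) < e / 2" "nrm (?f K - \<nu>') < e / 2"
      unfolding eventually_compact_subsets_at_top by blast
    show ?thesis using energy_norm_triangle[OF S(1) K(1) S(2)] energy_norm_sym[OF S(1) K(1)] K by linarith
  qed
  then have "nrm (\<nu> - \<nu>') \<le> 0" by (rule field_le_epsilon)
  then have "nrm (\<nu> - \<nu>') = 0" using energy_norm_nonneg[OF energy_space_diff[OF S]] by simp
  then show ?thesis by (rule energy_norm_definite[OF S])
qed

end

theorem theorem3p4:
  fixes A :: "(real ^ 'n) set" and \<alpha> :: real and \<mu> :: "(real ^ 'n) set \<Rightarrow> real"
  assumes "3 \<le> CARD('n)" and "0 < \<alpha>" and "\<alpha> \<le> 2"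
    and "A \<subset> UNIV" and "0 < inner_capacity \<alpha> A" and "\<mu> \<in> energy_cone \<alpha>"
  shows "(\<exists>!\<mu>A. \<mu>A \<in> energy_cone \<alpha> \<and> sweeps_to \<alpha> A \<mu> \<mu>A) \<and>
    (\<forall>\<mu>A. \<mu>A \<in> energy_cone \<alpha> \<and> sweeps_to \<alpha> A \<mu> \<mu>A \<longleftrightarrow>
       is_orth_proj \<alpha> (energy_cone_closure \<alpha> A) \<mu> \<mu>A)"
proof -
  \<comment> \<open>The exponent \<alpha> - n of the kernel is negative, as the representation by
    balls requires: the kernel is infinite on the diagonal and decays at infinity.\<close>
  have "\<alpha> < real CARD('n)" using assms(1,3) by linarith
  then obtain c where c: "0 < c"
    "\<And>x y :: real ^ 'n. riesz_kernel \<alpha> x y = ball_kernel c (\<alpha> - 2 * real CARD('n) - 1) x y"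
    by (rule riesz_kernel_eq_ball_kernel) blast
  interpret ball_represented_kernel \<alpha> c "\<alpha> - 2 * real CARD('n) - 1" "TYPE(real ^ 'n)"
    by unfold_locales (use c in auto)
  have \<mu>: "\<mu> \<in> ES" using assms(6) by (rule energy_cone_space)
  obtain p where p: "is_orth_proj \<alpha> (energy_cone_closure \<alpha> A) \<mu> p"
    using orth_proj_exists[OF projectable_closure \<mu>] by metis
  note sw = sweeps_to_orth_proj[OF \<mu> p]
  \<comment> \<open>Existence, uniqueness and the equivalence all follow once both conditions are
    seen to characterize the same measure p.\<close>
  have iff: "\<nu> \<in> energy_cone \<alpha> \<and> sweeps_to \<alpha> A \<mu> \<nu> \<longleftrightarrow> \<nu> = p" for \<nu>
    using sw sweeps_to_unique[of A \<mu> \<nu> p] by blast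
  have "is_orth_proj \<alpha> (energy_cone_closure \<alpha> A) \<mu> \<nu> \<longleftrightarrow> \<nu> = p" for \<nu>
    using p orth_proj_unique[OF projectable_closure \<mu>, of A \<nu> p] by blast
  then show ?thesis unfolding iff by simp
qed

end
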